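(* Let $M$ be a closed Riemannian manifold and let $f_k\colon M\to N_k$ be a sequence of continuous maps of $M$ into (possibly incomplete) Riemannian $n$-manifolds $N_k$. Assume that for each $k$ there exists a compact domain $U_k\subset N_k$ with $U_k\supset f_k(M)$ such that the family $\{U_k\}$ has uniformly bounded geometry. Assume that either (i) $\{f_k\}$ is almost equicontinuous, or (ii) each $f_k$ is a homotopy equivalence with a homotopy inverse $g_k\colon N_k\to M$ such that $\{g_k\}$ is almost equicontinuous. Then, for any $S(M)$-valued invariant of maps $\iota$, the subset $\{\iota(f_k)\}$ of $S(M)$ is finite.
   Context: Equicontinuity. A family of maps of metric spaces $f_\alpha\colon X_\alpha\to Y_\alpha$ is $\epsilon$-equicontinuous if there exists $\delta>0$ such that $d_{Y_\alpha}(f_\alpha(x),f_\alpha(x'))<\epsilon$ for any $\alpha$ and any $x,x'\in X_\alpha$ with $d_{X_\alpha}(x,x')<\delta$. The family is almost equicontinuous if for any $\epsilon>0$ there is a finite subset of $\{f_\alpha\}$ whose complement is $\epsilon$-equicontinuous. Bounded geometry. A compact domain in a manifold is a compact codimension zero topological submanifold. A family $\{U_\alpha\}$ of compact domains of Riemannian $n$-manifolds $N_\alpha$ has uniformly bounded geometry if any sequence of domains in the family has a subsequence $\{U_k\}$ such that there exist a metric space $V$ and homeomorphisms $h_k\colon V\to V_k$ of $V$ onto compact domains $V_k\supset U_k$ (in $N_k$) such that both $\{h_k\}$ and $\{h_k^{-1}\}$ are almost equicontinuous. Invariants of maps. Let $B$ be a topological space and $S(B)$ a set. For a smooth manifold $N$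 let $C(B,N)$ be the set of continuous maps $B\to N$. Suppose that for every smooth manifold $N$ there is a map $\iota\colon C(B,N)\to S(B)$. Then $\iota$ is called an $S(B)$-valued invariant of maps of $B$ if: (1) homotopic maps $f_1,f_2\colon B\to N$ have the same invariant; (2) if $h\colon N\to L$ is a homeomorphism of $N$ onto an open subset of $L$, then for any continuous $f\colon B\to N$ the maps $f\colon B\to N$ and $h\circ f\colon B\to L$ have the same invariant. *)

theory Defs
  imports "HOL-Analysis.Analysis"
begin

section \<open>Smooth functions on open subsets of Euclidean n-space\<close>

text \<open>
  The dimension has to be a natural number rather than a type, since invariants of maps range over
  manifolds of all dimensions.  The model space is therefore \<^const>\<open>Euclidean_space\<close>, whose points
  are the functions \<open>nat \<Rightarrow> real\<close> vanishing from index \<open>n\<close> on.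
\<close>

definition partial_deriv :: "nat \<Rightarrow> ((nat \<Rightarrow> real) \<Rightarrow> real) \<Rightarrow> (nat \<Rightarrow> real) \<Rightarrow> real" where
  "partial_deriv i F x = deriv (\<lambda>t. F (x(i := t))) (x i)"

primrec partial_derivs :: "nat list \<Rightarrow> ((nat \<Rightarrow> real) \<Rightarrow> real) \<Rightarrow> (nat \<Rightarrow> real) \<Rightarrow> real" where
  "partial_derivs [] F = F"
| "partial_derivs (i # is) F = partial_deriv i (partial_derivs is F)"

text \<open>Smoothness on a set \<open>A\<close>, meant to be open in \<^term>\<open>Euclidean_space n\<close>: the partial derivatives
  of all orders exist and are continuous.\<close>

definition smooth_on :: "nat \<Rightarrow> (nat \<Rightarrow> real) set \<Rightarrow> ((nat \<Rightarrow> real) \<Rightarrow> real) \<Rightarrow> bool" where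
  "smooth_on n A F \<longleftrightarrow>
     (\<forall>is. set is \<subseteq> {..<n} \<longrightarrow>
        continuous_map (subtopology (Euclidean_space n) A) euclideanreal (partial_derivs is F) \<and>
        (\<forall>i<n. \<forall>x\<in>A. (\<lambda>t. partial_derivs is F (x(i := t))) differentiable at (x i)))"


section \<open>Smooth manifolds\<close>

text \<open>A chart is given by its domain and its coordinate map (with irrelevant values off the domain).\<close>

type_synonym 'a chart = "'a set \<times> ('a \<Rightarrow> nat \<Rightarrow> real)"

definition chart_image :: "'a chart \<Rightarrow> (nat \<Rightarrow> real) set" where
  "chart_image c = snd c ` fst c"

definition chart_inv :: "'a chart \<Rightarrow> (nat \<Rightarrow> real) \<Rightarrow> 'a" where
  "chart_inv c = inv_into (fst c) (snd c)"

definition is_chart :: "nat \<Rightarrow> 'a topology \<Rightarrow> 'a chart \<Rightarrow> bool" where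
  "is_chart n X c \<longleftrightarrow>
     openin X (fst c) \<and> openin (Euclidean_space n) (chart_image c) \<and>
     homeomorphic_map (subtopology X (fst c)) (subtopology (Euclidean_space n) (chart_image c)) (snd c)"

definition transition :: "'a chart \<Rightarrow> 'a chart \<Rightarrow> nat \<Rightarrow> (nat \<Rightarrow> real) \<Rightarrow> real" where
  "transition c c' i x = snd c' (chart_inv c x) i"

record 'a smooth_mfd =
  mtop :: "'a topology"
  mdim :: nat
  atlas :: "'a chart set"

text \<open>Manifolds have no boundary and need not be connected.  The atlas is not required to be maximal.\<close>

definition smooth_manifold :: "'a smooth_mfd \<Rightarrow> bool" where
  "smooth_manifold N \<longleftrightarrow>
     Hausdorff_space (mtop N) \<and> second_countable (mtop N) \<and>
     (\<forall>c\<in>atlas N. is_chart (mdim N) (mtop N) c) \<and>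
     (\<Union>c\<in>atlas N. fst c) = topspace (mtop N) \<and>
     (\<forall>c\<in>atlas N. \<forall>c'\<in>atlas N. \<forall>i<mdim N.
        smooth_on (mdim N) (snd c ` (fst c \<inter> fst c')) (transition c c' i))"


section \<open>Riemannian metrics and the Riemannian distance\<close>

text \<open>A metric tensor \<open>g\<close> is given by its components: \<open>g c p i j\<close> is the component with indices
  \<open>i, j < n\<close>, at the point \<open>p\<close>, in the chart \<open>c\<close>.\<close>

type_synonym 'a metric_tensor = "'a chart \<Rightarrow> 'a \<Rightarrow> nat \<Rightarrow> nat \<Rightarrow> real"

definition riemannian_metric :: "'a smooth_mfd \<Rightarrow> 'a metric_tensor \<Rightarrow> bool" where
  "riemannian_metric N g \<longleftrightarrow>
     (\<forall>c\<in>atlas N. \<forall>i<mdim N. \<forall>j<mdim N.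
        smooth_on (mdim N) (chart_image c) (\<lambda>x. g c (chart_inv c x) i j)) \<and>
     (\<forall>c\<in>atlas N. \<forall>p\<in>fst c. \<forall>i<mdim N. \<forall>j<mdim N. g c p i j = g c p j i) \<and>
     (\<forall>c\<in>atlas N. \<forall>p\<in>fst c. \<forall>v. (\<exists>i<mdim N. v i \<noteq> 0) \<longrightarrow>
        0 < (\<Sum>i<mdim N. \<Sum>j<mdim N. g c p i j * v i * v j)) \<and>
     (\<forall>c\<in>atlas N. \<forall>c'\<in>atlas N. \<forall>p\<in>fst c \<inter> fst c'. \<forall>i<mdim N. \<forall>j<mdim N.
        g c p i j =
          (\<Sum>k<mdim N. \<Sum>l<mdim N.
             partial_deriv i (transition c c' k) (snd c p) *
             partial_deriv j (transition c c' l) (snd c p) * g c' p k l))"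

definition riemannian_manifold :: "'a smooth_mfd \<Rightarrow> 'a metric_tensor \<Rightarrow> bool" where
  "riemannian_manifold N g \<longleftrightarrow> smooth_manifold N \<and> riemannian_metric N g"

definition closed_riemannian_manifold :: "'a smooth_mfd \<Rightarrow> 'a metric_tensor \<Rightarrow> bool" where
  "closed_riemannian_manifold N g \<longleftrightarrow> riemannian_manifold N g \<and> compact_space (mtop N)"

definition C1_arc_on :: "'a smooth_mfd \<Rightarrow> (real \<Rightarrow> 'a) \<Rightarrow> real \<Rightarrow> real \<Rightarrow> bool" where
  "C1_arc_on N \<gamma> a b \<longleftrightarrow>
     (\<forall>c\<in>atlas N. \<forall>i<mdim N. \<exists>D.
        continuous_on {t\<in>{a..b}. \<gamma> t \<in> fst c} D \<and>
        (\<forall>t\<in>{a..b}. \<gamma> t \<in> fst c \<longrightarrow>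
           ((\<lambda>s. snd c (\<gamma> s) i) has_real_derivative D t) (at t within {a..b})))"

definition piecewise_C1_curve :: "'a smooth_mfd \<Rightarrow> (real \<Rightarrow> 'a) \<Rightarrow> bool" where
  "piecewise_C1_curve N \<gamma> \<longleftrightarrow>
     pathin (mtop N) \<gamma> \<and>
     (\<exists>m (\<tau> :: nat \<Rightarrow> real). \<tau> 0 = 0 \<and> \<tau> m = 1 \<and>
        (\<forall>k<m. \<tau> k < \<tau> (Suc k) \<and> C1_arc_on N \<gamma> (\<tau> k) (\<tau> (Suc k))))"

text \<open>By the transformation law the speed does not depend on the chart, except at the finitely many
  break points and end points, which do not affect the length.\<close>

definition speed :: "'a smooth_mfd \<Rightarrow> 'a metric_tensor \<Rightarrow> (real \<Rightarrow> 'a) \<Rightarrow> real \<Rightarrow> real" where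
  "speed N g \<gamma> t =
     (let c = (SOME c. c \<in> atlas N \<and> \<gamma> t \<in> fst c);
          v = (\<lambda>i. deriv (\<lambda>s. snd c (\<gamma> s) i) t)
      in sqrt (\<Sum>i<mdim N. \<Sum>j<mdim N. g c (\<gamma> t) i j * v i * v j))"

definition curve_length :: "'a smooth_mfd \<Rightarrow> 'a metric_tensor \<Rightarrow> (real \<Rightarrow> 'a) \<Rightarrow> real" where
  "curve_length N g \<gamma> = integral {0..1} (speed N g \<gamma>)"

text \<open>The distance is \<open>\<infinity>\<close> between points of different components, as the infimum is taken in
  \<^typ>\<open>ennreal\<close>.\<close>

definition riem_dist :: "'a smooth_mfd \<Rightarrow> 'a metric_tensor \<Rightarrow> 'a \<Rightarrow> 'a \<Rightarrow> ennreal" where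
  "riem_dist N g x y =
     (INF \<gamma> \<in> {\<gamma>. piecewise_C1_curve N \<gamma> \<and> \<gamma> 0 = x \<and> \<gamma> 1 = y}. ennreal (curve_length N g \<gamma>))"


section \<open>Equicontinuity\<close>

text \<open>Families are indexed by a set \<open>I\<close>; the map \<open>f \<alpha>\<close> is defined on \<open>X \<alpha>\<close> with distance
  \<open>dX \<alpha>\<close>, and distances in the target are measured by \<open>dY \<alpha>\<close>.  Distances are \<^typ>\<open>ennreal\<close>-valued
  so as to include Riemannian distances on manifolds that are not connected.\<close>

definition eps_equicontinuous ::
  "real \<Rightarrow> 'i set \<Rightarrow> ('i \<Rightarrow> 'x set) \<Rightarrow> ('i \<Rightarrow> 'x \<Rightarrow> 'x \<Rightarrow> ennreal) \<Rightarrow> ('i \<Rightarrow> 'y \<Rightarrow> 'y \<Rightarrow> ennreal) \<Rightarrow>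
   ('i \<Rightarrow> 'x \<Rightarrow> 'y) \<Rightarrow> bool" where
  "eps_equicontinuous \<epsilon> I X dX dY f \<longleftrightarrow>
     (\<exists>\<delta>>0. \<forall>\<alpha>\<in>I. \<forall>x\<in>X \<alpha>. \<forall>x'\<in>X \<alpha>.
        dX \<alpha> x x' < ennreal \<delta> \<longrightarrow> dY \<alpha> (f \<alpha> x) (f \<alpha> x') < ennreal \<epsilon>)"

definition almost_equicontinuous ::
  "'i set \<Rightarrow> ('i \<Rightarrow> 'x set) \<Rightarrow> ('i \<Rightarrow> 'x \<Rightarrow> 'x \<Rightarrow> ennreal) \<Rightarrow> ('i \<Rightarrow> 'y \<Rightarrow> 'y \<Rightarrow> ennreal) \<Rightarrow>
   ('i \<Rightarrow> 'x \<Rightarrow> 'y) \<Rightarrow> bool" where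
  "almost_equicontinuous I X dX dY f \<longleftrightarrow>
     (\<forall>\<epsilon>>0. \<exists>F. finite F \<and> F \<subseteq> I \<and> eps_equicontinuous \<epsilon> (I - F) X dX dY f)"


section \<open>Compact domains and uniformly bounded geometry\<close>

text \<open>The closed half-space \<open>x\<^sub>0 \<ge> 0\<close>; for \<open>n = 0\<close> this is a point.\<close>

definition half_space :: "nat \<Rightarrow> (nat \<Rightarrow> real) topology" where
  "half_space n = subtopology (Euclidean_space n) {x. n = 0 \<or> 0 \<le> x 0}"

text \<open>A compact subset that, with the subspace topology, is a topological manifold with (possibly
  empty) boundary, of the same dimension.\<close>

definition compact_domain :: "'a smooth_mfd \<Rightarrow> 'a set \<Rightarrow> bool" where
  "compact_domain N U \<longleftrightarrow>
     compactin (mtop N) U \<and>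
     (\<forall>x\<in>U. \<exists>W H. x \<in> W \<and> openin (subtopology (mtop N) U) W \<and> openin (half_space (mdim N)) H \<and>
        subtopology (mtop N) W homeomorphic_space subtopology (half_space (mdim N)) H)"

text \<open>The metric space \<open>V\<close> may be taken with carrier in the type of points of the manifolds, because it
  is in bijection with subsets of them.  Domains carry the restriction of the Riemannian distance of the
  ambient manifold.\<close>

definition uniformly_bounded_geometry ::
  "nat \<Rightarrow> 'i set \<Rightarrow> ('i \<Rightarrow> 'a smooth_mfd) \<Rightarrow> ('i \<Rightarrow> 'a metric_tensor) \<Rightarrow> ('i \<Rightarrow> 'a set) \<Rightarrow> bool" where
  "uniformly_bounded_geometry n I N g U \<longleftrightarrow>
     (\<forall>\<alpha>\<in>I. riemannian_manifold (N \<alpha>) (g \<alpha>) \<and> mdim (N \<alpha>) = n \<and> compact_domain (N \<alpha>) (U \<alpha>)) \<and>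
     (\<forall>\<sigma> :: nat \<Rightarrow> 'i. range \<sigma> \<subseteq> I \<longrightarrow>
        (\<exists>r. strict_mono r \<and>
          (let N' = (\<lambda>k :: nat. N (\<sigma> (r k)));
               U' = (\<lambda>k. U (\<sigma> (r k)));
               d' = (\<lambda>k. riem_dist (N (\<sigma> (r k))) (g (\<sigma> (r k))))
           in \<exists>(V :: 'a metric) V' h h'.
                (\<forall>k. compact_domain (N' k) (V' k) \<and> U' k \<subseteq> V' k \<and>
                   homeomorphic_maps (mtopology_of V) (subtopology (mtop (N' k)) (V' k)) (h k) (h' k)) \<and>
                almost_equicontinuous UNIV (\<lambda>k. mspace V) (\<lambda>k x y. ennreal (mdist V x y)) d' h \<and>
                almost_equicontinuous UNIV V' d' (\<lambda>k x y. ennreal (mdist V x y)) h')))"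


section \<open>Homotopy inverses and invariants of maps\<close>

definition homotopy_inverse :: "'a topology \<Rightarrow> 'b topology \<Rightarrow> ('a \<Rightarrow> 'b) \<Rightarrow> ('b \<Rightarrow> 'a) \<Rightarrow> bool" where
  "homotopy_inverse X Y f g \<longleftrightarrow>
     continuous_map X Y f \<and> continuous_map Y X g \<and>
     homotopic_with (\<lambda>_. True) X X (g \<circ> f) id \<and>
     homotopic_with (\<lambda>_. True) Y Y (f \<circ> g) id"

text \<open>The manifolds range over all smooth manifolds with points in a given, arbitrary, type.  Elements of
  \<open>C(B, N)\<close> are represented by total functions; as functions agreeing on \<open>topspace B\<close> are homotopic, the
  homotopy condition ensures that the values off \<open>topspace B\<close> are irrelevant.\<close>

definition invariant_of_maps ::
  "'b topology \<Rightarrow> 's set \<Rightarrow> ('a smooth_mfd \<Rightarrow> ('b \<Rightarrow> 'a) \<Rightarrow> 's) \<Rightarrow> bool" where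
  "invariant_of_maps B S \<iota> \<longleftrightarrow>
     (\<forall>N f. smooth_manifold N \<and> continuous_map B (mtop N) f \<longrightarrow> \<iota> N f \<in> S) \<and>
     (\<forall>N f1 f2. smooth_manifold N \<and> homotopic_with (\<lambda>_. True) B (mtop N) f1 f2 \<longrightarrow>
        \<iota> N f1 = \<iota> N f2) \<and>
     (\<forall>N L h f. smooth_manifold N \<and> smooth_manifold L \<and>
        embedding_map (mtop N) (mtop L) h \<and> openin (mtop L) (h ` topspace (mtop N)) \<and>
        continuous_map B (mtop N) f \<longrightarrow> \<iota> N f = \<iota> L (h \<circ> f))"

end

theory Submission
  imports Defs "HOL-Homology.Invariance_of_Domain"
begin

text \<open>
Suppose that the set of invariants is infinite and pass to a subsequence along which they are pairwise
distinct.  Bounded geometry provides, after passing to a further subsequence, one compact metric space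
\<open>V\<close>, which is a topological \<open>n\<close>-manifold with boundary, and homeomorphisms \<open>h\<^sub>k\<close> of \<open>V\<close> onto compact
domains containing \<open>f\<^sub>k(M)\<close>, such that the \<open>h\<^sub>k\<close> and their inverses are almost equicontinuous.  Put
\<open>u\<^sub>k = h\<^sub>k\<^sup>-\<^sup>1 f\<^sub>k : M \<rightarrow> V\<close>.  It suffices to find two indices with the same invariant.  Three facts are used.

\<^item> The invariant of \<open>h\<^sub>k u : M \<rightarrow> N\<^sub>k\<close> depends on the homotopy class of \<open>u : M \<rightarrow> V\<close> only, and not on \<open>k\<close>
  (\<open>invariant_of_maps_transfer\<close>).  Indeed \<open>V\<close> can be pushed off its boundary
  (\<open>push_into_interior\<close>); by invariance of domain \<open>h\<^sub>k\<close> maps the interior of \<open>V\<close> onto an open subset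
  of \<open>N\<^sub>k\<close>, which is a smooth manifold, and \<open>h\<^sub>l h\<^sub>k\<^sup>-\<^sup>1\<close> embeds this manifold as an open subset of \<open>N\<^sub>l\<close>.

\<^item> In a compact manifold, with or without boundary, maps that are sufficiently close are homotopic
  (\<open>locally_equiconnected\<close>, \<open>near_maps_homotopic\<close>).

\<^item> An almost equicontinuous sequence of maps from a totally bounded space to a compact space has two
  members that are as close as desired (\<open>almost_equicontinuous_close_pair\<close>).  This is the part of the
  Arzela-Ascoli theorem that is relevant here, and it is a pigeonhole argument.

If \<open>{f\<^sub>k}\<close> is almost equicontinuous, then so is \<open>{u\<^sub>k}\<close>; hence some \<open>u\<^sub>k\<close> and \<open>u\<^sub>l\<close> are homotopic,
and \<open>f\<^sub>k\<close> and \<open>f\<^sub>l\<close> have the same invariant.  If instead the homotopy inverses \<open>g\<^sub>k\<close> are almost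
equicontinuous, then so are the maps \<open>g\<^sub>k h\<^sub>k : V \<rightarrow> M\<close>, and some \<open>g\<^sub>k h\<^sub>k\<close> and \<open>g\<^sub>l h\<^sub>l\<close> are homotopic.
Therefore \<open>f\<^sub>l \<simeq> f\<^sub>l g\<^sub>k f\<^sub>k = f\<^sub>l g\<^sub>k h\<^sub>k u\<^sub>k \<simeq> f\<^sub>l g\<^sub>l h\<^sub>l u\<^sub>k \<simeq> h\<^sub>l u\<^sub>k\<close>, and the invariant of the latter is that
of \<open>h\<^sub>k u\<^sub>k = f\<^sub>k\<close>.

The Riemannian metric of \<open>M\<close> matters only through two properties of its distance function.  In the
first case finitely many small distance balls have to cover \<open>M\<close>, which needs an upper bound for the
distance of nearby points: a straight segment in a chart is short (\<open>riem_dist_small_near\<close>).  In the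
second case points at a small distance have to be close in the topology of \<open>M\<close>, which needs a lower
bound: a curve that leaves a coordinate box is long (\<open>riem_dist_controls_topology\<close>).
\<close>

section \<open>Straight-line deformations in convex charts\<close>

definition lin_comb :: "real \<Rightarrow> (nat \<Rightarrow> real) \<Rightarrow> (nat \<Rightarrow> real) \<Rightarrow> nat \<Rightarrow> real" where
  "lin_comb s y z = (\<lambda>i. (1 - s) * y i + s * z i)"

text \<open>The coordinates are taken in \<^typ>\<open>nat \<Rightarrow> real\<close>, so that a convex set may be an open box in a
Euclidean space of any dimension or the intersection of a box with a half-space.  This treats
boundary points and interior points of a manifold alike.\<close>

definition convex_chart ::
  "'a topology \<Rightarrow> 'a set \<Rightarrow> (nat \<Rightarrow> real) set \<Rightarrow> ('a \<Rightarrow> nat \<Rightarrow> real) \<Rightarrow> ((nat \<Rightarrow> real) \<Rightarrow> 'a) \<Rightarrow> bool" where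
  "convex_chart X W C \<phi> \<psi> \<longleftrightarrow>
     openin X W \<and> (\<forall>y\<in>C. \<forall>z\<in>C. \<forall>s\<in>{0..1}. lin_comb s y z \<in> C) \<and>
     homeomorphic_maps (subtopology X W) (top_of_set C) \<phi> \<psi>"

lemma convex_chartD:
  assumes "convex_chart X W C \<phi> \<psi>"
  shows "openin X W" "continuous_map (subtopology X W) (top_of_set C) \<phi>"
    "continuous_map (top_of_set C) (subtopology X W) \<psi>"
    "\<And>x. x \<in> W \<Longrightarrow> \<phi> x \<in> C" "\<And>x. x \<in> W \<Longrightarrow> \<psi> (\<phi> x) = x"
    "\<And>y. y \<in> C \<Longrightarrow> \<psi> y \<in> W" "\<And>y. y \<in> C \<Longrightarrow> \<phi> (\<psi> y) = y"
    "\<And>y z s. y \<in> C \<Longrightarrow> z \<in> C \<Longrightarrow> 0 \<le> s \<Longrightarrow> s \<le> 1 \<Longrightarrow> lin_comb s y z \<in> C"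
proof -
  have W: "topspace (subtopology X W) = W"
    using assms openin_subset unfolding convex_chart_def by fastforce
  have h: "homeomorphic_maps (subtopology X W) (top_of_set C) \<phi> \<psi>"
    using assms by (auto simp: convex_chart_def)
  show "openin X W" "\<And>y z s. y \<in> C \<Longrightarrow> z \<in> C \<Longrightarrow> 0 \<le> s \<Longrightarrow> s \<le> 1 \<Longrightarrow> lin_comb s y z \<in> C"
    using assms by (auto simp: convex_chart_def)
  show c1: "continuous_map (subtopology X W) (top_of_set C) \<phi>"
    and c2: "continuous_map (top_of_set C) (subtopology X W) \<psi>"
    using h by (auto simp: homeomorphic_maps_def)
  show "\<And>x. x \<in> W \<Longrightarrow> \<psi> (\<phi> x) = x" "\<And>y. y \<in> C \<Longrightarrow> \<phi> (\<psi> y) = y"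
    using h unfolding homeomorphic_maps_def W by auto
  show "\<And>x. x \<in> W \<Longrightarrow> \<phi> x \<in> C" "\<And>y. y \<in> C \<Longrightarrow> \<psi> y \<in> W"
    using continuous_map_image_subset_topspace[OF c1] continuous_map_image_subset_topspace[OF c2] W
    by auto
qed

lemma continuous_map_fun_euclidean:
  "continuous_map X (euclidean :: (nat \<Rightarrow> real) topology) f \<longleftrightarrow>
     (\<forall>i. continuous_map X euclideanreal (\<lambda>x. f x i))"
  by (metis continuous_map_componentwise_UNIV euclidean_product_topology)

text \<open>Inside the chart, \<open>a\<close> is moved towards \<open>b\<close> along segments, as far as \<open>l\<close> prescribes.  Since \<open>l\<close>
vanishes off \<open>K\<close>, the homotopy extends by the constant one: the two formulas are pasted along the
closed sets \<open>K\<close> and \<open>{l = 0}\<close>, which cover \<open>T\<close>.\<close>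

lemma chart_deformation:
  assumes ch: "convex_chart X W C \<phi> \<psi>"
    and a: "continuous_map T X a" and b: "continuous_map T X b"
    and l: "continuous_map T (top_of_set {0..1}) l"
    and K: "closedin T K" and l0: "\<And>t. t \<in> topspace T \<Longrightarrow> t \<notin> K \<Longrightarrow> l t = 0"
    and aK: "a ` K \<subseteq> W" and bK: "b ` K \<subseteq> W"
  obtains p where "continuous_map T X p" "homotopic_with (\<lambda>_. True) T X a p"
    "\<And>t. t \<in> topspace T \<Longrightarrow> l t = 0 \<Longrightarrow> p t = a t"
    "\<And>t. t \<in> K \<Longrightarrow> p t = \<psi> (lin_comb (l t) (\<phi> (a t)) (\<phi> (b t)))"
proof -
  note chD = convex_chartD[OF ch]
  let ?I = "top_of_set {0..1::real}"
  define Z where "Z = {t \<in> topspace T. l t = 0}"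
  have KT: "K \<subseteq> topspace T" using K closedin_subset by blast
  have Z: "closedin T Z"
    using closedin_continuous_map_preimage[OF l, of "{0}"] by (simp add: Z_def)
  have l01: "0 \<le> l t \<and> l t \<le> 1" if "t \<in> topspace T" for t
    using l that by (auto dest!: continuous_map_image_subset_topspace)
  define q where "q = (\<lambda>(s::real, t). \<psi> (lin_comb (s * l t) (\<phi> (a t)) (\<phi> (b t))))"
  define h where "h = (\<lambda>(s::real, t). if t \<in> K then q (s, t) else a t)"
  have aW: "continuous_map (subtopology T K) (subtopology X W) a"
    and bW: "continuous_map (subtopology T K) (subtopology X W) b"
    using a b aK bK KT by (auto simp: continuous_map_in_subtopology continuous_map_from_subtopology)
  have fa: "continuous_map (subtopology T K) euclidean (\<phi> \<circ> a)"
    and fb: "continuous_map (subtopology T K) euclidean (\<phi> \<circ> b)"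
    using continuous_map_compose[OF aW chD(2)] continuous_map_compose[OF bW chD(2)]
    by (auto simp: continuous_map_in_subtopology)
  have lK: "continuous_map (subtopology T K) euclideanreal l"
    using l by (simp add: continuous_map_in_subtopology continuous_map_from_subtopology)
  let ?Q = "prod_topology ?I (subtopology T K)"
  have cs: "continuous_map ?Q euclideanreal fst"
    using continuous_map_fst[of ?I "subtopology T K"] by (simp add: continuous_map_in_subtopology)
  have lin: "continuous_map ?Q (top_of_set C) (\<lambda>(s, t). lin_comb (s * l t) (\<phi> (a t)) (\<phi> (b t)))"
    unfolding continuous_map_in_subtopology
  proof
    have "continuous_map ?Q euclideanreal (\<lambda>u. \<phi> (a (snd u)) i)"
      "continuous_map ?Q euclideanreal (\<lambda>u. \<phi> (b (snd u)) i)" for i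
      using fa fb continuous_map_compose[OF continuous_map_snd[of ?I "subtopology T K"], of euclideanreal]
      by (auto simp: continuous_map_fun_euclidean o_def)
    moreover have "continuous_map ?Q euclideanreal (\<lambda>u. l (snd u))"
      using continuous_map_compose[OF continuous_map_snd lK] by (simp add: o_def)
    ultimately show "continuous_map ?Q euclidean (\<lambda>(s, t). lin_comb (s * l t) (\<phi> (a t)) (\<phi> (b t)))"
      using cs unfolding continuous_map_fun_euclidean lin_comb_def case_prod_beta
      by (intro allI continuous_intros) auto
    show "(\<lambda>(s, t). lin_comb (s * l t) (\<phi> (a t)) (\<phi> (b t))) \<in> topspace ?Q \<rightarrow> C"
      using chD(4,8) aK bK l01 by (auto simp: Pi_iff image_subset_iff mult_le_one)
  qed
  have cq: "continuous_map ?Q X q"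
    using continuous_map_compose[OF lin chD(3)]
    by (simp add: continuous_map_in_subtopology q_def o_def case_prod_beta')
  have psia: "\<psi> (lin_comb 0 (\<phi> (a t)) (\<phi> (b t))) = a t" if "t \<in> K" for t
    using that aK chD(5) by (auto simp: lin_comb_def)
  have hc: "continuous_map (prod_topology ?I T) X h"
  proof (rule pasting_lemma_closed[where I="{True,False}" and T="\<lambda>b. {0..1} \<times> (if b then K else Z)"
        and f="\<lambda>b. if b then q else a \<circ> snd"])
    show "closedin (prod_topology ?I T) ({0..1} \<times> (if i then K else Z))" for i
      using K Z by (auto simp: closedin_prod_Times_iff)
    show "continuous_map (subtopology (prod_topology ?I T) ({0..1} \<times> (if i then K else Z))) X
            (if i then q else a \<circ> snd)" for i
    proof (cases i)
      case True
      have "subtopology (prod_topology ?I T) ({0..1} \<times> K) = ?Q"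
        by (simp add: prod_topology_subtopology)
      with True cq show ?thesis by simp
    next
      case False
      then show ?thesis
        by (auto intro!: continuous_map_from_subtopology continuous_map_compose[OF continuous_map_snd a])
    qed
    show "(if i then q else a \<circ> snd) x = (if j then q else a \<circ> snd) x"
      if x: "x \<in> topspace (prod_topology ?I T) \<inter> ({0..1} \<times> (if i then K else Z)) \<inter> ({0..1} \<times> (if j then K else Z))"
      for i j x
    proof -
      have "q x = a (snd x)" if "snd x \<in> K" "l (snd x) = 0"
        using psia[OF that(1)] that(2) by (simp add: q_def case_prod_beta)
      moreover have "snd x \<in> Z" if "\<not> i \<or> \<not> j" using that x by (auto split: if_splits)
      moreover have "snd x \<in> K" if "i \<or> j" using that x by (auto split: if_splits)
      ultimately show ?thesis by (cases i; cases j) (simp_all add: Z_def)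
    qed
    show "\<exists>j. j \<in> {True, False} \<and> x \<in> {0..1} \<times> (if j then K else Z) \<and> h x = (if j then q else a \<circ> snd) x"
      if "x \<in> topspace (prod_topology ?I T)" for x
    proof -
      have x: "fst x \<in> {0..1}" "snd x \<in> topspace T" using that by auto
      show ?thesis
      proof (cases "snd x \<in> K")
        case True
        then show ?thesis using x by (intro exI[of _ True]) (simp add: h_def mem_Times_iff case_prod_beta)
      next
        case False
        then show ?thesis using x l0 by (intro exI[of _ False]) (simp add: h_def Z_def mem_Times_iff case_prod_beta)
      qed
    qed
  qed auto
  define p where "p = (\<lambda>t. h (1, t))"
  show ?thesis
  proof
    show "homotopic_with (\<lambda>_. True) T X a p"
      unfolding homotopic_with[of T "\<lambda>_. True", simplified]
      using hc psia by (intro exI[of _ h]) (auto simp: h_def q_def p_def)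
    then show "continuous_map T X p"
      using homotopic_with_imp_continuous_maps by blast
    show "p t = a t" if "t \<in> topspace T" "l t = 0" for t
      using that psia by (auto simp: p_def h_def q_def)
    show "p t = \<psi> (lin_comb (l t) (\<phi> (a t)) (\<phi> (b t)))" if "t \<in> K" for t
      using that by (simp add: p_def h_def q_def)
  qed
qed

text \<open>Urysohn's lemma between two nested closed neighbourhoods of \<open>x\<close>.\<close>

lemma bump_function:
  assumes "compact_space X" "Hausdorff_space X" "openin X W" "x \<in> W"
  obtains A K l where "openin X A" "x \<in> A" "closedin X K" "A \<subseteq> K" "K \<subseteq> W"
    "continuous_map X (top_of_set {0..1::real}) l" "\<And>y. y \<in> A \<Longrightarrow> l y = 1"
    "\<And>y. y \<in> topspace X \<Longrightarrow> y \<notin> K \<Longrightarrow> l y = 0"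
proof -
  have nb: "neighbourhood_base_of (closedin X) X"
    using assms compact_Hausdorff_imp_regular_space neighbourhood_base_of_closedin by blast
  then obtain W' K where K: "openin X W'" "closedin X K" "x \<in> W'" "W' \<subseteq> K" "K \<subseteq> W"
    using assms by (metis neighbourhood_base_of)
  with nb obtain A L where A: "openin X A" "closedin X L" "x \<in> A" "A \<subseteq> L" "L \<subseteq> W'"
    by (metis neighbourhood_base_of)
  have "normal_space X"
    using assms compact_Hausdorff_or_regular_imp_normal_space by blast
  then obtain l where l: "continuous_map X (top_of_set {0..1::real}) l"
      "l ` (topspace X - W') \<subseteq> {0}" "l ` L \<subseteq> {1}"
    using Urysohn_lemma[of X "topspace X - W'" L 0 1] A K by (auto simp: disjnt_iff)
  show ?thesis
    by (rule that[of A K l]) (use A K l in \<open>auto simp: image_subset_iff\<close>)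
qed

section \<open>Nearby maps are homotopic\<close>

definition locally_convex_space :: "'a topology \<Rightarrow> bool" where
  "locally_convex_space X \<longleftrightarrow> (\<forall>x\<in>topspace X. \<exists>W C \<phi> \<psi>. x \<in> W \<and> convex_chart X W C \<phi> \<psi>)"

text \<open>On a neighbourhood \<open>D\<close> of the diagonal, the first projection can be deformed, leaving the points of
the diagonal in place at the end of the deformation, so that it agrees with the second projection at
all pairs whose second member is in \<open>A\<close>.  The case in which \<open>A\<close> is the whole space says that the two
projections are homotopic near the diagonal.\<close>

definition deformable_near_diagonal :: "'a topology \<Rightarrow> 'a set \<Rightarrow> bool" where
  "deformable_near_diagonal X A \<longleftrightarrow> (\<exists>D p. openin (prod_topology X X) D \<and> (\<forall>z\<in>topspace X. (z, z) \<in> D) \<and>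
     homotopic_with (\<lambda>_. True) (subtopology (prod_topology X X) D) X fst p \<and>
     (\<forall>z\<in>topspace X. p (z, z) = z) \<and> (\<forall>y z. (y, z) \<in> D \<longrightarrow> z \<in> A \<longrightarrow> p (y, z) = z))"

lemma deformable_near_diagonalE:
  assumes "deformable_near_diagonal X A"
  obtains D p where "openin (prod_topology X X) D" "\<And>z. z \<in> topspace X \<Longrightarrow> (z, z) \<in> D"
    "homotopic_with (\<lambda>_. True) (subtopology (prod_topology X X) D) X fst p"
    "\<And>z. z \<in> topspace X \<Longrightarrow> p (z, z) = z" "\<And>y z. (y, z) \<in> D \<Longrightarrow> z \<in> A \<Longrightarrow> p (y, z) = z"
  using assms unfolding deformable_near_diagonal_def by blast

text \<open>In a convex chart around \<open>x\<close>, the first point is moved towards the second, with the weight given by a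
bump function of the second point.\<close>

lemma diagonal_step:
  assumes X: "compact_space X" "Hausdorff_space X" and "locally_convex_space X" "x \<in> topspace X"
  shows "\<exists>A. openin X A \<and> x \<in> A \<and> deformable_near_diagonal X A"
proof -
  obtain W C \<phi> \<psi> where xW: "x \<in> W" and ch: "convex_chart X W C \<phi> \<psi>"
    using assms unfolding locally_convex_space_def by blast
  note chD = convex_chartD[OF ch]
  obtain A K l where A: "openin X A" "x \<in> A" "closedin X K" "A \<subseteq> K" "K \<subseteq> W"
    "continuous_map X (top_of_set {0..1::real}) l" "\<And>y. y \<in> A \<Longrightarrow> l y = 1"
    "\<And>y. y \<in> topspace X \<Longrightarrow> y \<notin> K \<Longrightarrow> l y = 0"
    using bump_function[OF X chD(1) xW] by blast
  \<comment> \<open>The pairs for which either both points are in the chart or the second is off the support of \<open>l\<close>.\<close>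
  define D where "D = W \<times> W \<union> topspace X \<times> (topspace X - K)"
  have WX: "W \<subseteq> topspace X" using chD(1) openin_subset by blast
  have D: "openin (prod_topology X X) D"
    unfolding D_def using chD(1) A(3) openin_diff[OF openin_topspace A(3)]
    by (auto intro!: openin_Un simp: openin_prod_Times_iff)
  have OX: "D \<subseteq> topspace X \<times> topspace X" using D openin_subset by fastforce
  let ?T = "subtopology (prod_topology X X) D"
  have T: "topspace ?T = D" using OX by auto
  have l: "continuous_map ?T (top_of_set {0..1::real}) (l \<circ> snd)"
    by (intro continuous_map_compose[OF _ A(6)] continuous_map_from_subtopology continuous_map_snd)
  have K: "closedin ?T {t \<in> topspace ?T. snd t \<in> K}"
    by (rule closedin_continuous_map_preimage[OF _ A(3)])
      (intro continuous_map_from_subtopology continuous_map_snd)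
  obtain p where p: "homotopic_with (\<lambda>_. True) ?T X fst p"
    "\<And>t. t \<in> topspace ?T \<Longrightarrow> (l \<circ> snd) t = 0 \<Longrightarrow> p t = fst t"
    "\<And>t. t \<in> {t \<in> topspace ?T. snd t \<in> K} \<Longrightarrow> p t = \<psi> (lin_comb ((l \<circ> snd) t) (\<phi> (fst t)) (\<phi> (snd t)))"
  proof (rule chart_deformation[OF ch _ _ l K])
    show "continuous_map ?T X fst" "continuous_map ?T X snd"
      by (intro continuous_map_from_subtopology continuous_map_fst continuous_map_snd)+
  qed (use A T in \<open>auto simp: D_def\<close>)
  have "deformable_near_diagonal X A"
    unfolding deformable_near_diagonal_def
  proof (intro exI conjI ballI allI impI)
    show "openin (prod_topology X X) D" by fact
    show dO: "(z, z) \<in> D" if "z \<in> topspace X" for z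
      using that A(5) by (auto simp: D_def)
    show "homotopic_with (\<lambda>_. True) ?T X fst p" by fact
    show "p (z, z) = z" if z: "z \<in> topspace X" for z
    proof (cases "z \<in> K")
      case True
      then have "p (z, z) = \<psi> (lin_comb (l z) (\<phi> z) (\<phi> z))"
        using p(3)[of "(z,z)"] dO[OF z] T by auto
      also have "lin_comb (l z) (\<phi> z) (\<phi> z) = \<phi> z" by (simp add: lin_comb_def algebra_simps)
      finally show ?thesis using chD(5) True A(5) by auto
    next
      case False
      then show ?thesis using p(2)[of "(z,z)"] dO[OF z] T A(8) z by auto
    qed
    show "p (y, z) = z" if "(y, z) \<in> D" "z \<in> A" for y z
    proof -
      have z: "z \<in> K" "z \<in> topspace X" using that OX A(4) by auto
      have "p (y, z) = \<psi> (lin_comb (l z) (\<phi> y) (\<phi> z))"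
        using p(3)[of "(y,z)"] that T z OX by auto
      then show ?thesis using A(5,7) z that chD(5) by (auto simp: lin_comb_def)
    qed
  qed
  with A show ?thesis by blast
qed

text \<open>The two deformations are performed one after the other.  The second one is applied to the pair
\<open>(p (y, z), z)\<close>; it does not spoil what the first has achieved, as this pair is on the diagonal whenever
\<open>z \<in> A\<close>, and diagonal points come out unchanged.\<close>

lemma diagonal_compose:
  assumes "deformable_near_diagonal X A" "deformable_near_diagonal X A'"
  shows "deformable_near_diagonal X (A \<union> A')"
proof -
  let ?X2 = "prod_topology X X"
  obtain D p where O: "openin ?X2 D" "\<And>z. z \<in> topspace X \<Longrightarrow> (z, z) \<in> D"
    "homotopic_with (\<lambda>_. True) (subtopology ?X2 D) X fst p"
    "\<And>z. z \<in> topspace X \<Longrightarrow> p (z, z) = z" "\<And>y z. (y, z) \<in> D \<Longrightarrow> z \<in> A \<Longrightarrow> p (y, z) = z"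
    using deformable_near_diagonalE[OF assms(1)] by metis
  obtain D' p' where O': "openin ?X2 D'" "\<And>z. z \<in> topspace X \<Longrightarrow> (z, z) \<in> D'"
    "homotopic_with (\<lambda>_. True) (subtopology ?X2 D') X fst p'"
    "\<And>z. z \<in> topspace X \<Longrightarrow> p' (z, z) = z" "\<And>y z. (y, z) \<in> D' \<Longrightarrow> z \<in> A' \<Longrightarrow> p' (y, z) = z"
    using deformable_near_diagonalE[OF assms(2)] by metis
  define m where "m = (\<lambda>w. (p w, snd w))"
  define P where "P = {w \<in> D. m w \<in> D'}"
  have OX: "D \<subseteq> topspace X \<times> topspace X" using O(1) openin_subset by fastforce
  have p: "continuous_map (subtopology ?X2 D) X p"
    using O(3) homotopic_with_imp_continuous_maps by blast
  then have m: "continuous_map (subtopology ?X2 D) ?X2 m"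
    unfolding m_def using continuous_map_from_subtopology[OF continuous_map_snd, of X X D]
    by (intro continuous_map_pairedI)
  have "P = {w \<in> topspace (subtopology ?X2 D). m w \<in> D'}" using OX by (auto simp: P_def)
  then have "openin (subtopology ?X2 D) P"
    using openin_continuous_map_preimage[OF m O'(1)] by simp
  then have P: "openin ?X2 P" using O(1) openin_trans_full by blast
  have PO: "P \<subseteq> D" by (auto simp: P_def)
  have sub: "subtopology (subtopology ?X2 D) P = subtopology ?X2 P"
    using PO by (simp add: subtopology_subtopology Int_absorb1)
  have mP: "continuous_map (subtopology ?X2 P) (subtopology ?X2 D') m"
    using continuous_map_from_subtopology[OF m, of P] sub
    by (auto simp: continuous_map_in_subtopology P_def)
  have pP: "homotopic_with (\<lambda>_. True) (subtopology ?X2 P) X (fst \<circ> id) (p \<circ> id)"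
    by (rule homotopic_with_compose_continuous_map_right[OF O(3)])
      (use PO in \<open>auto simp: continuous_map_in_subtopology\<close>)
  have "homotopic_with (\<lambda>_. True) (subtopology ?X2 P) X (fst \<circ> m) (p' \<circ> m)"
    by (rule homotopic_with_compose_continuous_map_right[OF O'(3) mP]) auto
  moreover have "fst \<circ> m = p" by (auto simp: m_def)
  ultimately have h: "homotopic_with (\<lambda>_. True) (subtopology ?X2 P) X fst (p' \<circ> m)"
    using pP homotopic_with_trans by fastforce
  show ?thesis
    unfolding deformable_near_diagonal_def
  proof (intro exI conjI ballI allI impI)
    show "openin ?X2 P" by (fact P)
    show "homotopic_with (\<lambda>_. True) (subtopology ?X2 P) X fst (p' \<circ> m)" by (fact h)
    show "(z, z) \<in> P" if "z \<in> topspace X" for z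
      using that O O' by (auto simp: P_def m_def)
    show "(p' \<circ> m) (z, z) = z" if "z \<in> topspace X" for z
      using that O O' by (auto simp: m_def)
    show "(p' \<circ> m) (y, z) = z" if yz: "(y, z) \<in> P" "z \<in> A \<union> A'" for y z
    proof (cases "z \<in> A")
      case True
      then have "p (y, z) = z" "z \<in> topspace X" using O(5) yz OX by (auto simp: P_def)
      then show ?thesis using O'(4) by (simp add: m_def)
    next
      case False
      then show ?thesis using yz O'(5) by (auto simp: P_def m_def)
    qed
  qed
qed

lemma compact_space_finite_subcover:
  assumes "compact_space X" "\<And>x. x \<in> topspace X \<Longrightarrow> openin X (A x)" "\<And>x. x \<in> topspace X \<Longrightarrow> x \<in> A x"
  obtains F where "finite F" "F \<subseteq> topspace X" "topspace X \<subseteq> \<Union>(A ` F)"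
proof -
  have "topspace X \<subseteq> \<Union>(A ` topspace X)" "\<forall>U\<in>A ` topspace X. openin X U"
    using assms(2,3) by auto
  then obtain \<F> where "finite \<F>" "\<F> \<subseteq> A ` topspace X" "topspace X \<subseteq> \<Union>\<F>"
    using assms(1)[unfolded compact_space_alt, rule_format, of "A ` topspace X"] by blast
  moreover from this obtain F where "F \<subseteq> topspace X" "finite F" "\<F> = A ` F"
    by (meson finite_subset_image)
  ultimately show ?thesis using that by blast
qed

text \<open>A finite cover by sets as in \<open>diagonal_step\<close> is used up one set at a time.\<close>

lemma locally_equiconnected:
  assumes X: "compact_space X" "Hausdorff_space X" and lc: "locally_convex_space X"
  obtains D where "openin (prod_topology X X) D" "\<And>z. z \<in> topspace X \<Longrightarrow> (z, z) \<in> D"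
    "homotopic_with (\<lambda>_. True) (subtopology (prod_topology X X) D) X fst snd"
proof -
  let ?X2 = "prod_topology X X"
  have "\<exists>A. openin X A \<and> x \<in> A \<and> deformable_near_diagonal X A" if "x \<in> topspace X" for x
    using diagonal_step[OF X lc that] .
  then obtain A where A: "\<And>x. x \<in> topspace X \<Longrightarrow> openin X (A x) \<and> x \<in> A x \<and> deformable_near_diagonal X (A x)"
    by metis
  obtain I where I: "finite I" "I \<subseteq> topspace X" "topspace X \<subseteq> \<Union>(A ` I)"
    using compact_space_finite_subcover[OF X(1), of A] A by blast
  define \<F> where "\<F> = A ` I"
  have F: "finite \<F>" "\<F> \<subseteq> A ` topspace X" "topspace X \<subseteq> \<Union>\<F>"
    using I by (auto simp: \<F>_def)
  have "\<G> \<subseteq> A ` topspace X \<Longrightarrow> deformable_near_diagonal X (\<Union>\<G>)" if "finite \<G>" for \<G>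
    using that
  proof (induction)
    case empty
    then show ?case unfolding deformable_near_diagonal_def
      by (intro exI[of _ "topspace ?X2"] exI[of _ fst])
        (auto simp: continuous_map_fst continuous_map_from_subtopology openin_prod_Times_iff)
  next
    case (insert B \<G>)
    then show ?case using A diagonal_compose[of X B "\<Union>\<G>"] by auto
  qed
  then have "deformable_near_diagonal X (\<Union>\<F>)" using F by blast
  then obtain D p where D: "openin ?X2 D" "\<And>z. z \<in> topspace X \<Longrightarrow> (z, z) \<in> D"
    "homotopic_with (\<lambda>_. True) (subtopology ?X2 D) X fst p"
    "\<And>z. z \<in> topspace X \<Longrightarrow> p (z, z) = z"
    "\<And>y z. (y, z) \<in> D \<Longrightarrow> z \<in> \<Union>\<F> \<Longrightarrow> p (y, z) = z"
    using deformable_near_diagonalE by metis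
  have "homotopic_with (\<lambda>_. True) (subtopology ?X2 D) X p snd"
  proof (rule homotopic_with_equal)
    show "continuous_map (subtopology ?X2 D) X p"
      using D(3) homotopic_with_imp_continuous_maps by blast
    fix w assume "w \<in> topspace (subtopology ?X2 D)"
    then have w: "w \<in> D" "snd w \<in> topspace X"
      unfolding topspace_subtopology topspace_prod_topology by (simp_all only: Int_iff mem_Times_iff)
    then have "snd w \<in> \<Union>\<F>" using F(3) by blast
    then show "p w = snd w" using D(5)[of "fst w" "snd w"] w(1) by simp
  qed auto
  then show ?thesis using that[OF D(1,2)] D(3) homotopic_with_trans by blast
qed

lemma near_maps_homotopic:
  assumes D: "homotopic_with (\<lambda>_. True) (subtopology (prod_topology X X) D) X fst snd"
    and u: "continuous_map T X u" and v: "continuous_map T X v"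
    and near: "\<And>t. t \<in> topspace T \<Longrightarrow> (u t, v t) \<in> D"
  shows "homotopic_with (\<lambda>_. True) T X u v"
proof -
  have "continuous_map T (subtopology (prod_topology X X) D) (\<lambda>t. (u t, v t))"
    using u v near by (auto simp: continuous_map_in_subtopology intro: continuous_map_pairedI)
  from homotopic_with_compose_continuous_map_right[OF D this, of "\<lambda>_. True"] show ?thesis
    by (simp add: o_def)
qed

section \<open>Compact manifolds with boundary\<close>

definition coord_box :: "nat \<Rightarrow> (nat \<Rightarrow> real) \<Rightarrow> real \<Rightarrow> (nat \<Rightarrow> real) set" where
  "coord_box n y r = {z. (\<forall>i\<ge>n. z i = 0) \<and> (\<forall>i<n. \<bar>z i - y i\<bar> < r)}"

lemma Euclidean_space_eq_top_of_set: "Euclidean_space n = top_of_set {x. \<forall>i\<ge>n. x i = 0}"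
  by (simp add: Euclidean_space_def euclidean_product_topology)

lemma continuous_map_Euclidean_coordinate:
  "continuous_map (Euclidean_space n) euclideanreal (\<lambda>x. x i)"
  unfolding Euclidean_space_def
  by (rule continuous_map_from_subtopology) (metis UNIV_I continuous_map_product_coordinates)

text \<open>The topology is the product topology on \<^typ>\<open>nat \<Rightarrow> real\<close>; the coordinates from \<open>n\<close> on vanish, so a
basic open set restricts only finitely many coordinates and contains a box.\<close>

lemma openin_Euclidean_contains_box:
  assumes "openin (Euclidean_space n) H" "y \<in> H"
  obtains r where "r > 0" "coord_box n y r \<subseteq> H"
proof -
  obtain T where T: "openin (powertop_real UNIV) T" "H = T \<inter> {x. \<forall>i\<ge>n. x i = 0}"
    using assms(1) by (auto simp: Euclidean_space_def openin_subtopology)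
  then obtain U where U: "\<And>i. open (U i)" "y \<in> PiE UNIV U" "PiE UNIV U \<subseteq> T"
    using assms(2) unfolding openin_product_topology_alt by auto metis
  have "\<exists>r>0. \<forall>t. \<bar>t - y i\<bar> < r \<longrightarrow> t \<in> U i" for i
    using U(1)[of i] U(2) unfolding open_dist PiE_UNIV_domain dist_real_def by auto
  then obtain r where r: "\<And>i. r i > 0" "\<And>i t. \<bar>t - y i\<bar> < r i \<Longrightarrow> t \<in> U i" by metis
  \<comment> \<open>The element \<open>1\<close> keeps the set nonempty when \<open>n = 0\<close>.\<close>
  define R where "R = Min (insert 1 (r ` {..<n}))"
  have R: "R > 0" using r(1) by (simp add: R_def)
  have "coord_box n y R \<subseteq> H"
  proof
    fix z assume z: "z \<in> coord_box n y R"
    have "z i \<in> U i" for i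
    proof (cases "i < n")
      case True
      then have "R \<le> r i" by (auto simp: R_def intro!: Min_le)
      then show ?thesis using z True r(2) by (force simp: coord_box_def)
    next
      case False
      then have "z i = y i" using z assms(2) T(2) by (auto simp: coord_box_def)
      then show ?thesis using r by simp
    qed
    then show "z \<in> H" using z U(3) T(2) by (auto simp: coord_box_def PiE_UNIV_domain)
  qed
  with R show ?thesis using that by blast
qed

lemma openin_coord_box: "openin (Euclidean_space n) (coord_box n y r)"
proof -
  have o: "openin (Euclidean_space n) {x \<in> topspace (Euclidean_space n). x i \<in> {y i - r<..<y i + r}}" for i
    by (rule openin_continuous_map_preimage[OF continuous_map_Euclidean_coordinate]) simp
  have "coord_box n y r = topspace (Euclidean_space n) \<inter>
          (\<Inter>i\<in>{..<n}. {x \<in> topspace (Euclidean_space n). x i \<in> {y i - r<..<y i + r}})"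
  proof (intro equalityI subsetI)
    fix x assume x: "x \<in> topspace (Euclidean_space n) \<inter>
      (\<Inter>i\<in>{..<n}. {x \<in> topspace (Euclidean_space n). x i \<in> {y i - r<..<y i + r}})"
    then have "\<bar>x i - y i\<bar> < r" if "i < n" for i
      using that by (simp add: abs_less_iff) (smt (verit) lessThan_iff)
    with x show "x \<in> coord_box n y r" by (simp add: coord_box_def topspace_Euclidean_space)
  qed (auto simp: coord_box_def topspace_Euclidean_space abs_less_iff)
  moreover have "openin (Euclidean_space n) \<dots>"
  proof (cases "n = 0")
    case False
    then have "openin (Euclidean_space n) (\<Inter>i\<in>{..<n}. {x \<in> topspace (Euclidean_space n). x i \<in> {y i - r<..<y i + r}})"
      by (intro openin_Inter) (use o in auto)
    then show ?thesis by blast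
  qed simp
  ultimately show ?thesis by simp
qed

lemma lin_comb_in_coord_box:
  assumes "y \<in> coord_box n c r" "z \<in> coord_box n c r" "0 \<le> s" "s \<le> 1"
  shows "lin_comb s y z \<in> coord_box n c r"
proof -
  have "\<bar>lin_comb s y z i - c i\<bar> < r" if "i < n" for i
  proof -
    have "lin_comb s y z i \<in> ball (c i) r"
      using convexD[OF convex_ball[of "c i" r], of "y i" "z i" "1 - s" s] assms that
      by (auto simp: coord_box_def lin_comb_def dist_real_def abs_minus_commute)
    then show ?thesis by (simp add: dist_real_def abs_minus_commute)
  qed
  then show ?thesis using assms by (auto simp: coord_box_def lin_comb_def)
qed

lemma chart_restriction:
  assumes W: "openin X W" and h: "homeomorphic_maps (subtopology X W) Z \<phi> \<psi>" and B: "openin Z B"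
  shows "openin X {w \<in> W. \<phi> w \<in> B}"
    "homeomorphic_maps (subtopology X {w \<in> W. \<phi> w \<in> B}) (subtopology Z B) \<phi> \<psi>"
proof -
  have WX: "W \<subseteq> topspace X" using W openin_subset by blast
  have c: "continuous_map (subtopology X W) Z \<phi>" "continuous_map Z (subtopology X W) \<psi>"
    using h by (auto simp: homeomorphic_maps_def)
  have "openin (subtopology X W) {w \<in> topspace (subtopology X W). \<phi> w \<in> B}"
    by (rule openin_continuous_map_preimage[OF c(1) B])
  then show "openin X {w \<in> W. \<phi> w \<in> B}"
    using W WX openin_trans_full by (simp add: Int_absorb1)
  have "homeomorphic_maps (subtopology (subtopology X W) {w \<in> W. \<phi> w \<in> B}) (subtopology Z B) \<phi> \<psi>"
  proof (rule homeomorphic_maps_subtopologies[OF h])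
    have zW: "z \<in> \<phi> ` {w \<in> W. \<phi> w \<in> B}" if "z \<in> topspace Z" "z \<in> B" for z
    proof
      show "z = \<phi> (\<psi> z)" using h that by (simp add: homeomorphic_maps_def)
      then show "\<psi> z \<in> {w \<in> W. \<phi> w \<in> B}"
        using that continuous_map_image_subset_topspace[OF c(2)] by auto
    qed
    have BW: "topspace Z \<inter> B \<subseteq> \<phi> ` {w \<in> W. \<phi> w \<in> B}"
      by (rule subsetI, rule zW) simp_all
    have cW: "\<phi> w \<in> topspace Z" if "w \<in> W" for w
      using continuous_map_image_subset_topspace[OF c(1)] that WX by auto
    moreover have "topspace (subtopology X W) \<inter> {w \<in> W. \<phi> w \<in> B} = {w \<in> W. \<phi> w \<in> B}"
      using WX by auto
    moreover have "\<phi> ` {w \<in> W. \<phi> w \<in> B} \<subseteq> topspace Z \<inter> B"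
      using cW by auto
    ultimately show "\<phi> ` (topspace (subtopology X W) \<inter> {w \<in> W. \<phi> w \<in> B}) = topspace Z \<inter> B"
      using BW by (simp add: subset_antisym)
  qed
  moreover have "subtopology (subtopology X W) {w \<in> W. \<phi> w \<in> B} = subtopology X {w \<in> W. \<phi> w \<in> B}"
    by (simp add: subtopology_subtopology Int_absorb1)
  ultimately show "homeomorphic_maps (subtopology X {w \<in> W. \<phi> w \<in> B}) (subtopology Z B) \<phi> \<psi>"
    by simp
qed

definition manifold_with_boundary :: "nat \<Rightarrow> 'a topology \<Rightarrow> bool" where
  "manifold_with_boundary n X \<longleftrightarrow> (\<forall>x\<in>topspace X. \<exists>W H. x \<in> W \<and> openin X W \<and> openin (half_space n) H \<and>
     subtopology X W homeomorphic_space subtopology (half_space n) H)"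

text \<open>The interior is defined intrinsically, and not as the topological interior in an ambient manifold, so
that homeomorphic copies of \<open>X\<close> in different manifolds have corresponding interiors.\<close>

definition manifold_interior :: "nat \<Rightarrow> 'a topology \<Rightarrow> 'a set" where
  "manifold_interior n X = {x. \<exists>W H. x \<in> W \<and> openin X W \<and> openin (Euclidean_space n) H \<and>
     subtopology X W homeomorphic_space subtopology (Euclidean_space n) H}"

definition half_box :: "nat \<Rightarrow> (nat \<Rightarrow> real) \<Rightarrow> real \<Rightarrow> (nat \<Rightarrow> real) set" where
  "half_box n y r = coord_box n y r \<inter> {z. n = 0 \<or> 0 \<le> z 0}"

lemma subtopology_Euclidean_eq_top_of_set:
  assumes "B \<subseteq> topspace (Euclidean_space n)"
  shows "subtopology (Euclidean_space n) B = top_of_set B"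
  using assms unfolding Euclidean_space_eq_top_of_set
  by (simp add: subtopology_subtopology Int_absorb1)

lemma coord_box_subset: "coord_box n y r \<subseteq> topspace (Euclidean_space n)"
  by (auto simp: coord_box_def topspace_Euclidean_space)

lemma half_space_chart:
  assumes X: "manifold_with_boundary n X" and x: "x \<in> topspace X"
  obtains W \<phi> \<psi> y r where "x \<in> W" "r > 0" "y \<in> half_box n y r" "convex_chart X W (half_box n y r) \<phi> \<psi>"
proof -
  obtain W H \<phi> \<psi> where W: "x \<in> W" "openin X W" "openin (half_space n) H"
    "homeomorphic_maps (subtopology X W) (subtopology (half_space n) H) \<phi> \<psi>"
    using X x unfolding manifold_with_boundary_def homeomorphic_space_def by metis
  define y where "y = \<phi> x"
  have "continuous_map (subtopology X W) (subtopology (half_space n) H) \<phi>"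
    using W(4) by (simp add: homeomorphic_maps_def)
  then have y: "y \<in> H" "y \<in> topspace (half_space n)"
    using x W(1) continuous_map_image_subset_topspace by (fastforce simp: y_def)+
  obtain T where T: "openin (Euclidean_space n) T" "H = T \<inter> {x. n = 0 \<or> 0 \<le> x 0}"
    using W(3) by (auto simp: half_space_def openin_subtopology)
  then obtain r where r: "r > 0" "coord_box n y r \<subseteq> T"
    using openin_Euclidean_contains_box y by (metis IntD1)
  have yB: "y \<in> half_box n y r"
    using y r by (auto simp: half_box_def coord_box_def half_space_def topspace_Euclidean_space)
  have BH: "half_box n y r \<subseteq> H" using r(2) T(2) by (auto simp: half_box_def)
  have "openin (half_space n) (half_box n y r)"
    unfolding half_space_def half_box_def openin_subtopology using openin_coord_box by blast
  then have "openin (subtopology (half_space n) H) (half_box n y r)"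
    using BH by (rule subset_openin_subtopology)
  note ch = chart_restriction[OF W(2,4) this]
  have "subtopology (subtopology (half_space n) H) (half_box n y r) = subtopology (Euclidean_space n) (half_box n y r)"
    unfolding half_space_def subtopology_subtopology
    by (rule arg_cong[of _ _ "subtopology _"]) (use BH in \<open>auto simp: half_box_def\<close>)
  also have "\<dots> = top_of_set (half_box n y r)"
    using coord_box_subset by (intro subtopology_Euclidean_eq_top_of_set) (auto simp: half_box_def)
  finally have cc: "convex_chart X {w \<in> W. \<phi> w \<in> half_box n y r} (half_box n y r) \<phi> \<psi>"
    unfolding convex_chart_def using ch
    by (auto simp: half_box_def lin_comb_in_coord_box) (simp add: lin_comb_def)
  have "x \<in> {w \<in> W. \<phi> w \<in> half_box n y r}" using W(1) yB by (simp add: y_def)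
  then show ?thesis by (rule that[OF _ r(1) yB cc])
qed

lemma manifold_with_boundary_locally_convex:
  "manifold_with_boundary n X \<Longrightarrow> locally_convex_space X"
  unfolding locally_convex_space_def by (meson half_space_chart)

text \<open>Points off the boundary hyperplane of the half-space have a neighbourhood in the half-space that is
open in Euclidean space.  For \<open>n = 0\<close> the half-space is a point and there is no boundary.\<close>

lemma half_box_interior:
  assumes ch: "convex_chart X W (half_box n y r) \<phi> \<psi>" and z: "z \<in> half_box n y r" "n = 0 \<or> 0 < z 0"
  shows "\<psi> z \<in> manifold_interior n X"
proof -
  define B where "B = coord_box n y r \<inter> {z \<in> topspace (Euclidean_space n). n = 0 \<or> z 0 \<in> {0<..}}"
  have "openin (Euclidean_space n) {z \<in> topspace (Euclidean_space n). z 0 \<in> {0<..}}"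
    by (rule openin_continuous_map_preimage[OF continuous_map_Euclidean_coordinate]) simp
  then have B: "openin (Euclidean_space n) B"
    unfolding B_def by (cases "n = 0") (auto intro!: openin_Int openin_coord_box)
  have BC: "B \<subseteq> half_box n y r" by (auto simp: B_def half_box_def)
  have E: "subtopology (Euclidean_space n) (half_box n y r) = top_of_set (half_box n y r)"
    using coord_box_subset by (intro subtopology_Euclidean_eq_top_of_set) (auto simp: half_box_def)
  then have oB: "openin (top_of_set (half_box n y r)) B"
    using subset_openin_subtopology[OF B BC] by simp
  have chD: "openin X W" "homeomorphic_maps (subtopology X W) (top_of_set (half_box n y r)) \<phi> \<psi>"
    using ch by (auto simp: convex_chart_def)
  note res = chart_restriction[OF chD oB]
  have "subtopology (top_of_set (half_box n y r)) B = subtopology (Euclidean_space n) B"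
    using BC unfolding E[symmetric] by (simp add: subtopology_subtopology Int_absorb1)
  then have "subtopology X {w \<in> W. \<phi> w \<in> B} homeomorphic_space subtopology (Euclidean_space n) B"
    using homeomorphic_maps_imp_homeomorphic_space[OF res(2)] by simp
  moreover have "z \<in> B"
    using z coord_box_subset by (auto simp: B_def half_box_def)
  then have "\<psi> z \<in> {w \<in> W. \<phi> w \<in> B}" using convex_chartD(6,7)[OF ch z(1)] by simp
  ultimately show ?thesis unfolding manifold_interior_def mem_Collect_eq
    by (intro exI[of _ "{w \<in> W. \<phi> w \<in> B}"] exI[of _ B] conjI res(1) B) simp_all
qed

text \<open>The condition that every point stays in place or lands in the interior makes these maps composable: a
point that has been pushed inside remains inside, and one that has not been pushed is still in its
original position when the next map is applied.\<close>

definition pushes_into_interior :: "nat \<Rightarrow> 'a topology \<Rightarrow> 'a set \<Rightarrow> ('a \<Rightarrow> 'a) \<Rightarrow> bool" where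
  "pushes_into_interior n X A p \<longleftrightarrow> homotopic_with (\<lambda>_. True) X X id p \<and>
     (\<forall>t\<in>topspace X. p t = t \<or> p t \<in> manifold_interior n X) \<and> p ` A \<subseteq> manifold_interior n X"

text \<open>In a half-space chart, points are moved towards a point \<open>c\<close> with positive first coordinate.  A convex
combination of a point of the half-space with \<open>c\<close>, with a positive weight on \<open>c\<close>, has positive first
coordinate.\<close>

lemma local_push:
  assumes X: "compact_space X" "Hausdorff_space X" "manifold_with_boundary n X" and x: "x \<in> topspace X"
  shows "\<exists>A p. openin X A \<and> x \<in> A \<and> pushes_into_interior n X A p"
proof -
  obtain W \<phi> \<psi> y r where xW: "x \<in> W" and r: "r > 0" and y: "y \<in> half_box n y r"
    and ch: "convex_chart X W (half_box n y r) \<phi> \<psi>"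
    using half_space_chart[OF X(3) x] by metis
  note chD = convex_chartD[OF ch]
  have WX: "W \<subseteq> topspace X" using chD(1) openin_subset by blast
  \<comment> \<open>The target of the push: the centre of the box, moved away from the boundary.\<close>
  define c where "c = (if n = 0 then y else y(0 := y 0 + r / 2))"
  have c: "c \<in> half_box n y r" "n = 0 \<or> 0 < c 0"
    using y r by (auto simp: c_def half_box_def coord_box_def)
  obtain A K l where A: "openin X A" "x \<in> A" "closedin X K" "A \<subseteq> K" "K \<subseteq> W"
    "continuous_map X (top_of_set {0..1::real}) l" "\<And>y. y \<in> A \<Longrightarrow> l y = 1"
    "\<And>y. y \<in> topspace X \<Longrightarrow> y \<notin> K \<Longrightarrow> l y = 0"
    using bump_function[OF X(1,2) chD(1) xW] by blast
  have l01: "0 \<le> l t \<and> l t \<le> 1" if "t \<in> topspace X" for t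
    using continuous_map_image_subset_topspace[OF A(6)] that by auto
  obtain p where p: "homotopic_with (\<lambda>_. True) X X id p"
    "\<And>t. t \<in> topspace X \<Longrightarrow> l t = 0 \<Longrightarrow> p t = id t"
    "\<And>t. t \<in> K \<Longrightarrow> p t = \<psi> (lin_comb (l t) (\<phi> (id t)) (\<phi> (\<psi> c)))"
  proof (rule chart_deformation[OF ch _ _ A(6) A(3)])
    show "continuous_map X X id" by simp
    show "continuous_map X X (\<lambda>_. \<psi> c)" using chD(6)[OF c(1)] WX by auto
  qed (use A chD c in auto)
  have pos: "p t \<in> manifold_interior n X" if t: "t \<in> topspace X" "l t \<noteq> 0" for t
  proof -
    have tK: "t \<in> K" using A(8) t by blast
    then have ft: "\<phi> t \<in> half_box n y r" using chD(4) A(5) by blast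
    have "lin_comb (l t) (\<phi> t) c \<in> half_box n y r"
      using chD(8)[OF ft c(1)] l01[OF t(1)] by simp
    moreover have "n = 0 \<or> 0 < lin_comb (l t) (\<phi> t) c 0"
    proof (cases "n = 0")
      case False
      then have "0 \<le> \<phi> t 0" "0 < c 0" using ft c by (auto simp: half_box_def)
      moreover have "0 \<le> 1 - l t" "0 < l t" using l01[OF t(1)] t(2) by auto
      ultimately show ?thesis by (simp add: lin_comb_def add_nonneg_pos)
    qed simp
    ultimately have "\<psi> (lin_comb (l t) (\<phi> t) c) \<in> manifold_interior n X"
      using half_box_interior[OF ch] by blast
    then show ?thesis using p(3)[OF tK] chD(7)[OF c(1)] by simp
  qed
  have "pushes_into_interior n X A p"
    unfolding pushes_into_interior_def
  proof (intro conjI p(1) subsetI ballI)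
    show "p t = t \<or> p t \<in> manifold_interior n X" if "t \<in> topspace X" for t
      using p(2)[OF that] pos[OF that] by (cases "l t = 0") auto
    show "u \<in> manifold_interior n X" if "u \<in> p ` A" for u
      using that pos A(1,7) openin_subset by fastforce
  qed
  with A show ?thesis by blast
qed

text \<open>Finitely many local pushes are composed.  This replaces a collar of the boundary.\<close>

lemma push_into_interior:
  assumes X: "compact_space X" "Hausdorff_space X" "manifold_with_boundary n X"
  obtains p where "homotopic_with (\<lambda>_. True) X X id p" "p ` topspace X \<subseteq> manifold_interior n X"
proof -
  obtain A where A: "\<And>x. x \<in> topspace X \<Longrightarrow> openin X (A x) \<and> x \<in> A x \<and> (\<exists>p. pushes_into_interior n X (A x) p)"
    using local_push[OF X] by metis
  obtain I where I: "finite I" "I \<subseteq> topspace X" "topspace X \<subseteq> \<Union>(A ` I)"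
    using compact_space_finite_subcover[OF X(1), of A] A by blast
  have "J \<subseteq> topspace X \<Longrightarrow> \<exists>p. pushes_into_interior n X (\<Union>(A ` J)) p" if "finite J" for J
    using that
  proof (induction)
    case empty
    have "pushes_into_interior n X {} id" by (simp add: pushes_into_interior_def)
    then show ?case by auto
  next
    case (insert j J)
    obtain p where p: "pushes_into_interior n X (A j) p" using A insert.prems by blast
    obtain q where q: "pushes_into_interior n X (\<Union>(A ` J)) q" using insert by blast
    have AX: "A i \<subseteq> topspace X" if "i \<in> insert j J" for i
      using A[of i] that insert.prems openin_subset[of X "A i"] by blast
    have intX: "manifold_interior n X \<subseteq> topspace X"
      using openin_subset unfolding manifold_interior_def by blast
    have "homotopic_with (\<lambda>_. True) X X (id \<circ> id) (q \<circ> p)"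
      using p q unfolding pushes_into_interior_def by (intro homotopic_compose) auto
    moreover have int: "q t \<in> manifold_interior n X" if "t \<in> manifold_interior n X" for t
      using q intX that unfolding pushes_into_interior_def by (metis subsetD)
    have "q (p t) = t \<or> q (p t) \<in> manifold_interior n X" if "t \<in> topspace X" for t
      using p q int that unfolding pushes_into_interior_def by metis
    moreover have "q (p t) \<in> manifold_interior n X" if t: "t \<in> \<Union>(A ` insert j J)" for t
    proof (cases "p t \<in> manifold_interior n X")
      case True
      then show ?thesis by (rule int)
    next
      case False
      moreover have "t \<in> topspace X" using t AX by blast
      ultimately have "p t = t" "t \<notin> A j" using p unfolding pushes_into_interior_def by auto
      then have "t \<in> \<Union>(A ` J)" using t by auto
      then show ?thesis using q \<open>p t = t\<close> unfolding pushes_into_interior_def by auto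
    qed
    ultimately have "pushes_into_interior n X (\<Union>(A ` insert j J)) (q \<circ> p)"
      by (auto simp: pushes_into_interior_def)
    then show ?case by blast
  qed
  then obtain p where p: "pushes_into_interior n X (\<Union>(A ` I)) p" using I by blast
  show ?thesis
    by (rule that[of p]) (use p I(3) in \<open>fastforce simp: pushes_into_interior_def\<close>)+
qed

lemma compact_domain_manifold_with_boundary:
  assumes "compact_domain N V"
  shows "manifold_with_boundary (mdim N) (subtopology (mtop N) V)"
  unfolding manifold_with_boundary_def
proof
  fix x assume "x \<in> topspace (subtopology (mtop N) V)"
  then have "x \<in> V" by simp
  then obtain W H where W: "x \<in> W" "openin (subtopology (mtop N) V) W" "openin (half_space (mdim N)) H"
    "subtopology (mtop N) W homeomorphic_space subtopology (half_space (mdim N)) H"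
    using assms unfolding compact_domain_def by meson
  have "W \<subseteq> V" using openin_subset[OF W(2)] by simp
  then have "subtopology (subtopology (mtop N) V) W = subtopology (mtop N) W"
    by (simp add: subtopology_subtopology Int_absorb1)
  with W show "\<exists>W H. x \<in> W \<and> openin (subtopology (mtop N) V) W \<and> openin (half_space (mdim N)) H \<and>
      subtopology (subtopology (mtop N) V) W homeomorphic_space subtopology (half_space (mdim N)) H"
    by metis
qed

lemma manifold_with_boundary_homeomorphic:
  assumes X: "manifold_with_boundary n X" and XY: "X homeomorphic_space Y"
  shows "manifold_with_boundary n Y"
  unfolding manifold_with_boundary_def
proof
  fix y assume y: "y \<in> topspace Y"
  obtain h where h: "homeomorphic_map X Y h" using XY by (auto simp: homeomorphic_space)
  then obtain x where x: "x \<in> topspace X" "y = h x" using y homeomorphic_imp_surjective_map by blast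
  obtain W H where W: "x \<in> W" "openin X W" "openin (half_space n) H"
    "subtopology X W homeomorphic_space subtopology (half_space n) H"
    using X x(1) unfolding manifold_with_boundary_def by metis
  have WX: "W \<subseteq> topspace X" using W(2) openin_subset by blast
  have hW: "openin Y (h ` W)" using homeomorphic_map_openness[OF h WX] W(2) by simp
  have "homeomorphic_map (subtopology X W) (subtopology Y (h ` W)) h"
    by (rule homeomorphic_map_subtopologies[OF h])
      (use WX openin_subset[OF hW] in \<open>simp add: Int_absorb1\<close>)
  then have "subtopology Y (h ` W) homeomorphic_space subtopology X W"
    using homeomorphic_map_imp_homeomorphic_space homeomorphic_space_sym by blast
  then have "subtopology Y (h ` W) homeomorphic_space subtopology (half_space n) H"
    using W(4) homeomorphic_space_trans by blast
  then show "\<exists>W H. y \<in> W \<and> openin Y W \<and> openin (half_space n) H \<and>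
      subtopology Y W homeomorphic_space subtopology (half_space n) H"
    using W(1,3) x(2) hW by blast
qed

section \<open>Charts of a smooth manifold\<close>

lemma is_chart_openin_image:
  assumes c: "is_chart n X c" and W: "openin X W" "W \<subseteq> fst c"
  shows "openin (Euclidean_space n) (snd c ` W)"
proof -
  have "openin (subtopology X (fst c)) W" using W by (rule subset_openin_subtopology)
  then have "openin (subtopology (Euclidean_space n) (chart_image c)) (snd c ` W)"
    using c homeomorphic_imp_open_map unfolding is_chart_def open_map_def by blast
  then show ?thesis using c openin_trans_full unfolding is_chart_def by blast
qed

lemma is_chart_inj: "is_chart n X c \<Longrightarrow> inj_on (snd c) (fst c)"
  using openin_subset homeomorphic_imp_injective_map
  unfolding is_chart_def by (metis inf.absorb_iff2 topspace_subtopology)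

lemma smooth_manifold_chart_at:
  assumes "smooth_manifold N" "p \<in> topspace (mtop N)"
  obtains c where "c \<in> atlas N" "p \<in> fst c"
  using assms unfolding smooth_manifold_def by (metis UN_E)

lemma smooth_manifold_is_chart: "smooth_manifold N \<Longrightarrow> c \<in> atlas N \<Longrightarrow> is_chart (mdim N) (mtop N) c"
  by (simp add: smooth_manifold_def)

lemma is_chart_openin: "is_chart n X c \<Longrightarrow> openin X (fst c)"
  by (simp add: is_chart_def)

lemma chart_inv_chart: "is_chart n X c \<Longrightarrow> p \<in> fst c \<Longrightarrow> chart_inv c (snd c p) = p"
  using is_chart_inj by (metis chart_inv_def inv_into_f_f)

lemma centre_in_coord_box: "y \<in> topspace (Euclidean_space n) \<Longrightarrow> r > 0 \<Longrightarrow> y \<in> coord_box n y r"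
  by (simp add: coord_box_def topspace_Euclidean_space)

lemma chart_image_subset: "is_chart n X c \<Longrightarrow> chart_image c \<subseteq> topspace (Euclidean_space n)"
  unfolding is_chart_def using openin_subset by blast

lemma chart_homeomorphic_maps:
  assumes c: "is_chart n X c"
  shows "homeomorphic_maps (subtopology X (fst c)) (top_of_set (chart_image c)) (snd c) (chart_inv c)"
proof -
  have E: "subtopology (Euclidean_space n) (chart_image c) = top_of_set (chart_image c)"
    by (rule subtopology_Euclidean_eq_top_of_set[OF chart_image_subset[OF c]])
  have W: "topspace (subtopology X (fst c)) = fst c"
    using is_chart_openin[OF c] openin_subset by fastforce
  have "homeomorphic_map (subtopology X (fst c)) (top_of_set (chart_image c)) (snd c)"
    using c unfolding is_chart_def E by blast
  then obtain h where h: "homeomorphic_maps (subtopology X (fst c)) (top_of_set (chart_image c)) (snd c) h"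
    by (auto simp: homeomorphic_map_maps)
  then show ?thesis
  proof (rule homeomorphic_maps_eq)
    fix z assume "z \<in> topspace (top_of_set (chart_image c))"
    then obtain p where p: "p \<in> fst c" "z = snd c p" by (auto simp: chart_image_def)
    then show "h z = chart_inv c z"
      using h W chart_inv_chart[OF c p(1)] unfolding homeomorphic_maps_def by metis
  qed simp
qed

lemma chart_inv_in_chart:
  assumes "z \<in> chart_image c"
  shows "chart_inv c z \<in> fst c" "snd c (chart_inv c z) = z"
  using assms by (auto simp: chart_inv_def chart_image_def inv_into_into f_inv_into_f)

lemma smooth_manifold_locally_convex:
  assumes N: "smooth_manifold N"
  shows "locally_convex_space (mtop N)"
  unfolding locally_convex_space_def
proof
  let ?n = "mdim N"
  fix p assume "p \<in> topspace (mtop N)"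
  then obtain c where c: "c \<in> atlas N" "p \<in> fst c" using smooth_manifold_chart_at[OF N] by blast
  note chart = smooth_manifold_is_chart[OF N c(1)]
  have "snd c p \<in> chart_image c" using c by (simp add: chart_image_def)
  moreover have "openin (Euclidean_space ?n) (chart_image c)" using chart by (simp add: is_chart_def)
  ultimately obtain r where r: "r > 0" "coord_box ?n (snd c p) r \<subseteq> chart_image c"
    using openin_Euclidean_contains_box by metis
  let ?C = "coord_box ?n (snd c p) r"
  have "openin (top_of_set (chart_image c)) ?C"
    using subset_openin_subtopology[OF openin_coord_box r(2)]
    by (simp add: subtopology_Euclidean_eq_top_of_set[OF chart_image_subset[OF chart]])
  note res = chart_restriction[OF is_chart_openin[OF chart] chart_homeomorphic_maps[OF chart] this]
  have "subtopology (top_of_set (chart_image c)) ?C = top_of_set ?C"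
    using r(2) by (simp add: subtopology_subtopology Int_absorb1)
  then have cc: "convex_chart (mtop N) {w \<in> fst c. snd c w \<in> ?C} ?C (snd c) (chart_inv c)"
    using res unfolding convex_chart_def by (simp add: lin_comb_in_coord_box)
  have "snd c p \<in> topspace (Euclidean_space ?n)"
    using chart_image_subset[OF chart] c by (auto simp: chart_image_def)
  then have "p \<in> {w \<in> fst c. snd c w \<in> ?C}" using c(2) r(1) by (simp add: centre_in_coord_box)
  with cc show "\<exists>W C \<phi> \<psi>. p \<in> W \<and> convex_chart (mtop N) W C \<phi> \<psi>" by (intro exI conjI)
qed

section \<open>Open submanifolds\<close>

lemma coordinate_line_in_open:
  assumes "openin (Euclidean_space n) A" "x \<in> A" "i < n"
  obtains r where "r > 0" "\<And>t. \<bar>t - x i\<bar> < r \<Longrightarrow> x(i := t) \<in> A"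
proof -
  obtain r where r: "r > 0" "coord_box n x r \<subseteq> A"
    using openin_Euclidean_contains_box[OF assms(1,2)] by blast
  have "x \<in> topspace (Euclidean_space n)" using assms openin_subset by blast
  then have "x(i := t) \<in> A" if "\<bar>t - x i\<bar> < r" for t
    using r that assms(3) by (intro subsetD[OF r(2)]) (auto simp: coord_box_def topspace_Euclidean_space)
  with r show ?thesis using that by blast
qed

text \<open>Partial derivatives at a point of an open set depend only on values along coordinate lines near that
point, which lie in the open set.\<close>

lemma partial_derivs_cong:
  assumes A: "openin (Euclidean_space n) A" and FG: "\<And>x. x \<in> A \<Longrightarrow> F x = G x"
  shows "set is \<subseteq> {..<n} \<Longrightarrow> x \<in> A \<Longrightarrow> partial_derivs is F x = partial_derivs is G x"
proof (induction "is" arbitrary: x)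
  case Nil
  then show ?case using FG by simp
next
  case (Cons i "is")
  obtain r where r: "r > 0" "\<And>t. \<bar>t - x i\<bar> < r \<Longrightarrow> x(i := t) \<in> A"
    using coordinate_line_in_open[OF A Cons.prems(2)] Cons.prems(1) by auto
  have "\<forall>\<^sub>F t in nhds (x i). partial_derivs is F (x(i := t)) = partial_derivs is G (x(i := t))"
    unfolding eventually_nhds_metric using r Cons by (intro exI[of _ r]) (auto simp: dist_real_def)
  then show ?case by (simp add: partial_deriv_def deriv_cong_ev)
qed

lemma smooth_on_subset_cong:
  assumes F: "smooth_on n A F" and AB: "B \<subseteq> A" and B: "openin (Euclidean_space n) B"
    and FG: "\<And>x. x \<in> B \<Longrightarrow> F x = G x"
  shows "smooth_on n B G"
  unfolding smooth_on_def
proof (intro allI impI conjI ballI)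
  fix "is" assume is_n: "set is \<subseteq> {..<n}"
  note eq = partial_derivs_cong[OF B FG is_n]
  have F': "continuous_map (subtopology (Euclidean_space n) A) euclideanreal (partial_derivs is F)"
    "\<And>i x. i < n \<Longrightarrow> x \<in> A \<Longrightarrow> (\<lambda>t. partial_derivs is F (x(i := t))) differentiable at (x i)"
    using F is_n unfolding smooth_on_def by blast+
  have "continuous_map (subtopology (Euclidean_space n) B) euclideanreal (partial_derivs is F)"
    using F'(1) AB continuous_map_from_subtopology_mono by blast
  then show "continuous_map (subtopology (Euclidean_space n) B) euclideanreal (partial_derivs is G)"
    by (rule continuous_map_eq) (use eq in auto)
  fix i x assume i: "i < n" and x: "x \<in> B"
  obtain r where r: "r > 0" "\<And>t. \<bar>t - x i\<bar> < r \<Longrightarrow> x(i := t) \<in> B"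
    using coordinate_line_in_open[OF B x i] by auto
  have "(\<lambda>t. partial_derivs is F (x(i := t))) differentiable at (x i)" using F'(2) i x AB by blast
  then show "(\<lambda>t. partial_derivs is G (x(i := t))) differentiable at (x i)"
    by (rule differentiable_transform_within[OF _ r(1)]) (use r eq in \<open>auto simp: dist_real_def\<close>)
qed

text \<open>The charts are restricted to \<open>Q\<close>, and those that miss \<open>Q\<close> remain as empty charts.\<close>

definition open_submanifold :: "'a smooth_mfd \<Rightarrow> 'a set \<Rightarrow> 'a smooth_mfd" where
  "open_submanifold N Q = \<lparr>mtop = subtopology (mtop N) Q, mdim = mdim N,
     atlas = (\<lambda>c. (fst c \<inter> Q, snd c)) ` atlas N\<rparr>"

text \<open>The coordinate transitions of restricted charts agree with the original ones on the smaller overlap,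
but possibly not outside, since the inverse of a chart has arbitrary values off the chart image; hence
the appeal to \<open>smooth_on_subset_cong\<close>.\<close>

lemma smooth_manifold_open_submanifold:
  assumes N: "smooth_manifold N" and Q: "openin (mtop N) Q"
  shows "smooth_manifold (open_submanifold N Q)"
proof -
  let ?X = "mtop N" and ?n = "mdim N"
  have chart: "is_chart ?n ?X c" if "c \<in> atlas N" for c using N that by (simp add: smooth_manifold_def)
  have oc: "openin ?X (fst c)" if "c \<in> atlas N" for c using chart[OF that] by (simp add: is_chart_def)
  have ch: "is_chart ?n (subtopology ?X Q) (fst c \<inter> Q, snd c)" if c: "c \<in> atlas N" for c
    unfolding is_chart_def fst_conv snd_conv
  proof (intro conjI)
    show "openin (subtopology ?X Q) (fst c \<inter> Q)" using oc[OF c] by (simp add: openin_subtopology_Int)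
    show "openin (Euclidean_space ?n) (chart_image (fst c \<inter> Q, snd c))"
      unfolding chart_image_def fst_conv snd_conv
      by (rule is_chart_openin_image[OF chart[OF c]]) (use oc[OF c] Q in auto)
    have h: "homeomorphic_map (subtopology ?X (fst c)) (subtopology (Euclidean_space ?n) (chart_image c)) (snd c)"
      using chart[OF c] by (simp add: is_chart_def)
    have "homeomorphic_map (subtopology (subtopology ?X (fst c)) (fst c \<inter> Q))
      (subtopology (subtopology (Euclidean_space ?n) (chart_image c)) (snd c ` (fst c \<inter> Q))) (snd c)"
    proof (rule homeomorphic_map_subtopologies[OF h])
      have "fst c \<subseteq> topspace ?X" "chart_image c \<subseteq> topspace (Euclidean_space ?n)"
        using oc[OF c] chart[OF c] openin_subset unfolding is_chart_def by blast+
      then show "snd c ` (topspace (subtopology ?X (fst c)) \<inter> (fst c \<inter> Q)) =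
          topspace (subtopology (Euclidean_space ?n) (chart_image c)) \<inter> snd c ` (fst c \<inter> Q)"
        by (auto simp: chart_image_def)
    qed
    moreover have "subtopology (subtopology ?X (fst c)) (fst c \<inter> Q) = subtopology (subtopology ?X Q) (fst c \<inter> Q)"
      by (simp add: subtopology_subtopology Int_ac)
    moreover have "subtopology (subtopology (Euclidean_space ?n) (chart_image c)) (snd c ` (fst c \<inter> Q)) =
        subtopology (Euclidean_space ?n) (chart_image (fst c \<inter> Q, snd c))"
      by (simp add: subtopology_subtopology chart_image_def Int_absorb1 image_mono)
    ultimately show "homeomorphic_map (subtopology (subtopology ?X Q) (fst c \<inter> Q))
       (subtopology (Euclidean_space ?n) (chart_image (fst c \<inter> Q, snd c))) (snd c)" by simp
  qed
  have sm: "smooth_on ?n (snd c ` (fst c \<inter> Q \<inter> (fst c' \<inter> Q))) (transition (fst c \<inter> Q, snd c) (fst c' \<inter> Q, snd c') i)"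
    if c: "c \<in> atlas N" "c' \<in> atlas N" and i: "i < ?n" for c c' i
  proof (rule smooth_on_subset_cong)
    show "smooth_on ?n (snd c ` (fst c \<inter> fst c')) (transition c c' i)"
      using N c i by (simp add: smooth_manifold_def)
    show "snd c ` (fst c \<inter> Q \<inter> (fst c' \<inter> Q)) \<subseteq> snd c ` (fst c \<inter> fst c')" by auto
    show "openin (Euclidean_space ?n) (snd c ` (fst c \<inter> Q \<inter> (fst c' \<inter> Q)))"
      by (rule is_chart_openin_image[OF chart[OF c(1)]]) (use oc[OF c(1)] oc[OF c(2)] Q in auto)
    fix x assume "x \<in> snd c ` (fst c \<inter> Q \<inter> (fst c' \<inter> Q))"
    then obtain p where p: "x = snd c p" "p \<in> fst c" "p \<in> Q" by auto
    have inj: "inj_on (snd c) (fst c)" "inj_on (snd c) (fst c \<inter> Q)"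
      using is_chart_inj[OF chart[OF c(1)]] by (auto intro: inj_on_subset)
    have "chart_inv c x = p" "chart_inv (fst c \<inter> Q, snd c) x = p"
      using p inj by (auto simp: chart_inv_def)
    then show "transition c c' i x = transition (fst c \<inter> Q, snd c) (fst c' \<inter> Q, snd c') i x"
      by (simp add: transition_def)
  qed
  have "\<Union>(fst ` atlas N) = topspace ?X" using N by (simp add: smooth_manifold_def)
  moreover have "Q \<subseteq> topspace ?X" using Q openin_subset by blast
  ultimately have "(\<Union>c\<in>atlas N. fst c \<inter> Q) = topspace (subtopology ?X Q)" by auto
  then show ?thesis
    using N ch sm unfolding smooth_manifold_def open_submanifold_def
    by (simp add: Hausdorff_space_subtopology second_countable_subtopology)
qed

section \<open>Invariants of maps into a manifold with boundary\<close>

lemma embedding_imp_continuous_map: "embedding_map X Y h \<Longrightarrow> continuous_map X Y h"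
  unfolding embedding_map_def using homeomorphic_imp_continuous_map continuous_map_in_subtopology by blast

text \<open>Invariance of domain: near an interior point, \<open>h\<close> written in charts is an injective continuous map
between open subsets of the same Euclidean space.\<close>

lemma openin_embedding_interior:
  assumes N: "smooth_manifold N" and h: "embedding_map X (mtop N) h"
  shows "openin (mtop N) (h ` manifold_interior (mdim N) X)"
proof (subst openin_subopen, clarify)
  let ?n = "mdim N" and ?E = "Euclidean_space (mdim N)"
  fix x assume "x \<in> manifold_interior ?n X"
  then obtain W H \<phi> \<psi> where W: "x \<in> W" "openin X W" "openin ?E H"
    "homeomorphic_maps (subtopology X W) (subtopology ?E H) \<phi> \<psi>"
    and Wint: "W \<subseteq> manifold_interior ?n X"
    unfolding manifold_interior_def homeomorphic_space_def by blast
  have WX: "W \<subseteq> topspace X" using W(2) openin_subset by blast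
  have HE: "H \<subseteq> topspace ?E" using W(3) openin_subset by blast
  have hc: "continuous_map X (mtop N) h" and hinj: "inj_on h (topspace X)"
    using h homeomorphic_imp_injective_map
    by (auto simp: embedding_map_def intro: embedding_imp_continuous_map)
  have "h x \<in> topspace (mtop N)" using hc W(1) WX continuous_map_image_subset_topspace by blast
  then obtain c where c: "c \<in> atlas N" "h x \<in> fst c" using smooth_manifold_chart_at[OF N] by blast
  have chart: "is_chart ?n (mtop N) c" using N c by (simp add: smooth_manifold_def)
  have oc: "openin (mtop N) (fst c)" using chart by (simp add: is_chart_def)
  have ch: "homeomorphic_map (subtopology (mtop N) (fst c)) (subtopology ?E (chart_image c)) (snd c)"
    using chart by (simp add: is_chart_def)
  have tops: "topspace (subtopology X W) = W" "topspace (subtopology ?E H) = H"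
    using WX HE by auto
  have \<psi>: "continuous_map (subtopology ?E H) (subtopology X W) \<psi>"
    and \<phi>: "continuous_map (subtopology X W) (subtopology ?E H) \<phi>"
    using W(4) by (auto simp: homeomorphic_maps_def)
  have \<psi>W: "\<psi> z \<in> W" if "z \<in> H" for z
    using continuous_map_image_subset_topspace[OF \<psi>] that unfolding tops by blast
  have \<phi>H: "\<phi> x \<in> H"
    using continuous_map_image_subset_topspace[OF \<phi>] W(1) unfolding tops by blast
  have \<phi>\<psi>: "\<And>z. z \<in> H \<Longrightarrow> \<phi> (\<psi> z) = z" and \<psi>\<phi>: "\<psi> (\<phi> x) = x"
    using W(1,4) unfolding homeomorphic_maps_def tops by blast+
  have h\<psi>: "continuous_map (subtopology ?E H) (mtop N) (h \<circ> \<psi>)"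
    using \<psi> by (intro continuous_map_compose[OF _ hc]) (simp add: continuous_map_in_subtopology)
  \<comment> \<open>The part of the Euclidean neighbourhood that \<open>h\<close> maps into the chart \<open>c\<close>.\<close>
  define H' where "H' = {z \<in> H. h (\<psi> z) \<in> fst c}"
  have "openin (subtopology ?E H) H'"
    using openin_continuous_map_preimage[OF h\<psi> oc] HE by (simp add: H'_def Int_absorb1)
  then have H': "openin ?E H'" using W(3) openin_trans_full by blast
  have H'H: "H' \<subseteq> H" by (auto simp: H'_def)
  have "continuous_map (subtopology ?E H') (subtopology (mtop N) (fst c)) (h \<circ> \<psi>)"
    using continuous_map_from_subtopology_mono[OF h\<psi> H'H]
    by (auto simp: continuous_map_in_subtopology H'_def)
  from continuous_map_compose[OF this homeomorphic_imp_continuous_map[OF ch]]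
  have f: "continuous_map (subtopology ?E H') ?E (snd c \<circ> (h \<circ> \<psi>))"
    by (simp add: continuous_map_in_subtopology)
  have "inj_on (snd c \<circ> (h \<circ> \<psi>)) H'"
  proof (intro comp_inj_on)
    show "inj_on \<psi> H'" using \<phi>\<psi> H'H by (metis inj_on_inverseI subsetD)
    show "inj_on h (\<psi> ` H')" using hinj by (rule inj_on_subset) (use \<psi>W H'H WX in blast)
    show "inj_on (snd c) ((h \<circ> \<psi>) ` H')"
      using is_chart_inj[OF chart] by (rule inj_on_subset) (auto simp: H'_def)
  qed
  from invariance_of_domain_Euclidean_space[OF H' f this]
  have "openin ?E (snd c ` ((h \<circ> \<psi>) ` H'))" by (simp add: image_comp)
  then have "openin (subtopology ?E (chart_image c)) (snd c ` ((h \<circ> \<psi>) ` H'))"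
    by (rule subset_openin_subtopology) (auto simp: chart_image_def H'_def)
  moreover have "(h \<circ> \<psi>) ` H' \<subseteq> topspace (subtopology (mtop N) (fst c))"
    using oc openin_subset by (fastforce simp: H'_def)
  ultimately have "openin (subtopology (mtop N) (fst c)) ((h \<circ> \<psi>) ` H')"
    using homeomorphic_map_openness[OF ch] by blast
  then have "openin (mtop N) ((h \<circ> \<psi>) ` H')" using oc openin_trans_full by blast
  moreover have "h x \<in> (h \<circ> \<psi>) ` H'"
    using \<phi>H \<psi>\<phi> c(2) by (intro image_eqI[of _ _ "\<phi> x"]) (auto simp: H'_def)
  moreover have "(h \<circ> \<psi>) ` H' \<subseteq> h ` manifold_interior ?n X"
    using \<psi>W Wint by (auto simp: H'_def)
  ultimately show "\<exists>T. openin (mtop N) T \<and> h x \<in> T \<and> T \<subseteq> h ` manifold_interior ?n X" by blast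
qed

lemma embedding_map_left_inverse:
  assumes h: "embedding_map X Y h" and A: "A \<subseteq> topspace X"
  shows "\<exists>g. embedding_map (subtopology Y (h ` A)) X g \<and> (\<forall>x\<in>topspace X. g (h x) = x)"
proof -
  obtain g where g: "homeomorphic_maps X (subtopology Y (h ` topspace X)) h g"
    using h by (auto simp: embedding_map_def homeomorphic_map_maps)
  then have gh: "g (h x) = x" if "x \<in> topspace X" for x using that by (simp add: homeomorphic_maps_def)
  have hY: "h ` topspace X \<subseteq> topspace Y"
    using h homeomorphic_imp_continuous_map continuous_map_image_subset_topspace
    unfolding embedding_map_def by fastforce
  have "homeomorphic_map (subtopology Y (h ` topspace X)) X g"
    using g homeomorphic_maps_map by blast
  moreover have "g ` (topspace (subtopology Y (h ` topspace X)) \<inter> h ` A) = topspace X \<inter> A"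
  proof -
    have "topspace (subtopology Y (h ` topspace X)) \<inter> h ` A = h ` A" using hY A by auto
    moreover have "g ` h ` A = A" using gh A by (force simp: image_image)
    ultimately show ?thesis using A by auto
  qed
  ultimately have "homeomorphic_map (subtopology (subtopology Y (h ` topspace X)) (h ` A)) (subtopology X A) g"
    by (rule homeomorphic_map_subtopologies)
  moreover have "subtopology (subtopology Y (h ` topspace X)) (h ` A) = subtopology Y (h ` A)"
    using A by (simp add: subtopology_subtopology Int_absorb1 image_mono)
  moreover have "g ` topspace (subtopology Y (h ` A)) = A"
  proof -
    have "topspace (subtopology Y (h ` A)) = h ` A" using hY A by auto
    moreover have "g ` h ` A = A" using gh A by (force simp: image_image)
    ultimately show ?thesis by simp
  qed
  ultimately have "embedding_map (subtopology Y (h ` A)) X g" by (simp add: embedding_map_def)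
  with gh show ?thesis by blast
qed

lemma invariant_of_maps_homotopic:
  "invariant_of_maps B S \<iota> \<Longrightarrow> smooth_manifold N \<Longrightarrow> homotopic_with (\<lambda>_. True) B (mtop N) f1 f2 \<Longrightarrow> \<iota> N f1 = \<iota> N f2"
  unfolding invariant_of_maps_def by blast

lemma invariant_of_maps_embedding:
  "invariant_of_maps B S \<iota> \<Longrightarrow> smooth_manifold N \<Longrightarrow> smooth_manifold L \<Longrightarrow> embedding_map (mtop N) (mtop L) h \<Longrightarrow>
   openin (mtop L) (h ` topspace (mtop N)) \<Longrightarrow> continuous_map B (mtop N) f \<Longrightarrow> \<iota> N f = \<iota> L (h \<circ> f)"
  unfolding invariant_of_maps_def by blast

text \<open>The given map is first pushed into the interior of \<open>X\<close>.  The image of the interior under \<open>h\<close> is an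
open submanifold of \<open>N\<close>, and \<open>h'\<close> composed with the inverse of \<open>h\<close> embeds it as an open subset of \<open>L\<close>.\<close>

lemma invariant_of_maps_transfer:
  fixes N L :: "'a smooth_mfd"
  assumes \<iota>: "invariant_of_maps B S \<iota>" and N: "smooth_manifold N" "mdim N = n" and L: "smooth_manifold L" "mdim L = n"
    and X: "compact_space X" "Hausdorff_space X" "manifold_with_boundary n X"
    and h: "embedding_map X (mtop N) h" and h': "embedding_map X (mtop L) h'"
    and uv: "homotopic_with (\<lambda>_. True) B X u v"
  shows "\<iota> N (h \<circ> u) = \<iota> L (h' \<circ> v)"
proof -
  let ?I = "manifold_interior n X"
  obtain p where p: "homotopic_with (\<lambda>_. True) X X id p" "p ` topspace X \<subseteq> ?I"
    using push_into_interior[OF X] by blast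
  have IX: "?I \<subseteq> topspace X" using openin_subset unfolding manifold_interior_def by blast
  have hc: "continuous_map X (mtop N) h" and hc': "continuous_map X (mtop L) h'"
    using h h' by (auto intro: embedding_imp_continuous_map)
  have u: "continuous_map B X u" and pc: "continuous_map X X p"
    using uv p homotopic_with_imp_continuous_maps by blast+
  define Q where "Q = h ` ?I"
  have Q: "openin (mtop N) Q" unfolding Q_def using openin_embedding_interior[OF N(1) h] N(2) by simp
  have Q': "openin (mtop L) (h' ` ?I)" using openin_embedding_interior[OF L(1) h'] L(2) by simp
  let ?NQ = "open_submanifold N Q"
  have mtopQ: "mtop ?NQ = subtopology (mtop N) Q" by (simp add: open_submanifold_def)
  have topQ: "topspace (mtop ?NQ) = Q" using Q openin_subset by (fastforce simp: mtopQ)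
  have NQ: "smooth_manifold ?NQ" by (rule smooth_manifold_open_submanifold[OF N(1) Q])
  have "\<exists>g. embedding_map (mtop ?NQ) X g \<and> (\<forall>x\<in>topspace X. g (h x) = x)"
    unfolding mtopQ unfolding Q_def by (rule embedding_map_left_inverse[OF h IX])
  then obtain g where g: "embedding_map (mtop ?NQ) X g" "\<And>x. x \<in> topspace X \<Longrightarrow> g (h x) = x"
    by blast
  have "(\<lambda>x. g (h x)) ` ?I = (\<lambda>x. x) ` ?I"
    by (rule image_cong[OF refl]) (use g(2) IX in blast)
  then have gQ: "g ` Q = ?I" by (simp add: Q_def image_image)
  have puI: "p (u x) \<in> ?I" if "x \<in> topspace B" for x
    using p(2) continuous_map_image_subset_topspace[OF u] that by blast
  let ?w = "h \<circ> (p \<circ> u)"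
  have w: "continuous_map B (mtop ?NQ) ?w"
    unfolding mtopQ continuous_map_in_subtopology
  proof
    show "continuous_map B (mtop N) ?w" by (intro continuous_map_compose[OF _ hc] continuous_map_compose[OF u pc])
    show "?w \<in> topspace B \<rightarrow> Q"
      using puI by (simp add: Q_def)
  qed
  have push: "homotopic_with (\<lambda>_. True) B Y (k \<circ> u) (k \<circ> (p \<circ> u))" if "continuous_map X Y k" for Y :: "'a topology" and k
  proof -
    have "homotopic_with (\<lambda>_. True) B X (id \<circ> u) (p \<circ> u)"
      by (rule homotopic_with_compose_continuous_map_right[OF p(1) u]) simp
    then show ?thesis using homotopic_with_compose_continuous_map_left[OF _ that] by fastforce
  qed
  have "\<iota> N (h \<circ> u) = \<iota> N ?w"
    by (rule invariant_of_maps_homotopic[OF \<iota> N(1) push[OF hc]])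
  also have "\<iota> N ?w = \<iota> ?NQ ?w"
    using invariant_of_maps_embedding[OF \<iota> NQ N(1) _ _ w, of id] Q topQ
    by (simp add: embedding_map_def mtopQ)
  also have "\<dots> = \<iota> L ((h' \<circ> g) \<circ> ?w)"
  proof (rule invariant_of_maps_embedding[OF \<iota> NQ L(1) _ _ w])
    show "embedding_map (mtop ?NQ) (mtop L) (h' \<circ> g)" by (rule embedding_map_compose[OF g(1) h'])
    show "openin (mtop L) ((h' \<circ> g) ` topspace (mtop ?NQ))"
      unfolding topQ image_comp[symmetric] gQ by (rule Q')
  qed
  also have "\<dots> = \<iota> L (h' \<circ> v)"
  proof (rule invariant_of_maps_homotopic[OF \<iota> L(1)])
    have "homotopic_with (\<lambda>_. True) B (mtop L) (h' \<circ> (p \<circ> u)) ((h' \<circ> g) \<circ> ?w)"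
    proof (rule homotopic_with_equal)
      show "continuous_map B (mtop L) (h' \<circ> (p \<circ> u))"
        by (intro continuous_map_compose[OF _ hc'] continuous_map_compose[OF u pc])
      show "(h' \<circ> (p \<circ> u)) x = ((h' \<circ> g) \<circ> ?w) x" if "x \<in> topspace B" for x
      proof -
        have "p (u x) \<in> topspace X" using puI[OF that] IX by blast
        then show ?thesis using g(2) by simp
      qed
    qed auto
    moreover have "homotopic_with (\<lambda>_. True) B (mtop L) (h' \<circ> u) (h' \<circ> v)"
      by (rule homotopic_with_compose_continuous_map_left[OF uv hc']) simp
    moreover have "homotopic_with (\<lambda>_. True) B (mtop L) (h' \<circ> u) (h' \<circ> (p \<circ> u))" by (rule push[OF hc'])
    ultimately show "homotopic_with (\<lambda>_. True) B (mtop L) ((h' \<circ> g) \<circ> ?w) (h' \<circ> v)"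
      using homotopic_with_trans homotopic_with_symD by metis
  qed
  finally show ?thesis .
qed

section \<open>Differential calculus in charts\<close>

lemma smooth_onD:
  assumes "smooth_on n A F"
  shows "continuous_map (subtopology (Euclidean_space n) A) euclideanreal F"
    "i < n \<Longrightarrow> continuous_map (subtopology (Euclidean_space n) A) euclideanreal (partial_deriv i F)"
    "i < n \<Longrightarrow> x \<in> A \<Longrightarrow> ((\<lambda>t. F (x(i := t))) has_real_derivative partial_deriv i F x) (at (x i))"
proof -
  show "continuous_map (subtopology (Euclidean_space n) A) euclideanreal F"
    using assms[unfolded smooth_on_def, rule_format, of "[]"] by simp
  show "continuous_map (subtopology (Euclidean_space n) A) euclideanreal (partial_deriv i F)" if "i < n"
    using assms[unfolded smooth_on_def, rule_format, of "[i]"] that by simp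
  show "((\<lambda>t. F (x(i := t))) has_real_derivative partial_deriv i F x) (at (x i))" if "i < n" "x \<in> A"
    using assms[unfolded smooth_on_def, rule_format, of "[]"] that
    by (simp add: partial_deriv_def DERIV_deriv_iff_real_differentiable)
qed

lemma coord_box_mono: "r \<le> s \<Longrightarrow> coord_box n y r \<subseteq> coord_box n y s"
  by (force simp: coord_box_def)

lemma continuous_near_box:
  assumes A: "openin (Euclidean_space n) A" "a \<in> A" and I: "finite I" and e: "e > 0"
    and F: "\<And>i. i \<in> I \<Longrightarrow> continuous_map (subtopology (Euclidean_space n) A) euclideanreal (F i)"
  obtains r where "r > 0" "coord_box n a r \<subseteq> A" "\<And>z i. z \<in> coord_box n a r \<Longrightarrow> i \<in> I \<Longrightarrow> \<bar>F i z - F i a\<bar> < e"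
proof -
  have top: "topspace (subtopology (Euclidean_space n) A) = A"
    using A(1) openin_subset by fastforce
  have o: "openin (Euclidean_space n) {z \<in> A. F i z \<in> ball (F i a) e}" if "i \<in> I" for i
    using openin_continuous_map_preimage[OF F[OF that], of "ball (F i a) e"] A(1) openin_trans_full
    unfolding top by fastforce
  define H where "H = A \<inter> \<Inter>((\<lambda>i. {z \<in> A. F i z \<in> ball (F i a) e}) ` I)"
  have "openin (Euclidean_space n) H"
  proof (cases "I = {}")
    case False
    then show ?thesis unfolding H_def using o A(1) I by (intro openin_Int openin_Inter) auto
  qed (simp add: H_def A)
  moreover have "a \<in> H" using A e by (simp add: H_def)
  ultimately obtain r where "r > 0" "coord_box n a r \<subseteq> H" using openin_Euclidean_contains_box by blast
  moreover have "\<bar>F i z - F i a\<bar> < e" if "z \<in> H" "i \<in> I" for z i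
    using that by (auto simp: H_def dist_real_def abs_minus_commute)
  ultimately show ?thesis by (intro that[of r]) (auto simp: H_def)
qed

text \<open>The mean value theorem is applied to each side of the staircase from \<open>a\<close> to \<open>y\<close> that changes one
coordinate at a time.\<close>

lemma box_increment:
  assumes F: "smooth_on n A F" and A: "coord_box n a r \<subseteq> A" and a: "a \<in> topspace (Euclidean_space n)" "r > 0"
    and y: "y \<in> coord_box n a r"
  shows "\<exists>\<xi>. (\<forall>k<n. \<xi> k \<in> coord_box n a r) \<and> F y - F a = (\<Sum>k<n. (y k - a k) * partial_deriv k F (\<xi> k))"
proof -
  \<comment> \<open>The corners of the staircase.\<close>
  define m where "m k = (\<lambda>i. if i < k then y i else a i)" for k :: nat
  have "\<exists>z. z \<in> coord_box n a r \<and> F (m (Suc k)) - F (m k) = (y k - a k) * partial_deriv k F z" if k: "k < n" for k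
  proof -
    define \<phi> where "\<phi> = (\<lambda>s. F ((m k)(k := s)))"
    have box: "(m k)(k := s) \<in> coord_box n a r" if "s \<in> closed_segment (a k) (y k)" for s
    proof -
      have "\<bar>s - a k\<bar> \<le> \<bar>y k - a k\<bar>" using that by (auto simp: closed_segment_eq_real_ivl split: if_splits)
      then show ?thesis using y a k by (auto simp: m_def coord_box_def topspace_Euclidean_space)
    qed
    have d: "(\<phi> has_real_derivative partial_deriv k F ((m k)(k := s))) (at s)"
      if "s \<in> closed_segment (a k) (y k)" for s
      using smooth_onD(3)[OF F k subsetD[OF A box[OF that]]] by (simp add: \<phi>_def)
    have e: "\<phi> (y k) - \<phi> (a k) = F (m (Suc k)) - F (m k)"
    proof -
      have "(m k)(k := y k) = m (Suc k)" "(m k)(k := a k) = m k" by (auto simp: m_def fun_eq_iff less_Suc_eq)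
      then show ?thesis by (simp add: \<phi>_def)
    qed
    consider "a k < y k" | "a k = y k" | "y k < a k" by linarith
    then show ?thesis
    proof cases
      case 1
      then obtain s where "a k < s" "s < y k" "\<phi> (y k) - \<phi> (a k) = (y k - a k) * partial_deriv k F ((m k)(k := s))"
        using MVT2[of "a k" "y k" \<phi> "\<lambda>s. partial_deriv k F ((m k)(k := s))"] d by (auto simp: closed_segment_eq_real_ivl)
      then show ?thesis using box[of s] e by (auto simp: closed_segment_eq_real_ivl)
    next
      case 2
      then show ?thesis using box[of "a k"] e by (intro exI[of _ "(m k)(k := a k)"]) auto
    next
      case 3
      then obtain s where "y k < s" "s < a k" "\<phi> (a k) - \<phi> (y k) = (a k - y k) * partial_deriv k F ((m k)(k := s))"
        using MVT2[of "y k" "a k" \<phi> "\<lambda>s. partial_deriv k F ((m k)(k := s))"] d by (auto simp: closed_segment_eq_real_ivl)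
      then show ?thesis using box[of s] e 3
        by (intro exI[of _ "(m k)(k := s)"]) (auto simp: closed_segment_eq_real_ivl algebra_simps)
    qed
  qed
  then obtain \<xi> where \<xi>: "\<And>k. k < n \<Longrightarrow> \<xi> k \<in> coord_box n a r"
    "\<And>k. k < n \<Longrightarrow> F (m (Suc k)) - F (m k) = (y k - a k) * partial_deriv k F (\<xi> k)" by metis
  have "m 0 = a" "m n = y"
    using y a by (auto simp: m_def coord_box_def topspace_Euclidean_space fun_eq_iff)
  then have "F y - F a = (\<Sum>k<n. F (m (Suc k)) - F (m k))"
    using sum_lessThan_telescope[of "\<lambda>k. F (m k)" n] by simp
  also have "\<dots> = (\<Sum>k<n. (y k - a k) * partial_deriv k F (\<xi> k))" using \<xi>(2) by (intro sum.cong) auto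
  finally show ?thesis using \<xi>(1) by blast
qed

text \<open>Continuity of the first partial derivatives gives differentiability along every differentiable curve,
not only along coordinate lines.  By \<open>box_increment\<close> the difference quotient of \<open>F\<close> along the curve is the
sum of those of the coordinates, weighted by partial derivatives at points that converge to \<open>x t\<close>.\<close>

lemma smooth_on_chain_rule:
  assumes F: "smooth_on n A F" and A: "openin (Euclidean_space n) A" and t: "t \<in> S" "\<And>s. s \<in> S \<Longrightarrow> x s \<in> A"
    and x: "\<And>i. i < n \<Longrightarrow> ((\<lambda>s. x s i) has_real_derivative D i) (at t within S)"
  shows "((\<lambda>s. F (x s)) has_real_derivative (\<Sum>i<n. D i * partial_deriv i F (x t))) (at t within S)"
proof -
  define a where "a = x t"
  let ?P = "\<lambda>i. partial_deriv i F"
  define q where "q i s = (x s i - a i) / (s - t)" for i s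
  have q: "(q i \<longlongrightarrow> D i) (at t within S)" if "i < n" for i
    using x[OF that] unfolding has_field_derivative_iff q_def a_def .
  have aA: "a \<in> A" using t by (simp add: a_def)
  have aE: "a \<in> topspace (Euclidean_space n)" using aA A openin_subset by blast
  define rest where "rest s = (F (x s) - F a) / (s - t) - (\<Sum>i<n. q i s * ?P i a)" for s
  have "(rest \<longlongrightarrow> 0) (at t within S)"
  proof (rule tendstoI)
    fix e :: real assume e: "e > 0"
    define M where "M = (\<Sum>i<n. \<bar>D i\<bar>) + 1"
    have M: "M > 0" unfolding M_def by (simp add: add_nonneg_pos sum_nonneg)
    obtain r where r: "r > 0" "coord_box n a r \<subseteq> A"
      "\<And>z i. z \<in> coord_box n a r \<Longrightarrow> i \<in> {..<n} \<Longrightarrow> \<bar>?P i z - ?P i a\<bar> < e / M"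
      by (rule continuous_near_box[OF A aA, of "{..<n}" "e / M" ?P])
        (use smooth_onD(2)[OF F] e M in auto)
    have "((\<lambda>s. x s i) \<longlongrightarrow> a i) (at t within S)" if "i < n" for i
      using DERIV_continuous[OF x[OF that]] by (simp add: continuous_within a_def)
    then have "\<forall>\<^sub>F s in at t within S. \<bar>x s i - a i\<bar> < r" if "i < n" for i
      using tendstoD[OF _ r(1)] that by (fastforce simp: dist_real_def)
    then have "\<forall>\<^sub>F s in at t within S. \<forall>i\<in>{..<n}. \<bar>x s i - a i\<bar> < r"
      by (intro eventually_ball_finite) auto
    moreover have "((\<lambda>s. \<Sum>i<n. \<bar>q i s\<bar>) \<longlongrightarrow> (\<Sum>i<n. \<bar>D i\<bar>)) (at t within S)"
      using q by (intro tendsto_sum tendsto_rabs) auto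
    then have "\<forall>\<^sub>F s in at t within S. (\<Sum>i<n. \<bar>q i s\<bar>) < M"
      by (rule order_tendstoD) (simp add: M_def)
    moreover have "\<forall>\<^sub>F s in at t within S. s \<in> S \<and> s \<noteq> t"
      by (simp add: eventually_at_filter)
    ultimately show "\<forall>\<^sub>F s in at t within S. dist (rest s) 0 < e"
    proof eventually_elim
      case (elim s)
      have "x s \<in> topspace (Euclidean_space n)" using t(2) elim A openin_subset by blast
      then have xb: "x s \<in> coord_box n a r" using elim by (auto simp: coord_box_def topspace_Euclidean_space)
      obtain \<xi> where \<xi>: "\<And>k. k < n \<Longrightarrow> \<xi> k \<in> coord_box n a r"
        "F (x s) - F a = (\<Sum>k<n. (x s k - a k) * ?P k (\<xi> k))"
        using box_increment[OF F r(2) aE r(1) xb] by blast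
      have "(F (x s) - F a) / (s - t) = (\<Sum>k<n. q k s * ?P k (\<xi> k))"
        unfolding \<xi>(2) by (simp add: sum_divide_distrib q_def)
      then have "rest s = (\<Sum>k<n. q k s * (?P k (\<xi> k) - ?P k a))"
        by (simp add: rest_def sum_subtractf right_diff_distrib)
      then have "\<bar>rest s\<bar> \<le> (\<Sum>k<n. \<bar>q k s\<bar> * \<bar>?P k (\<xi> k) - ?P k a\<bar>)"
        using sum_abs[of "\<lambda>k. q k s * (?P k (\<xi> k) - ?P k a)"] by (simp add: abs_mult)
      also have "\<dots> \<le> (\<Sum>k<n. \<bar>q k s\<bar> * (e / M))"
        using r(3)[OF \<xi>(1)] by (intro sum_mono mult_left_mono) (auto simp: less_imp_le)
      also have "\<dots> = (\<Sum>k<n. \<bar>q k s\<bar>) * (e / M)" by (rule sum_distrib_right[symmetric])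
      also have "\<dots> < M * (e / M)" using elim e M by (intro mult_strict_right_mono) auto
      also have "\<dots> = e" using M by simp
      finally show ?case by simp
    qed
  qed
  moreover have "((\<lambda>s. \<Sum>i<n. q i s * ?P i a) \<longlongrightarrow> (\<Sum>i<n. D i * ?P i a)) (at t within S)"
    using q by (intro tendsto_sum tendsto_mult_right) auto
  ultimately have "((\<lambda>s. rest s + (\<Sum>i<n. q i s * ?P i a)) \<longlongrightarrow> 0 + (\<Sum>i<n. D i * ?P i a)) (at t within S)"
    by (rule tendsto_add)
  then show ?thesis unfolding has_field_derivative_iff by (simp add: rest_def a_def)
qed

text \<open>The quadratic form of the metric tensor at \<open>p\<close>, in the coordinates of the chart \<open>c\<close>.\<close>

definition metric_form :: "nat \<Rightarrow> 'a metric_tensor \<Rightarrow> 'a chart \<Rightarrow> 'a \<Rightarrow> (nat \<Rightarrow> real) \<Rightarrow> real" where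
  "metric_form n g c p v = (\<Sum>i<n. \<Sum>j<n. g c p i j * v i * v j)"

lemma metric_form_cong: "(\<And>i. i < n \<Longrightarrow> v i = w i) \<Longrightarrow> metric_form n g c p v = metric_form n g c p w"
  unfolding metric_form_def by (intro sum.cong) auto

lemma metric_form_transition:
  assumes g: "riemannian_metric N g" and c: "c \<in> atlas N" "c' \<in> atlas N" and p: "p \<in> fst c \<inter> fst c'"
  shows "metric_form (mdim N) g c p v =
    metric_form (mdim N) g c' p (\<lambda>k. \<Sum>i<mdim N. v i * partial_deriv i (transition c c' k) (snd c p))"
proof -
  let ?n = "mdim N"
  let ?a = "\<lambda>i k. partial_deriv i (transition c c' k) (snd c p)"
  have law: "g c p i j = (\<Sum>k<?n. \<Sum>l<?n. ?a i k * ?a j l * g c' p k l)" if "i < ?n" "j < ?n" for i j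
    using g c p that unfolding riemannian_metric_def by blast
  have "metric_form ?n g c p v = (\<Sum>i<?n. \<Sum>j<?n. (\<Sum>k<?n. \<Sum>l<?n. ?a i k * ?a j l * g c' p k l) * v i * v j)"
    unfolding metric_form_def by (intro sum.cong refl) (simp add: law)
  also have "\<dots> = (\<Sum>i<?n. \<Sum>j<?n. \<Sum>k<?n. \<Sum>l<?n. g c' p k l * (v i * ?a i k) * (v j * ?a j l))"
    by (simp add: sum_distrib_right sum_distrib_left algebra_simps)
  also have "\<dots> = (\<Sum>i<?n. \<Sum>k<?n. \<Sum>j<?n. \<Sum>l<?n. g c' p k l * (v i * ?a i k) * (v j * ?a j l))"
    by (intro sum.cong refl sum.swap)
  also have "\<dots> = (\<Sum>k<?n. \<Sum>i<?n. \<Sum>j<?n. \<Sum>l<?n. g c' p k l * (v i * ?a i k) * (v j * ?a j l))"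
    by (rule sum.swap)
  also have "\<dots> = (\<Sum>k<?n. \<Sum>i<?n. \<Sum>l<?n. \<Sum>j<?n. g c' p k l * (v i * ?a i k) * (v j * ?a j l))"
    by (intro sum.cong refl sum.swap)
  also have "\<dots> = (\<Sum>k<?n. \<Sum>l<?n. \<Sum>i<?n. \<Sum>j<?n. g c' p k l * (v i * ?a i k) * (v j * ?a j l))"
    by (intro sum.cong refl sum.swap)
  also have "\<dots> = metric_form ?n g c' p (\<lambda>k. \<Sum>i<?n. v i * ?a i k)"
    unfolding metric_form_def by (simp add: sum_distrib_right sum_distrib_left algebra_simps)
  finally show ?thesis .
qed

lemma openin_chart_overlap:
  assumes "smooth_manifold N" "c \<in> atlas N" "c' \<in> atlas N"
  shows "openin (Euclidean_space (mdim N)) (snd c ` (fst c \<inter> fst c'))"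
  using assms smooth_manifold_is_chart is_chart_openin
  by (intro is_chart_openin_image[of _ "mtop N"]) blast+

lemma derivative_in_other_chart:
  assumes N: "smooth_manifold N" and c: "c \<in> atlas N" "c' \<in> atlas N"
    and \<gamma>: "t \<in> S" "\<And>s. s \<in> S \<Longrightarrow> \<gamma> s \<in> fst c \<inter> fst c'"
    and D: "\<And>i. i < mdim N \<Longrightarrow> ((\<lambda>s. snd c (\<gamma> s) i) has_real_derivative D i) (at t within S)"
    and k: "k < mdim N"
  shows "((\<lambda>s. snd c' (\<gamma> s) k) has_real_derivative
    (\<Sum>i<mdim N. D i * partial_deriv i (transition c c' k) (snd c (\<gamma> t)))) (at t within S)"
proof -
  let ?A = "snd c ` (fst c \<inter> fst c')"
  have "smooth_on (mdim N) ?A (transition c c' k)" using N c k by (simp add: smooth_manifold_def)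
  then have *: "((\<lambda>s. transition c c' k (snd c (\<gamma> s))) has_real_derivative
    (\<Sum>i<mdim N. D i * partial_deriv i (transition c c' k) (snd c (\<gamma> t)))) (at t within S)"
    by (rule smooth_on_chain_rule[OF _ openin_chart_overlap[OF N c] \<gamma>(1)]) (rule imageI[OF \<gamma>(2)], assumption, rule D)
  have "transition c c' k (snd c (\<gamma> s)) = snd c' (\<gamma> s) k" if "s \<in> S" for s
    using chart_inv_chart[OF smooth_manifold_is_chart[OF N c(1)]] \<gamma>(2)[OF that] by (simp add: transition_def)
  then show ?thesis by (rule has_field_derivative_transform_within[OF * zero_less_one \<gamma>(1)])
qed

lemma pathin_openin_preimage:
  assumes "pathin X \<gamma>" "openin X W"
  shows "openin (top_of_set {0..1}) {s \<in> {0..1}. \<gamma> s \<in> W}" "open {s \<in> {0<..<1}. \<gamma> s \<in> W}"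
proof -
  show *: "openin (top_of_set {0..1}) {s \<in> {0..1}. \<gamma> s \<in> W}"
    using openin_continuous_map_preimage[of "top_of_set {0..1}" X \<gamma> W] assms by (simp add: pathin_def)
  have "{s \<in> {0<..<1}. \<gamma> s \<in> W} = {0<..<1} \<inter> {s \<in> {0..1}. \<gamma> s \<in> W}" by auto
  moreover obtain T where "open T" "{s \<in> {0..1}. \<gamma> s \<in> W} = {0..1} \<inter> T"
    using * by (auto simp: openin_open)
  moreover have "{0<..<1} \<subseteq> {0..1::real}" by auto
  ultimately have "{s \<in> {0<..<1}. \<gamma> s \<in> W} = {0<..<1} \<inter> T" by blast
  then show "open {s \<in> {0<..<1}. \<gamma> s \<in> W}" using \<open>open T\<close> by (simp add: open_Int)
qed

text \<open>The speed is defined through an unspecified chart; by the chain rule and the transformation law of the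
metric tensor it can be computed in any chart.\<close>

lemma speed_in_chart:
  assumes N: "riemannian_manifold N g" and c: "c \<in> atlas N"
    and \<gamma>: "pathin (mtop N) \<gamma>" and t: "t \<in> {0<..<1}" "\<gamma> t \<in> fst c"
    and D: "\<And>i. i < mdim N \<Longrightarrow> ((\<lambda>s. snd c (\<gamma> s) i) has_real_derivative D i) (at t)"
  shows "speed N g \<gamma> t = sqrt (metric_form (mdim N) g c (\<gamma> t) D)"
proof -
  have sm: "smooth_manifold N" and rm: "riemannian_metric N g" using N by (auto simp: riemannian_manifold_def)
  define c0 where "c0 = (SOME c. c \<in> atlas N \<and> \<gamma> t \<in> fst c)"
  have "\<exists>c. c \<in> atlas N \<and> \<gamma> t \<in> fst c" using c t by blast
  from someI_ex[OF this] have c0: "c0 \<in> atlas N" "\<gamma> t \<in> fst c0" by (auto simp: c0_def)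
  define S where "S = {s \<in> {0<..<1}. \<gamma> s \<in> fst c \<inter> fst c0}"
  have "openin (mtop N) (fst c \<inter> fst c0)"
    using smooth_manifold_is_chart[OF sm] is_chart_openin c c0 by blast
  then have S: "open S" unfolding S_def by (rule pathin_openin_preimage(2)[OF \<gamma>])
  have tS: "t \<in> S" using t c0 by (simp add: S_def)
  have "((\<lambda>s. snd c0 (\<gamma> s) k) has_real_derivative
    (\<Sum>i<mdim N. D i * partial_deriv i (transition c c0 k) (snd c (\<gamma> t)))) (at t)" if "k < mdim N" for k
  proof -
    have "((\<lambda>s. snd c0 (\<gamma> s) k) has_real_derivative
      (\<Sum>i<mdim N. D i * partial_deriv i (transition c c0 k) (snd c (\<gamma> t)))) (at t within S)"
      by (rule derivative_in_other_chart[OF sm c c0(1) tS _ _ that])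
        (auto simp: S_def intro: has_field_derivative_at_within D)
    then show ?thesis using at_within_open[OF tS S] by simp
  qed
  then have d: "deriv (\<lambda>s. snd c0 (\<gamma> s) k) t = (\<Sum>i<mdim N. D i * partial_deriv i (transition c c0 k) (snd c (\<gamma> t)))"
    if "k < mdim N" for k using that DERIV_imp_deriv by blast
  have "speed N g \<gamma> t = sqrt (metric_form (mdim N) g c0 (\<gamma> t) (\<lambda>k. deriv (\<lambda>s. snd c0 (\<gamma> s) k) t))"
    by (simp add: speed_def metric_form_def c0_def Let_def)
  also have "\<dots> = sqrt (metric_form (mdim N) g c0 (\<gamma> t) (\<lambda>k. \<Sum>i<mdim N. D i * partial_deriv i (transition c c0 k) (snd c (\<gamma> t))))"
    by (intro arg_cong[of _ _ sqrt] metric_form_cong d)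
  also have "\<dots> = sqrt (metric_form (mdim N) g c (\<gamma> t) D)"
    using metric_form_transition[OF rm c c0(1), of "\<gamma> t" D] t c0 by simp
  finally show ?thesis .
qed

section \<open>Short Riemannian distances in small neighbourhoods\<close>

lemma continuous_on_metric_component:
  assumes N: "riemannian_manifold N g" and c: "c \<in> atlas N" and ij: "i < mdim N" "j < mdim N"
  shows "continuous_map (subtopology (Euclidean_space (mdim N)) (chart_image c)) euclideanreal (\<lambda>z. g c (chart_inv c z) i j)"
    "continuous_on (chart_image c) (\<lambda>z. g c (chart_inv c z) i j)"
proof -
  have "smooth_on (mdim N) (chart_image c) (\<lambda>z. g c (chart_inv c z) i j)"
    using N c ij by (simp add: riemannian_manifold_def riemannian_metric_def)
  then show *: "continuous_map (subtopology (Euclidean_space (mdim N)) (chart_image c)) euclideanreal (\<lambda>z. g c (chart_inv c z) i j)"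
    by (rule smooth_onD)
  have chart: "is_chart (mdim N) (mtop N) c"
    using N c smooth_manifold_is_chart unfolding riemannian_manifold_def by blast
  show "continuous_on (chart_image c) (\<lambda>z. g c (chart_inv c z) i j)"
    using * unfolding subtopology_Euclidean_eq_top_of_set[OF chart_image_subset[OF chart]] by simp
qed

lemma metric_form_le:
  assumes "\<And>i j. i < n \<Longrightarrow> j < n \<Longrightarrow> \<bar>g c p i j\<bar> \<le> G i j" "\<And>i. i < n \<Longrightarrow> \<bar>v i\<bar> \<le> w"
  shows "metric_form n g c p v \<le> (\<Sum>i<n. \<Sum>j<n. G i j) * w\<^sup>2"
proof -
  have "metric_form n g c p v \<le> (\<Sum>i<n. \<Sum>j<n. G i j * w\<^sup>2)"
    unfolding metric_form_def
  proof (intro sum_mono)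
    fix i j assume ij: "i \<in> {..<n}" "j \<in> {..<n}"
    have "g c p i j * v i * v j \<le> \<bar>g c p i j\<bar> * (\<bar>v i\<bar> * \<bar>v j\<bar>)"
      using abs_ge_self[of "g c p i j * v i * v j"] by (simp add: abs_mult mult.assoc)
    also have "\<dots> \<le> G i j * (w * w)"
      using assms ij abs_ge_zero order_trans[OF abs_ge_zero] by (intro mult_mono) (auto intro: order_trans[OF abs_ge_zero])
    finally show "g c p i j * v i * v j \<le> G i j * w\<^sup>2" by (simp add: power2_eq_square)
  qed
  then show ?thesis by (simp add: sum_distrib_right)
qed

text \<open>A bound on the speed is enough, whether or not the speed is integrable: an integral that does not exist
has the value \<open>0\<close>.  The end points are excluded because two-sided derivatives are not available there.\<close>

lemma curve_length_le:
  assumes "\<And>t. t \<in> {0<..<1} \<Longrightarrow> speed N g \<gamma> t \<le> K" "0 \<le> K"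
  shows "curve_length N g \<gamma> \<le> K"
proof (cases "speed N g \<gamma> integrable_on {0..1}")
  case True
  define h where "h t = (if t \<in> {0<..<1} then speed N g \<gamma> t else 0)" for t
  have "(h has_integral curve_length N g \<gamma>) {0..1}"
    by (rule has_integral_spike_finite[of "{0,1}" _ _ "speed N g \<gamma>"])
      (use True in \<open>auto simp: h_def curve_length_def\<close>)
  moreover have "((\<lambda>_. K) has_integral K) {0..1::real}" using has_integral_const_real[of K 0 1] by simp
  ultimately show ?thesis by (rule has_integral_le) (use assms in \<open>auto simp: h_def\<close>)
next
  case False
  then show ?thesis using assms(2) by (simp add: curve_length_def not_integrable_integral)
qed

text \<open>The segment is required to lie in the chart for a little longer than the unit interval, so that its
derivatives at the end points are two-sided.\<close>

lemma straight_curve: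
  assumes N: "smooth_manifold N" and c: "c \<in> atlas N"
    and ab: "\<And>s. s \<in> {-1<..<2} \<Longrightarrow> lin_comb s a b \<in> chart_image c"
  shows "piecewise_C1_curve N (\<lambda>s. chart_inv c (lin_comb s a b))"
    "\<And>t i. t \<in> {-1<..<2} \<Longrightarrow> ((\<lambda>s. snd c (chart_inv c (lin_comb s a b)) i) has_real_derivative b i - a i) (at t)"
proof -
  let ?n = "mdim N"
  define T where "T = {-1<..<2::real}"
  define x where "x s = lin_comb s a b" for s
  define \<gamma> where "\<gamma> = (\<lambda>s. chart_inv c (x s))"
  note chart = smooth_manifold_is_chart[OF N c]
  have xT: "x s \<in> chart_image c" if "s \<in> T" for s using ab that by (simp add: T_def x_def)
  have xc: "continuous_on T x"
    unfolding x_def lin_comb_def by (intro continuous_on_coordinatewise_then_product continuous_intros)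
  have "continuous_map (top_of_set T) (top_of_set (chart_image c)) x"
    using xc xT by (auto simp: continuous_map_in_subtopology)
  moreover have "continuous_map (top_of_set (chart_image c)) (subtopology (mtop N) (fst c)) (chart_inv c)"
    using chart_homeomorphic_maps[OF chart] by (simp add: homeomorphic_maps_def)
  ultimately have "continuous_map (top_of_set T) (subtopology (mtop N) (fst c)) (chart_inv c \<circ> x)"
    by (rule continuous_map_compose)
  moreover have "chart_inv c \<circ> x = \<gamma>" by (simp add: \<gamma>_def fun_eq_iff)
  ultimately have \<gamma>c: "continuous_map (top_of_set T) (mtop N) \<gamma>"
    by (simp add: continuous_map_in_subtopology)
  have \<gamma>T: "\<gamma> s \<in> fst c" "snd c (\<gamma> s) = x s" if "s \<in> T" for s
    using chart_inv_in_chart[OF xT[OF that]] by (simp_all add: \<gamma>_def)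
  have oT: "open T" by (simp add: T_def)
  have d: "((\<lambda>s. snd c (\<gamma> s) i) has_real_derivative b i - a i) (at t)" if "t \<in> T" for t i
  proof (rule has_field_derivative_transform_within_open[OF _ oT that])
    show "((\<lambda>s. x s i) has_real_derivative b i - a i) (at t)"
      unfolding x_def lin_comb_def by (auto intro!: derivative_eq_intros)
  qed (use \<gamma>T in simp)
  show "\<And>t i. t \<in> {-1<..<2} \<Longrightarrow> ((\<lambda>s. snd c (chart_inv c (lin_comb s a b)) i) has_real_derivative b i - a i) (at t)"
    using d by (simp add: \<gamma>_def x_def T_def)
  have "C1_arc_on N \<gamma> 0 1"
    unfolding C1_arc_on_def
  proof (intro ballI allI impI)
    fix c' i assume c': "c' \<in> atlas N" and i: "i < ?n"
    let ?A = "snd c ` (fst c \<inter> fst c')"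
    define D where "D t = (\<Sum>k<?n. (b k - a k) * partial_deriv k (transition c c' i) (x t))" for t
    have A: "?A \<subseteq> topspace (Euclidean_space ?n)"
      using chart_image_subset[OF chart] by (auto simp: chart_image_def)
    have sm: "smooth_on ?n ?A (transition c c' i)" using N c c' i by (simp add: smooth_manifold_def)
    have pd: "continuous_on ?A (partial_deriv k (transition c c' i))" if "k < ?n" for k
      using smooth_onD(2)[OF sm that] subtopology_Euclidean_eq_top_of_set[OF A] by simp
    have "continuous_on {t \<in> {0..1}. \<gamma> t \<in> fst c'} D"
      unfolding D_def
    proof (intro continuous_on_sum continuous_on_mult continuous_on_const)
      fix k assume "k \<in> {..<?n}"
      then have k: "k < ?n" by simp
      show "continuous_on {t \<in> {0..1}. \<gamma> t \<in> fst c'} (\<lambda>t. partial_deriv k (transition c c' i) (x t))"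
      proof (rule continuous_on_compose2[OF pd[OF k]])
        show "continuous_on {t \<in> {0..1}. \<gamma> t \<in> fst c'} x"
          by (rule continuous_on_subset[OF xc]) (auto simp: T_def)
        show "x ` {t \<in> {0..1}. \<gamma> t \<in> fst c'} \<subseteq> ?A"
        proof clarify
          fix t :: real assume t: "t \<in> {0..1}" "\<gamma> t \<in> fst c'"
          then have "t \<in> T" by (simp add: T_def)
          then show "x t \<in> ?A" using \<gamma>T[of t] t(2) by (intro image_eqI[of _ _ "\<gamma> t"]) auto
        qed
      qed
    qed
    moreover have "((\<lambda>s. snd c' (\<gamma> s) i) has_real_derivative D t) (at t within {0..1})"
      if t: "t \<in> {0..1}" "\<gamma> t \<in> fst c'" for t
    proof -
      define S where "S = {s \<in> T. \<gamma> s \<in> fst c'}"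
      have "openin (top_of_set T) S"
        using openin_continuous_map_preimage[OF \<gamma>c is_chart_openin[OF smooth_manifold_is_chart[OF N c']]]
        by (simp add: S_def)
      then have S: "open S" using oT by (simp add: openin_open_eq)
      have tS: "t \<in> S" using t by (simp add: S_def T_def)
      have "((\<lambda>s. snd c (\<gamma> s) k) has_real_derivative b k - a k) (at t within S)" for k
        using d[of t k] tS by (simp add: S_def has_field_derivative_at_within)
      then have "((\<lambda>s. snd c' (\<gamma> s) i) has_real_derivative
        (\<Sum>k<?n. (b k - a k) * partial_deriv k (transition c c' i) (snd c (\<gamma> t)))) (at t within S)"
        by (intro derivative_in_other_chart[OF N c c' tS _ _ i]) (use \<gamma>T in \<open>auto simp: S_def\<close>)
      then show ?thesis
        using at_within_open[OF tS S] \<gamma>T tS by (auto simp: S_def D_def intro: has_field_derivative_at_within)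
    qed
    ultimately show "\<exists>D. continuous_on {t \<in> {0..1}. \<gamma> t \<in> fst c'} D \<and>
      (\<forall>t\<in>{0..1}. \<gamma> t \<in> fst c' \<longrightarrow> ((\<lambda>s. snd c' (\<gamma> s) i) has_real_derivative D t) (at t within {0..1}))"
      by blast
  qed
  moreover have "pathin (mtop N) \<gamma>"
    unfolding pathin_def by (rule continuous_map_from_subtopology_mono[OF \<gamma>c]) (auto simp: T_def)
  ultimately have "piecewise_C1_curve N \<gamma>"
    unfolding piecewise_C1_curve_def by (intro conjI exI[of _ 1] exI[of _ real]) auto
  then show "piecewise_C1_curve N (\<lambda>s. chart_inv c (lin_comb s a b))" by (simp add: \<gamma>_def x_def)
qed

text \<open>The components of the metric tensor are bounded near \<open>p\<close>, so a straight segment of coordinate size \<open>r\<close>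
has length at most a constant times \<open>r\<close>.\<close>

lemma riem_dist_small_near:
  assumes N: "riemannian_manifold N g" and p: "p \<in> topspace (mtop N)" and \<delta>: "\<delta> > 0"
  shows "\<exists>W. openin (mtop N) W \<and> p \<in> W \<and> (\<forall>q\<in>W. riem_dist N g p q < ennreal \<delta>)"
proof -
  let ?n = "mdim N"
  have sm: "smooth_manifold N" using N by (simp add: riemannian_manifold_def)
  obtain c where c: "c \<in> atlas N" "p \<in> fst c" using smooth_manifold_chart_at[OF sm p] by blast
  note chart = smooth_manifold_is_chart[OF sm c(1)]
  define a where "a = snd c p"
  have aA: "a \<in> chart_image c" using c by (simp add: a_def chart_image_def)
  have oA: "openin (Euclidean_space ?n) (chart_image c)" using chart by (simp add: is_chart_def)
  have pa: "chart_inv c a = p" using chart_inv_chart[OF chart c(2)] by (simp add: a_def)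
  obtain r1 where r1: "r1 > 0" "coord_box ?n a r1 \<subseteq> chart_image c"
    "\<And>z ij. z \<in> coord_box ?n a r1 \<Longrightarrow> ij \<in> {..<?n} \<times> {..<?n} \<Longrightarrow>
       \<bar>g c (chart_inv c z) (fst ij) (snd ij) - g c (chart_inv c a) (fst ij) (snd ij)\<bar> < 1"
    by (rule continuous_near_box[OF oA aA, of "{..<?n} \<times> {..<?n}" 1 "\<lambda>ij z. g c (chart_inv c z) (fst ij) (snd ij)"])
      (use continuous_on_metric_component(1)[OF N c(1)] in auto)
  define G where "G i j = \<bar>g c p i j\<bar> + 1" for i j
  define C where "C = (\<Sum>i<?n. \<Sum>j<?n. G i j)"
  have C: "C \<ge> 0" unfolding C_def G_def by (intro sum_nonneg) auto
  have gG: "\<bar>g c (chart_inv c z) i j\<bar> \<le> G i j" if "z \<in> coord_box ?n a r1" "i < ?n" "j < ?n" for z i j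
    using r1(3)[OF that(1), of "(i,j)"] that by (simp add: G_def pa)
  \<comment> \<open>Half of \<open>r1\<close>, because the segments will be prolonged to twice their length.\<close>
  define r where "r = min (r1 / 2) (\<delta> / (2 * (sqrt C + 1)))"
  have sC: "sqrt C + 1 > 0" using C by (simp add: add_nonneg_pos)
  have r: "r > 0" "2 * r \<le> r1" using r1(1) \<delta> sC by (auto simp: r_def)
  have rC: "sqrt C * r < \<delta>"
  proof -
    have "sqrt C * r \<le> (sqrt C + 1) * (\<delta> / (2 * (sqrt C + 1)))"
      using C r \<delta> by (intro mult_mono) (auto simp: r_def)
    also have "\<dots> = \<delta> / 2" using sC by (simp add: field_simps)
    finally show ?thesis using \<delta> by simp
  qed
  define W where "W = {q \<in> fst c. snd c q \<in> coord_box ?n a r}"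
  have bA: "coord_box ?n a r \<subseteq> chart_image c" using r1(2) r coord_box_mono[of r r1] by fastforce
  have "openin (top_of_set (chart_image c)) (coord_box ?n a r)"
    using subset_openin_subtopology[OF openin_coord_box bA]
    by (simp add: subtopology_Euclidean_eq_top_of_set[OF chart_image_subset[OF chart]])
  from chart_restriction(1)[OF is_chart_openin[OF chart] chart_homeomorphic_maps[OF chart] this]
  have W: "openin (mtop N) W" by (simp add: W_def)
  have pW: "p \<in> W" using c(2) r(1) aA chart_image_subset[OF chart] by (auto simp: W_def a_def intro!: centre_in_coord_box)
  have "riem_dist N g p q < ennreal \<delta>" if q: "q \<in> W" for q
  proof -
    define b where "b = snd c q"
    have b: "b \<in> coord_box ?n a r" using q by (simp add: W_def b_def)
    have ab: "lin_comb s a b \<in> coord_box ?n a r1" if s: "s \<in> {-1<..<2}" for s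
    proof -
      have "\<bar>lin_comb s a b i - a i\<bar> < r1" if "i < ?n" for i
      proof -
        have "\<bar>lin_comb s a b i - a i\<bar> = \<bar>s\<bar> * \<bar>b i - a i\<bar>"
          by (simp add: lin_comb_def abs_mult[symmetric] algebra_simps)
        also have "\<dots> \<le> 2 * \<bar>b i - a i\<bar>" using s by (intro mult_right_mono) auto
        also have "\<dots> < 2 * r" using b that by (simp add: coord_box_def)
        finally show ?thesis using r by simp
      qed
      moreover have "lin_comb s a b i = 0" if "i \<ge> ?n" for i
        using that b aA chart_image_subset[OF chart] by (auto simp: lin_comb_def coord_box_def topspace_Euclidean_space)
      ultimately show ?thesis by (simp add: coord_box_def)
    qed
    define \<gamma> where "\<gamma> s = chart_inv c (lin_comb s a b)" for s
    have "\<gamma> = (\<lambda>s. chart_inv c (lin_comb s a b))" by (simp add: \<gamma>_def fun_eq_iff)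
    then have pc: "piecewise_C1_curve N \<gamma>"
      and d: "\<And>t i. t \<in> {-1<..<2} \<Longrightarrow> ((\<lambda>s. snd c (\<gamma> s) i) has_real_derivative b i - a i) (at t)"
      using straight_curve[OF sm c(1), of a b] ab r1(2) by auto
    have path: "pathin (mtop N) \<gamma>" using pc by (simp add: piecewise_C1_curve_def)
    have "speed N g \<gamma> t \<le> sqrt C * r" if t: "t \<in> {0<..<1}" for t
    proof -
      have box: "lin_comb t a b \<in> coord_box ?n a r1" using ab t by simp
      have \<gamma>t: "\<gamma> t \<in> fst c" using chart_inv_in_chart(1) box r1(2) unfolding \<gamma>_def by blast
      have "speed N g \<gamma> t = sqrt (metric_form ?n g c (\<gamma> t) (\<lambda>i. b i - a i))"
        by (rule speed_in_chart[OF N c(1) path t \<gamma>t]) (use d t in auto)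
      also have "\<dots> \<le> sqrt (C * r\<^sup>2)"
        unfolding C_def \<gamma>_def
        by (intro real_sqrt_le_mono metric_form_le gG box) (use b in \<open>auto simp: coord_box_def less_imp_le\<close>)
      also have "\<dots> = sqrt C * r" using r by (simp add: real_sqrt_mult)
      finally show ?thesis .
    qed
    then have "curve_length N g \<gamma> \<le> sqrt C * r" using C r by (intro curve_length_le) auto
    then have "ennreal (curve_length N g \<gamma>) < ennreal \<delta>" using rC \<delta> by (auto simp: ennreal_less_iff ennreal_lessI)
    moreover have "\<gamma> 0 = p" "\<gamma> 1 = q"
      using pa chart_inv_chart[OF chart] q by (auto simp: \<gamma>_def lin_comb_def b_def W_def)
    then have "riem_dist N g p q \<le> ennreal (curve_length N g \<gamma>)"
      unfolding riem_dist_def using pc by (intro INF_lower) auto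
    ultimately show ?thesis by (rule le_less_trans[rotated])
  qed
  with W pW show ?thesis by blast
qed

text \<open>Total boundedness with respect to a distance that may be infinite.\<close>

definition has_finite_nets :: "'a set \<Rightarrow> ('a \<Rightarrow> 'a \<Rightarrow> ennreal) \<Rightarrow> bool" where
  "has_finite_nets X d \<longleftrightarrow> (\<forall>\<delta>>0. \<exists>F. finite F \<and> F \<subseteq> X \<and> (\<forall>x\<in>X. \<exists>p\<in>F. d p x < ennreal \<delta>))"

lemma closed_manifold_has_finite_nets:
  assumes M: "closed_riemannian_manifold M g"
  shows "has_finite_nets (topspace (mtop M)) (riem_dist M g)"
  unfolding has_finite_nets_def
proof (intro allI impI)
  fix \<delta> :: real assume \<delta>: "\<delta> > 0"
  have rm: "riemannian_manifold M g" and cM: "compact_space (mtop M)"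
    using M by (auto simp: closed_riemannian_manifold_def)
  have "\<forall>p\<in>topspace (mtop M). \<exists>W. openin (mtop M) W \<and> p \<in> W \<and> (\<forall>q\<in>W. riem_dist M g p q < ennreal \<delta>)"
    using riem_dist_small_near[OF rm _ \<delta>] by blast
  then obtain W where W: "\<And>p. p \<in> topspace (mtop M) \<Longrightarrow> openin (mtop M) (W p) \<and> p \<in> W p \<and> (\<forall>q\<in>W p. riem_dist M g p q < ennreal \<delta>)"
    by metis
  obtain F where F: "finite F" "F \<subseteq> topspace (mtop M)" "topspace (mtop M) \<subseteq> \<Union>(W ` F)"
    using compact_space_finite_subcover[OF cM, of W] W by blast
  have "\<exists>p\<in>F. riem_dist M g p x < ennreal \<delta>" if "x \<in> topspace (mtop M)" for x
    using that F(2,3) W by blast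
  with F show "\<exists>F. finite F \<and> F \<subseteq> topspace (mtop M) \<and> (\<forall>x\<in>topspace (mtop M). \<exists>p\<in>F. riem_dist M g p x < ennreal \<delta>)"
    by blast
qed

section \<open>Riemannian distances control the topology\<close>

text \<open>Points at a small distance from each other are close in the topology, locally uniformly in the first
point.  On a compact space this becomes uniform: finitely many of the sets \<open>B\<close> cover it.\<close>

definition controls_topology :: "'a topology \<Rightarrow> ('a \<Rightarrow> 'a \<Rightarrow> ennreal) \<Rightarrow> bool" where
  "controls_topology Y d \<longleftrightarrow> (\<forall>W. \<forall>p\<in>W. openin Y W \<longrightarrow>
     (\<exists>B \<epsilon>. openin Y B \<and> p \<in> B \<and> 0 < \<epsilon> \<and> (\<forall>x\<in>B. \<forall>y\<in>topspace Y. d x y < ennreal \<epsilon> \<longrightarrow> y \<in> W)))"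

definition closed_box :: "nat \<Rightarrow> (nat \<Rightarrow> real) \<Rightarrow> real \<Rightarrow> (nat \<Rightarrow> real) set" where
  "closed_box n y r = {z. (\<forall>i\<ge>n. z i = 0) \<and> (\<forall>i<n. \<bar>z i - y i\<bar> \<le> r)}"

lemma compact_closed_box: "compact (closed_box n y r)"
proof -
  let ?S = "\<lambda>i. if i < n then {y i - r..y i + r} else {0::real}"
  have "compactin (powertop_real UNIV) (PiE UNIV ?S)"
    by (auto simp: compactin_PiE)
  moreover have "PiE UNIV ?S = closed_box n y r"
  proof (intro equalityI subsetI)
    fix z assume z: "z \<in> PiE UNIV ?S"
    have "z i \<in> ?S i" for i using PiE_mem[OF z] by blast
    then have "(i < n \<longrightarrow> y i - r \<le> z i \<and> z i \<le> y i + r) \<and> (i \<ge> n \<longrightarrow> z i = 0)" for i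
      by (metis atLeastAtMost_iff linorder_not_less singletonD)
    then show "z \<in> closed_box n y r" by (auto simp: closed_box_def abs_le_iff algebra_simps)
  qed (auto simp: closed_box_def abs_le_iff PiE_UNIV_domain algebra_simps)
  ultimately show ?thesis by (simp add: euclidean_product_topology)
qed

lemma compact_unit_sphere:
  "compact {v \<in> closed_box n (\<lambda>_. 0) 1. \<exists>i<n. \<bar>v i\<bar> = 1}"
proof -
  have "closed (\<Union>i\<in>{..<n}. {v::nat \<Rightarrow> real. \<bar>v i\<bar> = 1})"
    by (intro closed_UN ballI closed_Collect_eq continuous_on_rabs continuous_on_product_coordinates continuous_on_const) auto
  then have "compact (closed_box n (\<lambda>_. 0) 1 \<inter> (\<Union>i\<in>{..<n}. {v::nat \<Rightarrow> real. \<bar>v i\<bar> = 1}))"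
    using compact_closed_box by (rule compact_Int_closed[rotated])
  moreover have "closed_box n (\<lambda>_. 0) 1 \<inter> (\<Union>i\<in>{..<n}. {v::nat \<Rightarrow> real. \<bar>v i\<bar> = 1}) =
      {v \<in> closed_box n (\<lambda>_. 0) 1. \<exists>i<n. \<bar>v i\<bar> = 1}" by auto
  ultimately show ?thesis by simp
qed

lemma metric_form_pos:
  assumes "riemannian_manifold N g" "c \<in> atlas N" "p \<in> fst c" "i < mdim N" "v i \<noteq> 0"
  shows "0 < metric_form (mdim N) g c p v"
  using assms unfolding metric_form_def riemannian_manifold_def riemannian_metric_def by blast

lemma metric_form_nonneg:
  assumes "riemannian_manifold N g" "c \<in> atlas N" "p \<in> fst c"
  shows "0 \<le> metric_form (mdim N) g c p v"
proof (cases "\<exists>i<mdim N. v i \<noteq> 0")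
  case True
  then show ?thesis using metric_form_pos[OF assms] by (auto simp: less_imp_le)
next
  case False
  then show ?thesis by (simp add: metric_form_def)
qed

lemma metric_form_scale: "metric_form n g c p (\<lambda>i. w * v i) = w\<^sup>2 * metric_form n g c p v"
  by (simp add: metric_form_def sum_distrib_left power2_eq_square algebra_simps)

text \<open>A positive continuous function on the compact product of \<open>K\<close> with the unit sphere of the maximum norm
is bounded away from \<open>0\<close>; the general case follows by homogeneity.\<close>

lemma metric_form_lower_bound:
  assumes N: "riemannian_manifold N g" and c: "c \<in> atlas N" and K: "compact K" "K \<subseteq> chart_image c"
  obtains m where "m > 0" "\<And>z v i. z \<in> K \<Longrightarrow> i < mdim N \<Longrightarrow> m * (v i)\<^sup>2 \<le> metric_form (mdim N) g c (chart_inv c z) v"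
proof -
  let ?n = "mdim N"
  define S where "S = {v \<in> closed_box ?n (\<lambda>_. 0) 1. \<exists>i<?n. \<bar>v i\<bar> = 1}"
  define f where "f u = metric_form ?n g c (chart_inv c (fst u)) (snd u)" for u
  show ?thesis
  proof (cases "K \<times> S = {}")
    case True
    have "S \<noteq> {}" if "i < ?n" for i
    proof -
      have "(\<lambda>j. if j = i then 1 else 0) \<in> S" using that by (auto simp: S_def closed_box_def)
      then show ?thesis by blast
    qed
    then show ?thesis using True by (intro that[of 1]) auto
  next
    case False
    have "compact (K \<times> S)" using K(1) compact_unit_sphere unfolding S_def by (rule compact_Times)
    moreover have "continuous_on (K \<times> S) f"
      unfolding f_def metric_form_def
    proof (intro continuous_on_sum continuous_on_mult)
      fix i j assume ij: "i \<in> {..<?n}" "j \<in> {..<?n}"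
      show "continuous_on (K \<times> S) (\<lambda>u. g c (chart_inv c (fst u)) i j)"
        by (rule continuous_on_compose2[OF continuous_on_metric_component(2)[OF N c, of i j] continuous_on_fst[OF continuous_on_id]])
          (use ij K(2) in auto)
      have "continuous_on (K \<times> S) (\<lambda>u. snd u k)" for k
        by (rule continuous_on_compose2[OF continuous_on_product_coordinates[of k] continuous_on_snd[OF continuous_on_id]]) auto
      then show "continuous_on (K \<times> S) (\<lambda>u. snd u i)" "continuous_on (K \<times> S) (\<lambda>u. snd u j)"
        by blast+
    qed
    ultimately obtain u where u: "u \<in> K \<times> S" "\<And>u'. u' \<in> K \<times> S \<Longrightarrow> f u \<le> f u'"
      using continuous_attains_inf[of "K \<times> S" f] False by blast
    define m where "m = f u"
    obtain i0 where i0: "i0 < ?n" "\<bar>snd u i0\<bar> = 1" using u(1) by (auto simp: S_def)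
    have inch: "chart_inv c z \<in> fst c" if "z \<in> K" for z using chart_inv_in_chart(1) K(2) that by blast
    have "snd u i0 \<noteq> 0" using i0(2) by auto
    then have m: "m > 0" unfolding m_def f_def
      using u(1) i0 inch by (intro metric_form_pos[OF N c]) auto
    have "m * (v i)\<^sup>2 \<le> metric_form ?n g c (chart_inv c z) v" if z: "z \<in> K" and i: "i < ?n" for z v i
    proof -
      define w where "w = Max ((\<lambda>j. \<bar>v j\<bar>) ` {..<?n})"
      have fin: "finite ((\<lambda>j. \<bar>v j\<bar>) ` {..<?n})" "(\<lambda>j. \<bar>v j\<bar>) ` {..<?n} \<noteq> {}" using i by auto
      have w: "\<bar>v j\<bar> \<le> w" if "j < ?n" for j using that fin by (auto simp: w_def intro: Max_ge)
      obtain j where j: "j < ?n" "w = \<bar>v j\<bar>" using Max_in[OF fin] by (auto simp: w_def)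
      show ?thesis
      proof (cases "w = 0")
        case True
        then show ?thesis using w[OF i] metric_form_nonneg[OF N c inch[OF z], of v] by simp
      next
        case False
        then have wp: "w > 0" using j by auto
        define v' where "v' k = (if k < ?n then v k / w else 0)" for k
        have "v' \<in> S"
          using w wp j by (auto simp: S_def v'_def closed_box_def abs_mult divide_le_eq_1 intro!: exI[of _ j])
        then have "m \<le> f (z, v')" using u(2) z by (simp add: m_def)
        then have "m * w\<^sup>2 \<le> w\<^sup>2 * f (z, v')" by (simp add: mult_right_mono mult.commute)
        also have "\<dots> = metric_form ?n g c (chart_inv c z) (\<lambda>k. w * v' k)" by (simp add: f_def metric_form_scale)
        also have "\<dots> = metric_form ?n g c (chart_inv c z) v"
          using wp by (intro metric_form_cong) (simp add: v'_def)
        finally have "m * w\<^sup>2 \<le> metric_form ?n g c (chart_inv c z) v" .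
        moreover have "(v i)\<^sup>2 \<le> w\<^sup>2" using power_mono[OF w[OF i] abs_ge_zero, of 2] by simp
        then have "m * (v i)\<^sup>2 \<le> m * w\<^sup>2" using m by simp
        ultimately show ?thesis by linarith
      qed
    qed
    with m show ?thesis using that by blast
  qed
qed

lemma break_points_mono:
  fixes \<tau> :: "nat \<Rightarrow> real"
  assumes "\<And>k. k < m \<Longrightarrow> \<tau> k < \<tau> (Suc k)" "i \<le> j" "j \<le> m"
  shows "\<tau> i \<le> \<tau> j"
  using assms(2,3)
proof (induction rule: dec_induct)
  case (step k)
  then show ?case using assms(1)[of k] by simp
qed simp

lemma continuous_on_chart_path:
  assumes N: "smooth_manifold N" and c: "c \<in> atlas N" and \<gamma>: "pathin (mtop N) \<gamma>"
    and S: "S \<subseteq> {0..1}" "\<gamma> ` S \<subseteq> fst c"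
  shows "continuous_on S (\<lambda>t. snd c (\<gamma> t))"
proof -
  have "continuous_map (top_of_set S) (mtop N) \<gamma>"
    using \<gamma> S(1) continuous_map_from_subtopology_mono unfolding pathin_def by blast
  then have "continuous_map (top_of_set S) (subtopology (mtop N) (fst c)) \<gamma>"
    using S(2) by (auto simp: continuous_map_in_subtopology)
  moreover have "continuous_map (subtopology (mtop N) (fst c)) (top_of_set (chart_image c)) (snd c)"
    using chart_homeomorphic_maps[OF smooth_manifold_is_chart[OF N c]] by (simp add: homeomorphic_maps_def)
  ultimately have "continuous_map (top_of_set S) (top_of_set (chart_image c)) (snd c \<circ> \<gamma>)"
    by (rule continuous_map_compose)
  then show ?thesis by (simp add: continuous_map_in_subtopology o_def)
qed

lemma C1_arc_on_derivatives:
  assumes "C1_arc_on N \<gamma> a b" "c \<in> atlas N"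
  shows "\<exists>D. \<forall>i\<in>{..<mdim N}. continuous_on {t \<in> {a..b}. \<gamma> t \<in> fst c} (D i) \<and>
    (\<forall>t\<in>{a..b}. \<gamma> t \<in> fst c \<longrightarrow> ((\<lambda>s. snd c (\<gamma> s) i) has_real_derivative D i t) (at t within {a..b}))"
  by (rule bchoice) (use assms in \<open>simp add: C1_arc_on_def\<close>)

text \<open>In a chart, the one-sided derivatives of a \<open>C\<^sup>1\<close> arc are continuous up to the end points, so on a short
interval the speed agrees with a continuous function except possibly at the end points of the arc.\<close>

lemma speed_integrable_on_arc:
  assumes N: "riemannian_manifold N g" and \<gamma>: "pathin (mtop N) \<gamma>"
    and ab: "0 \<le> a" "b \<le> 1" and arc: "C1_arc_on N \<gamma> a b"
  shows "speed N g \<gamma> integrable_on {a..b}"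
proof -
  let ?n = "mdim N"
  have sm: "smooth_manifold N" using N by (simp add: riemannian_manifold_def)
  have "\<exists>d>0. \<forall>u v. x \<in> cbox u v \<and> cbox u v \<subseteq> ball x d \<and> cbox u v \<subseteq> cbox a b \<longrightarrow> speed N g \<gamma> integrable_on cbox u v"
    if x: "x \<in> cbox a b" for x
  proof -
    have x01: "x \<in> {0..1}" using x ab by auto
    then have "\<gamma> x \<in> topspace (mtop N)"
      using \<gamma> continuous_map_image_subset_topspace unfolding pathin_def by fastforce
    then obtain c where c: "c \<in> atlas N" "\<gamma> x \<in> fst c" using smooth_manifold_chart_at[OF sm] by blast
    have "openin (top_of_set {0..1}) {s \<in> {0..1}. \<gamma> s \<in> fst c}"
      by (rule pathin_openin_preimage(1)[OF \<gamma> is_chart_openin[OF smooth_manifold_is_chart[OF sm c(1)]]])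
    then obtain d where d: "d > 0" "ball x d \<inter> {0..1} \<subseteq> {s \<in> {0..1}. \<gamma> s \<in> fst c}"
      using x01 c(2) unfolding openin_contains_ball by blast
    obtain D where D': "\<forall>i\<in>{..<?n}. continuous_on {t \<in> {a..b}. \<gamma> t \<in> fst c} (D i) \<and>
        (\<forall>t\<in>{a..b}. \<gamma> t \<in> fst c \<longrightarrow> ((\<lambda>s. snd c (\<gamma> s) i) has_real_derivative D i t) (at t within {a..b}))"
      using C1_arc_on_derivatives[OF arc c(1)] by blast
    have D: "\<And>i. i < ?n \<Longrightarrow> continuous_on {t \<in> {a..b}. \<gamma> t \<in> fst c} (D i)"
      "\<And>i t. i < ?n \<Longrightarrow> t \<in> {a..b} \<Longrightarrow> \<gamma> t \<in> fst c \<Longrightarrow> ((\<lambda>s. snd c (\<gamma> s) i) has_real_derivative D i t) (at t within {a..b})"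
      using D' by simp_all
    have "speed N g \<gamma> integrable_on cbox u v" if uv: "x \<in> cbox u v" "cbox u v \<subseteq> ball x d" "cbox u v \<subseteq> cbox a b" for u v
    proof -
      have in_c: "\<gamma> t \<in> fst c" if "t \<in> {u..v}" for t 
      proof -
        have "t \<in> ball x d \<inter> {0..1}" using uv that ab by auto
        then show ?thesis using d(2) by blast
      qed
      define s where "s t = sqrt (metric_form ?n g c (\<gamma> t) (\<lambda>i. D i t))" for t
      have uv_c: "{u..v} \<subseteq> {t \<in> {a..b}. \<gamma> t \<in> fst c}"
      proof
        fix t assume t: "t \<in> {u..v}"
        then have "t \<in> {a..b}" using uv(3) by (metis cbox_interval subsetD)
        then show "t \<in> {t \<in> {a..b}. \<gamma> t \<in> fst c}" using in_c[OF t] by simp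
      qed
      have cx: "continuous_on {u..v} (\<lambda>t. snd c (\<gamma> t))"
        by (rule continuous_on_chart_path[OF sm c(1) \<gamma>]) (use in_c uv ab in auto)
      have "continuous_on {u..v} s"
        unfolding s_def metric_form_def
      proof (intro continuous_on_real_sqrt continuous_on_sum continuous_on_mult)
        fix i j assume ij: "i \<in> {..<?n}" "j \<in> {..<?n}"
        have "continuous_on {u..v} (\<lambda>t. g c (chart_inv c (snd c (\<gamma> t))) i j)"
          by (rule continuous_on_compose2[OF continuous_on_metric_component(2)[OF N c(1), of i j] cx])
            (use ij in_c in \<open>auto simp: chart_image_def\<close>)
        then show "continuous_on {u..v} (\<lambda>t. g c (\<gamma> t) i j)"
          by (rule continuous_on_eq) (use chart_inv_chart[OF smooth_manifold_is_chart[OF sm c(1)]] in_c in auto)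
        show "continuous_on {u..v} (D i)" "continuous_on {u..v} (D j)"
          using continuous_on_subset[OF D(1) uv_c] ij by simp_all
      qed
      then have "s integrable_on {u..v}" by (rule integrable_continuous_real)
      then have "speed N g \<gamma> integrable_on {u..v}"
      proof (rule integrable_spike_finite[of "{a, b}", rotated 2])
        fix t assume t: "t \<in> {u..v} - {a, b}"
        then have tab: "t \<in> {a<..<b}" using uv(3) by fastforce
        show "speed N g \<gamma> t = s t"
          unfolding s_def
        proof (rule speed_in_chart[OF N c(1) \<gamma>])
          show "t \<in> {0<..<1}" using tab ab by auto
          show "\<gamma> t \<in> fst c" using in_c t by blast
          fix i assume "i < ?n"
          then have "((\<lambda>s. snd c (\<gamma> s) i) has_real_derivative D i t) (at t within {a..b})"
            using D(2) tab in_c t by auto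
          then show "((\<lambda>s. snd c (\<gamma> s) i) has_real_derivative D i t) (at t)"
            using tab by (simp add: at_within_Icc_at)
        qed
      qed simp
      then show ?thesis by simp
    qed
    with d(1) show ?thesis by blast
  qed
  then show ?thesis using integrable_on_little_subintervals[of a b "speed N g \<gamma>"] by simp
qed

text \<open>Integrability is needed for lower bounds of the length, since the length of a curve with a speed that is
not integrable would be \<open>0\<close> by convention.\<close>

lemma speed_integrable:
  assumes N: "riemannian_manifold N g" and \<gamma>: "piecewise_C1_curve N \<gamma>"
  shows "speed N g \<gamma> integrable_on {0..1}"
proof -
  obtain m and \<tau> :: "nat \<Rightarrow> real" where \<tau>: "\<tau> 0 = 0" "\<tau> m = 1"
    "\<And>k. k < m \<Longrightarrow> \<tau> k < \<tau> (Suc k)" "\<And>k. k < m \<Longrightarrow> C1_arc_on N \<gamma> (\<tau> k) (\<tau> (Suc k))"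
    and path: "pathin (mtop N) \<gamma>"
    using \<gamma> unfolding piecewise_C1_curve_def by blast
  note mono = break_points_mono[of m \<tau>, OF \<tau>(3)]
  have "k \<le> m \<Longrightarrow> speed N g \<gamma> integrable_on {0..\<tau> k}" for k
  proof (induction k)
    case (Suc k)
    have k: "0 \<le> \<tau> k" "\<tau> k \<le> \<tau> (Suc k)" "\<tau> (Suc k) \<le> 1"
      using mono[of 0 k] mono[of k "Suc k"] mono[of "Suc k" m] Suc.prems \<tau>(1,2) by auto
    have "C1_arc_on N \<gamma> (\<tau> k) (\<tau> (Suc k))" using \<tau>(4) Suc.prems by simp
    then have arc: "speed N g \<gamma> integrable_on {\<tau> k..\<tau> (Suc k)}"
      by (rule speed_integrable_on_arc[OF N path k(1,3)])
    have "speed N g \<gamma> integrable_on {0..\<tau> k}" using Suc by simp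
    then show ?case by (rule Henstock_Kurzweil_Integration.integrable_combine[OF k(1,2) _ arc])
  qed (use integrable_on_refl[of "speed N g \<gamma>" "0::real"] in \<open>simp add: \<tau>(1)\<close>)
  from this[of m] show ?thesis by (simp add: \<tau>(2))
qed

lemma speed_nonneg:
  assumes N: "riemannian_manifold N g" and t: "\<gamma> t \<in> topspace (mtop N)"
  shows "0 \<le> speed N g \<gamma> t"
proof -
  define c where "c = (SOME c. c \<in> atlas N \<and> \<gamma> t \<in> fst c)"
  have "smooth_manifold N" using N by (simp add: riemannian_manifold_def)
  then have "\<exists>c. c \<in> atlas N \<and> \<gamma> t \<in> fst c" using smooth_manifold_chart_at[OF _ t] by blast
  from someI_ex[OF this] have c: "c \<in> atlas N" "\<gamma> t \<in> fst c" by (auto simp: c_def)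
  have "speed N g \<gamma> t = sqrt (metric_form (mdim N) g c (\<gamma> t) (\<lambda>k. deriv (\<lambda>s. snd c (\<gamma> s) k) t))"
    by (simp add: speed_def metric_form_def c_def Let_def)
  then show ?thesis using metric_form_nonneg[OF N c] by simp
qed

lemma break_point_interval:
  fixes \<tau> :: "nat \<Rightarrow> real"
  shows "\<tau> 0 < t \<Longrightarrow> t < \<tau> m \<Longrightarrow> t \<notin> \<tau> ` {..m} \<Longrightarrow> \<exists>k<m. \<tau> k < t \<and> t < \<tau> (Suc k)"
proof (induction m)
  case (Suc m)
  show ?case
  proof (cases "t < \<tau> m")
    case True
    then obtain k where "k < m" "\<tau> k < t \<and> t < \<tau> (Suc k)" using Suc by (auto simp: atMost_Suc)
    then show ?thesis using less_SucI by blast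
  next
    case False
    then have "\<tau> m < t" using Suc.prems(3) by (metis atMost_iff image_eqI le_SucI linorder_neqE_linordered_idom order_refl)
    then show ?thesis using Suc.prems(2) by blast
  qed
qed simp

text \<open>As long as the curve stays in a chart in which the metric is bounded below by \<open>m\<close>, its speed is at least
\<open>sqrt m\<close> times the derivative of any coordinate in absolute value; integrate up to time \<open>T\<close>.\<close>

lemma displacement_le_curve_length:
  assumes N: "riemannian_manifold N g" and c: "c \<in> atlas N" and \<gamma>: "piecewise_C1_curve N \<gamma>"
    and T: "0 \<le> T" "T \<le> 1" "\<And>t. t \<in> {0..T} \<Longrightarrow> \<gamma> t \<in> fst c" and m: "m \<ge> 0"
    "\<And>t v i. t \<in> {0..T} \<Longrightarrow> i < mdim N \<Longrightarrow> m * (v i)\<^sup>2 \<le> metric_form (mdim N) g c (\<gamma> t) v"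
    and i: "i < mdim N"
  shows "sqrt m * \<bar>snd c (\<gamma> T) i - snd c (\<gamma> 0) i\<bar> \<le> curve_length N g \<gamma>"
proof -
  let ?n = "mdim N"
  have sm: "smooth_manifold N" using N by (simp add: riemannian_manifold_def)
  obtain M and \<tau> :: "nat \<Rightarrow> real" where \<tau>: "\<tau> 0 = 0" "\<tau> M = 1"
    "\<And>k. k < M \<Longrightarrow> \<tau> k < \<tau> (Suc k)" "\<And>k. k < M \<Longrightarrow> C1_arc_on N \<gamma> (\<tau> k) (\<tau> (Suc k))"
    and path: "pathin (mtop N) \<gamma>"
    using \<gamma> unfolding piecewise_C1_curve_def by blast
  define x where "x = (\<lambda>j t. snd c (\<gamma> t) j)"
  define D where "D j t = deriv (x j) t" for j t
  \<comment> \<open>The exceptional times, at which the curve may fail to be differentiable.\<close>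
  define B where "B = \<tau> ` {..M} \<union> {0, T}"
  have B: "finite B" by (simp add: B_def)
  have d: "(x j has_real_derivative D j t) (at t)" if t: "t \<in> {0..T} - B" and j: "j < ?n" for t j
  proof -
    have "0 < t" "t < 1" "t \<notin> \<tau> ` {..M}" using t T(2) by (auto simp: B_def)
    then obtain k where k: "k < M" "\<tau> k < t" "t < \<tau> (Suc k)"
      using break_point_interval[of \<tau> t M] \<tau>(1,2) by auto
    have "\<gamma> t \<in> fst c" using T(3) t by blast
    moreover obtain d where "\<forall>j\<in>{..<?n}. continuous_on {t \<in> {\<tau> k..\<tau> (Suc k)}. \<gamma> t \<in> fst c} (d j) \<and>
        (\<forall>t\<in>{\<tau> k..\<tau> (Suc k)}. \<gamma> t \<in> fst c \<longrightarrow>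
          ((\<lambda>s. snd c (\<gamma> s) j) has_real_derivative d j t) (at t within {\<tau> k..\<tau> (Suc k)}))"
      using C1_arc_on_derivatives[OF \<tau>(4)[OF k(1)] c] by blast
    ultimately have "(x j has_real_derivative d j t) (at t within {\<tau> k..\<tau> (Suc k)})"
      using j k(2,3) unfolding x_def by simp
    then have "(x j has_real_derivative d j t) (at t)" using k by (simp add: at_within_Icc_at)
    then show ?thesis unfolding D_def using DERIV_imp_deriv by metis
  qed
  have "continuous_on {0..T} (\<lambda>t. snd c (\<gamma> t))"
    by (rule continuous_on_chart_path[OF sm c path]) (use T in auto)
  then have "continuous_on {0..T} (x i)"
    unfolding x_def by (rule continuous_on_product_then_coordinatewise)
  then have "(D i has_integral (x i T - x i 0)) {0..T}"
    using d[OF _ i] T(1) B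
    by (intro fundamental_theorem_of_calculus_interior_strong[of B])
      (auto simp: has_real_derivative_iff_has_vector_derivative[symmetric])
  then have D0: "((\<lambda>t. if t \<in> B then 0 else D i t) has_integral (x i T - x i 0)) {0..T}"
    by (rule has_integral_spike_finite[OF B, rotated]) auto
  have int: "speed N g \<gamma> integrable_on {0..1}" by (rule speed_integrable[OF N \<gamma>])
  then have intT: "speed N g \<gamma> integrable_on {0..T}"
    by (rule integrable_on_subinterval) (use T in auto)
  have top: "\<gamma> t \<in> topspace (mtop N)" if "t \<in> {0..1}" for t
    using path that continuous_map_image_subset_topspace unfolding pathin_def by fastforce
  have le: "sqrt m * \<bar>if t \<in> B then 0 else D i t\<bar> \<le> speed N g \<gamma> t" if t: "t \<in> {0..T}" for t
  proof (cases "t \<in> B")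
    case True
    then show ?thesis using speed_nonneg[of N g \<gamma> t] N top t T(2) by auto
  next
    case False
    have "speed N g \<gamma> t = sqrt (metric_form ?n g c (\<gamma> t) (\<lambda>j. D j t))"
    proof (rule speed_in_chart[OF N c path])
      show "t \<in> {0<..<1}" using False t T(2) by (auto simp: B_def order_le_less)
      show "\<gamma> t \<in> fst c" using T(3) t by blast
      show "((\<lambda>s. snd c (\<gamma> s) j) has_real_derivative D j t) (at t)" if "j < ?n" for j
        using d[of t j] that t False by (simp add: x_def)
    qed
    moreover have "sqrt m * \<bar>D i t\<bar> = sqrt (m * (D i t)\<^sup>2)" by (simp add: real_sqrt_mult)
    moreover have "m * (D i t)\<^sup>2 \<le> metric_form ?n g c (\<gamma> t) (\<lambda>j. D j t)" using m(2)[OF t i, of "\<lambda>j. D j t"] by simp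
    ultimately show ?thesis using False by simp
  qed
  have I: "(speed N g \<gamma> has_integral integral {0..T} (speed N g \<gamma>)) {0..T}"
    using intT by (rule integrable_integral)
  have "sqrt m * (x i T - x i 0) \<le> integral {0..T} (speed N g \<gamma>)"
  proof (rule has_integral_le[OF has_integral_mult_right[OF D0, of "sqrt m"] I])
    fix t assume "t \<in> {0..T}"
    from le[OF this] have "sqrt m * \<bar>if t \<in> B then 0 else D i t\<bar> \<le> speed N g \<gamma> t" .
    moreover have "sqrt m * (if t \<in> B then 0 else D i t) \<le> sqrt m * \<bar>if t \<in> B then 0 else D i t\<bar>"
      using m(1) by (intro mult_left_mono) auto
    ultimately show "sqrt m * (if t \<in> B then 0 else D i t) \<le> speed N g \<gamma> t" by linarith
  qed
  moreover have "- sqrt m * (x i T - x i 0) \<le> integral {0..T} (speed N g \<gamma>)"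
  proof (rule has_integral_le[OF has_integral_mult_right[OF D0, of "- sqrt m"] I])
    fix t assume "t \<in> {0..T}"
    from le[OF this] have "sqrt m * \<bar>if t \<in> B then 0 else D i t\<bar> \<le> speed N g \<gamma> t" .
    moreover have "sqrt m * - (if t \<in> B then 0 else D i t) \<le> sqrt m * \<bar>if t \<in> B then 0 else D i t\<bar>"
      using m(1) by (intro mult_left_mono) auto
    ultimately show "- sqrt m * (if t \<in> B then 0 else D i t) \<le> speed N g \<gamma> t" by linarith
  qed
  moreover have "integral {0..T} (speed N g \<gamma>) \<le> curve_length N g \<gamma>"
    unfolding curve_length_def
    by (rule integral_subset_le[OF _ intT int]) (use T top speed_nonneg[of N g \<gamma>] N in auto)
  ultimately show ?thesis by (auto simp: x_def abs_if algebra_simps)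
qed

text \<open>A curve that starts near \<open>p\<close> and ends outside \<open>W\<close> has to leave a closed coordinate box around \<open>p\<close> inside
\<open>W\<close>.  Up to the first exit time it stays in this compact box, where the metric has a positive lower bound,
and some coordinate changes by at least a fixed amount.\<close>

lemma riem_dist_controls_topology:
  assumes N: "riemannian_manifold N g"
  shows "controls_topology (mtop N) (riem_dist N g)"
  unfolding controls_topology_def
proof (intro allI ballI impI)
  fix W p assume p: "p \<in> W" and W: "openin (mtop N) W"
  let ?n = "mdim N"
  have sm: "smooth_manifold N" using N by (simp add: riemannian_manifold_def)
  have "p \<in> topspace (mtop N)" using p W openin_subset by blast
  then obtain c where c: "c \<in> atlas N" "p \<in> fst c" using smooth_manifold_chart_at[OF sm] by blast
  note chart = smooth_manifold_is_chart[OF sm c(1)]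
  define a where "a = snd c p"
  have aE: "a \<in> topspace (Euclidean_space ?n)"
    using chart_image_subset[OF chart] c by (auto simp: a_def chart_image_def)
  have "openin (Euclidean_space ?n) (snd c ` (fst c \<inter> W))"
    by (rule is_chart_openin_image[OF chart]) (use W is_chart_openin[OF chart] in auto)
  moreover have "a \<in> snd c ` (fst c \<inter> W)" using c p by (simp add: a_def)
  ultimately obtain r0 where r0: "r0 > 0" "coord_box ?n a r0 \<subseteq> snd c ` (fst c \<inter> W)"
    using openin_Euclidean_contains_box by blast
  define r where "r = r0 / 2"
  have r: "r > 0" "r < r0" using r0 by (auto simp: r_def)
  define K where "K = closed_box ?n a r"
  have Kbox: "K \<subseteq> coord_box ?n a r0" using r by (force simp: K_def closed_box_def coord_box_def)
  then have KA: "K \<subseteq> chart_image c" using r0(2) by (fastforce simp: chart_image_def)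
  have K: "compact K" by (simp add: K_def compact_closed_box)
  obtain m where m: "m > 0" "\<And>z v i. z \<in> K \<Longrightarrow> i < ?n \<Longrightarrow> m * (v i)\<^sup>2 \<le> metric_form ?n g c (chart_inv c z) v"
    using metric_form_lower_bound[OF N c(1) K KA] by metis
  have ci: "continuous_map (top_of_set (chart_image c)) (mtop N) (chart_inv c)"
    using chart_homeomorphic_maps[OF chart] by (simp add: homeomorphic_maps_def continuous_map_in_subtopology)
  have "compactin (top_of_set (chart_image c)) K"
    using K KA by (simp add: compactin_subtopology)
  then have "compactin (mtop N) (chart_inv c ` K)" using ci by (rule image_compactin)
  moreover have "Hausdorff_space (mtop N)" using sm by (simp add: smooth_manifold_def)
  ultimately have K': "closedin (mtop N) (chart_inv c ` K)" using compactin_imp_closedin by blast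
  define box where "box s = {q \<in> fst c. snd c q \<in> coord_box ?n a s}" for s
  have obox: "openin (mtop N) (box s)" if "s \<le> r0" for s
  proof -
    have "coord_box ?n a s \<subseteq> chart_image c"
      using coord_box_mono[OF that] r0(2) by (fastforce simp: chart_image_def)
    then have "openin (top_of_set (chart_image c)) (coord_box ?n a s)"
      using subset_openin_subtopology[OF openin_coord_box]
      by (metis subtopology_Euclidean_eq_top_of_set[OF chart_image_subset[OF chart]])
    from chart_restriction(1)[OF is_chart_openin[OF chart] chart_homeomorphic_maps[OF chart] this]
    show ?thesis by (simp add: box_def)
  qed
  have K'D: "q \<in> fst c \<and> snd c q \<in> K" if "q \<in> chart_inv c ` K" for q
    using that chart_inv_in_chart KA by fastforce
  have boxK: "box r \<subseteq> chart_inv c ` K"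
  proof
    fix q assume q: "q \<in> box r"
    then have "snd c q \<in> K" by (auto simp: box_def K_def coord_box_def closed_box_def less_imp_le)
    then show "q \<in> chart_inv c ` K"
      using q chart_inv_chart[OF chart] by (intro image_eqI[of _ _ "snd c q"]) (auto simp: box_def)
  qed
  have KW: "chart_inv c ` K \<subseteq> W"
  proof
    fix q assume q: "q \<in> chart_inv c ` K"
    then have "snd c q \<in> snd c ` (fst c \<inter> W)" using K'D Kbox r0(2) by blast
    then obtain q' where "q' \<in> fst c" "q' \<in> W" "snd c q' = snd c q" by auto
    then show "q \<in> W" using is_chart_inj[OF chart] K'D[OF q] by (metis inj_onD)
  qed
  define \<epsilon> where "\<epsilon> = sqrt m * (r / 2)"
  have \<epsilon>: "\<epsilon> > 0" using m(1) r by (simp add: \<epsilon>_def)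
  have far: "\<epsilon> \<le> curve_length N g \<gamma>"
    if \<gamma>: "piecewise_C1_curve N \<gamma>" and \<gamma>0: "\<gamma> 0 \<in> box (r / 2)" and \<gamma>1: "\<gamma> 1 \<notin> W" for \<gamma>
  proof -
    have path: "pathin (mtop N) \<gamma>" using \<gamma> by (simp add: piecewise_C1_curve_def)
    have cpath: "continuous_map (top_of_set {0..1}) (mtop N) \<gamma>" using path by (simp add: pathin_def)
    \<comment> \<open>The first exit time \<open>T\<close> is the least element of the closed set \<open>E\<close>.\<close>
    define E where "E = {t \<in> {0..1}. \<gamma> t \<notin> box r}"
    have "openin (top_of_set {0..1}) {t \<in> {0..1}. \<gamma> t \<in> box r}"
      by (rule pathin_openin_preimage(1)[OF path obox]) (use r in auto)
    then have "closedin (top_of_set {0..1}) ({0..1} - {t \<in> {0..1}. \<gamma> t \<in> box r})"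
      using closedin_diff[OF closedin_topspace[of "top_of_set {0..1::real}"]] by simp
    moreover have "{0..1} - {t \<in> {0..1}. \<gamma> t \<in> box r} = E" by (auto simp: E_def)
    ultimately have cE: "closed E" using closedin_closed_trans by auto
    have E1: "1 \<in> E" using \<gamma>1 boxK KW by (auto simp: E_def)
    have bE: "bdd_below E" by (rule bdd_belowI[of _ 0]) (auto simp: E_def)
    define T where "T = Inf E"
    have TE: "T \<in> E" unfolding T_def using closed_contains_Inf[OF _ bE cE] E1 by blast
    have before: "\<gamma> t \<in> box r" if "0 \<le> t" "t < T" for t
    proof (rule ccontr)
      assume "\<gamma> t \<notin> box r"
      then have "t \<in> E" using that TE by (auto simp: E_def)
      then show False using cInf_lower[OF _ bE, of t] that by (simp add: T_def)
    qed
    have T01: "0 \<le> T" "T \<le> 1" using TE by (auto simp: E_def)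
    have "\<gamma> 0 \<in> box r" using \<gamma>0 coord_box_mono[of "r/2" r] r by (auto simp: box_def)
    then have T0: "0 < T" using TE T01 by (auto simp: E_def order_le_less)
    have inK: "\<gamma> t \<in> chart_inv c ` K" if t: "t \<in> {0..T}" for t
    proof -
      have "closedin (top_of_set {0..1}) {t \<in> topspace (top_of_set {0..1}). \<gamma> t \<in> chart_inv c ` K}"
        by (rule closedin_continuous_map_preimage[OF cpath K'])
      then have "closed {t \<in> {0..1}. \<gamma> t \<in> chart_inv c ` K}" using closedin_closed_trans by auto
      moreover have "{0..<T} \<subseteq> {t \<in> {0..1}. \<gamma> t \<in> chart_inv c ` K}"
        using before boxK T01 by auto
      ultimately have "closure {0..<T} \<subseteq> {t \<in> {0..1}. \<gamma> t \<in> chart_inv c ` K}"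
        by (rule closure_minimal[rotated])
      then show ?thesis using t T0 by (auto simp: closure_atLeastLessThan)
    qed
    have inc: "\<gamma> t \<in> fst c" if "t \<in> {0..T}" for t using K'D inK[OF that] by blast
    have "snd c (\<gamma> T) \<notin> coord_box ?n a r" using TE inc[of T] T01 by (auto simp: E_def box_def)
    moreover have "snd c (\<gamma> T) \<in> topspace (Euclidean_space ?n)"
      using chart_image_subset[OF chart] inc[of T] T01 by (auto simp: chart_image_def)
    ultimately obtain i where i: "i < ?n" "r \<le> \<bar>snd c (\<gamma> T) i - a i\<bar>"
      by (auto simp: coord_box_def topspace_Euclidean_space not_less)
    have "\<bar>snd c (\<gamma> 0) i - a i\<bar> < r / 2" using \<gamma>0 i by (simp add: box_def coord_box_def)
    then have "r / 2 \<le> \<bar>snd c (\<gamma> T) i - snd c (\<gamma> 0) i\<bar>" using i(2) by linarith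
    then have "\<epsilon> \<le> sqrt m * \<bar>snd c (\<gamma> T) i - snd c (\<gamma> 0) i\<bar>"
      unfolding \<epsilon>_def using m(1) by (intro mult_left_mono) auto
    also have "\<dots> \<le> curve_length N g \<gamma>"
    proof (rule displacement_le_curve_length[OF N c(1) \<gamma> T01 inc _ _ i(1)])
      fix t v j assume t: "t \<in> {0..T}" and j: "j < ?n"
      have "chart_inv c (snd c (\<gamma> t)) = \<gamma> t" using chart_inv_chart[OF chart inc[OF t]] .
      then show "m * (v j)\<^sup>2 \<le> metric_form ?n g c (\<gamma> t) v"
        using m(2)[of "snd c (\<gamma> t)" j v] K'D[OF inK[OF t]] j by simp
    qed (use m(1) in auto)
    finally show ?thesis .
  qed
  have "y \<in> W" if x: "x \<in> box (r / 2)" and xy: "riem_dist N g x y < ennreal \<epsilon>" for x y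
  proof (rule ccontr)
    assume "y \<notin> W"
    then have "ennreal \<epsilon> \<le> riem_dist N g x y"
      unfolding riem_dist_def by (intro INF_greatest) (use far x in \<open>auto intro!: ennreal_leI\<close>)
    then show False using xy by simp
  qed
  moreover have "openin (mtop N) (box (r / 2))" using r by (intro obox) auto
  moreover have "p \<in> box (r / 2)" using c(2) r aE by (auto simp: box_def a_def intro!: centre_in_coord_box)
  ultimately show "\<exists>B \<epsilon>. openin (mtop N) B \<and> p \<in> B \<and> 0 < \<epsilon> \<and>
      (\<forall>x\<in>B. \<forall>y\<in>topspace (mtop N). riem_dist N g x y < ennreal \<epsilon> \<longrightarrow> y \<in> W)"
    using \<epsilon> by blast
qed

section \<open>Equicontinuous sequences\<close>

text \<open>Cover \<open>Y\<close> by finitely many small sets and choose a finite net in \<open>X\<close> fine enough for the modulus of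
equicontinuity.  A map \<open>u k\<close> is determined up to closeness by the function that assigns to each point of
the net a small set containing its image.  There are finitely many such functions but infinitely many
non-exceptional indices, so two of these indices share one.\<close>

lemma almost_equicontinuous_close_pair:
  fixes u :: "nat \<Rightarrow> 'x \<Rightarrow> 'y"
  assumes u: "almost_equicontinuous UNIV (\<lambda>_. X) (\<lambda>_. dX) (\<lambda>_. dY) u"
    and nets: "has_finite_nets X dX" and Y: "compact_space Y" and dY: "controls_topology Y dY"
    and uY: "\<And>k. u k ` X \<subseteq> topspace Y"
    and D: "openin (prod_topology Y Y) D" "\<And>z. z \<in> topspace Y \<Longrightarrow> (z, z) \<in> D"
  obtains k l where "k \<noteq> l" "\<And>x. x \<in> X \<Longrightarrow> (u k x, u l x) \<in> D"
proof -
  have "\<exists>W. openin Y W \<and> p \<in> W \<and> W \<times> W \<subseteq> D" if "p \<in> topspace Y" for p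
  proof -
    have "(p, p) \<in> D" using D(2) that .
    then obtain U V where "openin Y U" "openin Y V" "p \<in> U" "p \<in> V" "U \<times> V \<subseteq> D"
      using D(1) unfolding openin_prod_topology_alt by meson
    then show ?thesis by (intro exI[of _ "U \<inter> V"]) auto
  qed
  then obtain W where W: "\<And>p. p \<in> topspace Y \<Longrightarrow> openin Y (W p) \<and> p \<in> W p \<and> W p \<times> W p \<subseteq> D" by metis
  then have "\<exists>B \<epsilon>. openin Y B \<and> p \<in> B \<and> 0 < \<epsilon> \<and> (\<forall>x\<in>B. \<forall>y\<in>topspace Y. dY x y < ennreal \<epsilon> \<longrightarrow> y \<in> W p)"
    if "p \<in> topspace Y" for p using dY that unfolding controls_topology_def by blast
  then obtain B \<epsilon> where B: "\<And>p. p \<in> topspace Y \<Longrightarrow> openin Y (B p) \<and> p \<in> B p \<and> 0 < \<epsilon> p \<and>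
      (\<forall>x\<in>B p. \<forall>y\<in>topspace Y. dY x y < ennreal (\<epsilon> p) \<longrightarrow> y \<in> W p)" by metis
  obtain I where I: "finite I" "I \<subseteq> topspace Y" "topspace Y \<subseteq> \<Union>(B ` I)"
    using compact_space_finite_subcover[OF Y, of B] B by blast
  \<comment> \<open>The element \<open>1\<close> is needed if \<open>Y\<close> is empty.\<close>
  define e where "e = Min (insert 1 (\<epsilon> ` I))"
  have e: "e > 0" "\<And>p. p \<in> I \<Longrightarrow> e \<le> \<epsilon> p" using I B by (auto simp: e_def)
  obtain E \<delta> where E: "finite E" and \<delta>: "\<delta> > 0"
    "\<And>k x x'. k \<notin> E \<Longrightarrow> x \<in> X \<Longrightarrow> x' \<in> X \<Longrightarrow> dX x x' < ennreal \<delta> \<Longrightarrow> dY (u k x) (u k x') < ennreal e"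
    using u e(1) unfolding almost_equicontinuous_def eps_equicontinuous_def
    by (metis Diff_iff UNIV_I)
  obtain F where F: "finite F" "F \<subseteq> X" "\<And>x. x \<in> X \<Longrightarrow> \<exists>p\<in>F. dX p x < ennreal \<delta>"
    using nets \<delta>(1) unfolding has_finite_nets_def by meson
  \<comment> \<open>The combinatorial type of \<open>u k\<close>, to which the pigeonhole principle is applied.\<close>
  define P where "P k = (\<lambda>q\<in>F. SOME p. p \<in> I \<and> u k q \<in> B p)" for k
  have P: "P k q \<in> I \<and> u k q \<in> B (P k q)" if "q \<in> F" for k q
  proof -
    have "\<exists>p. p \<in> I \<and> u k q \<in> B p" using I(3) uY[of k] F(2) that by blast
    from someI_ex[OF this] show ?thesis using that by (simp add: P_def)
  qed
  have "P ` (- E) \<subseteq> F \<rightarrow>\<^sub>E I" using P by (auto simp: P_def)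
  moreover have "finite (F \<rightarrow>\<^sub>E I)" using F(1) I(1) by (rule finite_PiE)
  ultimately have "finite (P ` (- E))" using finite_subset by blast
  moreover have "infinite (- E)" using E by (simp add: finite_compl)
  ultimately have "\<not> inj_on P (- E)" using finite_imageD by blast
  then obtain k l where kl: "k \<notin> E" "l \<notin> E" "k \<noteq> l" "P k = P l" by (auto simp: inj_on_def)
  have "(u k x, u l x) \<in> D" if x: "x \<in> X" for x
  proof -
    obtain q where q: "q \<in> F" "dX q x < ennreal \<delta>" using F(3)[OF x] by blast
    have near: "u j x \<in> W (P j q)" if "j \<notin> E" for j
    proof -
      have "dY (u j q) (u j x) < ennreal e" using \<delta>(2)[OF that _ x q(2)] F(2) q(1) by blast
      also have "\<dots> \<le> ennreal (\<epsilon> (P j q))" using e(2) P[OF q(1)] by (simp add: ennreal_leI)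
      finally show ?thesis using B P[OF q(1)] I(2) uY x by blast
    qed
    have "W (P k q) \<times> W (P k q) \<subseteq> D" using W P[OF q(1)] I(2) by blast
    moreover have "u k x \<in> W (P k q)" "u l x \<in> W (P k q)"
      using near[OF kl(1)] near[OF kl(2)] kl(4) by auto
    ultimately show ?thesis by blast
  qed
  with kl(3) show ?thesis using that by blast
qed

lemma controls_topology_mdist: "controls_topology (mtopology_of V) (\<lambda>x y. ennreal (mdist V x y))"
  unfolding controls_topology_def
proof (intro allI ballI impI)
  fix W p assume p: "p \<in> W" and W: "openin (mtopology_of V) W"
  interpret Metric_space "mspace V" "mdist V" by (rule Metric_space_mspace_mdist)
  have W': "openin mtopology W" using W by (simp add: mtopology_of_def)
  then obtain r where r: "r > 0" "mball p r \<subseteq> W" using p by (auto simp: openin_mtopology)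
  have pV: "p \<in> mspace V" using W p openin_subset by fastforce
  have "y \<in> W" if x: "x \<in> mball p (r / 2)" and y: "y \<in> mspace V" "ennreal (mdist V x y) < ennreal (r / 2)" for x y
  proof -
    have "mdist V x y < r / 2" using y(2) by (simp add: ennreal_less_iff)
    then have "mdist V p y < r" using triangle[of p x y] x y(1) by (auto simp: in_mball)
    then show ?thesis using r(2) y(1) pV by (auto simp: in_mball)
  qed
  moreover have "openin (mtopology_of V) (mball p (r / 2))" by (simp add: mtopology_of_def)
  moreover have "p \<in> mball p (r / 2)" using r(1) pV by simp
  ultimately show "\<exists>B \<epsilon>. openin (mtopology_of V) B \<and> p \<in> B \<and> 0 < \<epsilon> \<and>
      (\<forall>x\<in>B. \<forall>y\<in>topspace (mtopology_of V). ennreal (mdist V x y) < ennreal \<epsilon> \<longrightarrow> y \<in> W)"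
    using r(1) by (intro exI[of _ "mball p (r / 2)"] exI[of _ "r / 2"]) auto
qed

lemma compact_metric_has_finite_nets:
  assumes V: "compact_space (mtopology_of V)"
  shows "has_finite_nets (mspace V) (\<lambda>x y. ennreal (mdist V x y))"
  unfolding has_finite_nets_def
proof (intro allI impI)
  fix \<delta> :: real assume \<delta>: "\<delta> > 0"
  interpret Metric_space "mspace V" "mdist V" by (rule Metric_space_mspace_mdist)
  obtain F where F: "finite F" "F \<subseteq> mspace V" "mspace V \<subseteq> \<Union>((\<lambda>p. mball p \<delta>) ` F)"
    using compact_space_finite_subcover[OF V, of "\<lambda>p. mball p \<delta>"] \<delta> by (auto simp: mtopology_of_def)
  have "\<exists>p\<in>F. ennreal (mdist V p x) < ennreal \<delta>" if "x \<in> mspace V" for x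
    using that F(3) \<delta> by (fastforce simp: in_mball ennreal_less_iff)
  with F show "\<exists>F. finite F \<and> F \<subseteq> mspace V \<and> (\<forall>x\<in>mspace V. \<exists>p\<in>F. ennreal (mdist V p x) < ennreal \<delta>)"
    by blast
qed

lemma almost_equicontinuous_compose:
  assumes f: "almost_equicontinuous I X dX dY f" and h: "almost_equicontinuous I Y dY dZ h"
    and fY: "\<And>\<alpha>. \<alpha> \<in> I \<Longrightarrow> f \<alpha> ` X \<alpha> \<subseteq> Y \<alpha>"
  shows "almost_equicontinuous I X dX dZ (\<lambda>\<alpha>. h \<alpha> \<circ> f \<alpha>)"
  unfolding almost_equicontinuous_def
proof (intro allI impI)
  fix \<epsilon> :: real assume "\<epsilon> > 0"
  then obtain F \<delta> where F: "finite F" "F \<subseteq> I" "\<delta> > 0"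
    "\<And>\<alpha> x x'. \<alpha> \<in> I - F \<Longrightarrow> x \<in> Y \<alpha> \<Longrightarrow> x' \<in> Y \<alpha> \<Longrightarrow> dY \<alpha> x x' < ennreal \<delta> \<Longrightarrow> dZ \<alpha> (h \<alpha> x) (h \<alpha> x') < ennreal \<epsilon>"
    using h unfolding almost_equicontinuous_def eps_equicontinuous_def by metis
  obtain F' \<delta>' where F': "finite F'" "F' \<subseteq> I" "\<delta>' > 0"
    "\<And>\<alpha> x x'. \<alpha> \<in> I - F' \<Longrightarrow> x \<in> X \<alpha> \<Longrightarrow> x' \<in> X \<alpha> \<Longrightarrow> dX \<alpha> x x' < ennreal \<delta>' \<Longrightarrow> dY \<alpha> (f \<alpha> x) (f \<alpha> x') < ennreal \<delta>"
    using f F(3) unfolding almost_equicontinuous_def eps_equicontinuous_def by metis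
  show "\<exists>F. finite F \<and> F \<subseteq> I \<and> eps_equicontinuous \<epsilon> (I - F) X dX dZ (\<lambda>\<alpha>. h \<alpha> \<circ> f \<alpha>)"
    unfolding eps_equicontinuous_def
  proof (intro exI[of _ "F \<union> F'"] conjI exI[of _ \<delta>'] ballI impI)
    fix \<alpha> x x' assume \<alpha>: "\<alpha> \<in> I - (F \<union> F')" and x: "x \<in> X \<alpha>" "x' \<in> X \<alpha>" "dX \<alpha> x x' < ennreal \<delta>'"
    then have "f \<alpha> x \<in> Y \<alpha>" "f \<alpha> x' \<in> Y \<alpha>" using fY by blast+
    then show "dZ \<alpha> ((h \<alpha> \<circ> f \<alpha>) x) ((h \<alpha> \<circ> f \<alpha>) x') < ennreal \<epsilon>"
      using F(4) F'(4) \<alpha> x by simp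
  qed (use F F' in auto)
qed

lemma almost_equicontinuous_reindex:
  fixes s :: "'j \<Rightarrow> 'i"
  assumes f: "almost_equicontinuous UNIV X dX dY f" and s: "inj s"
  shows "almost_equicontinuous UNIV (\<lambda>k. X (s k)) (\<lambda>k. dX (s k)) (\<lambda>k. dY (s k)) (\<lambda>k. f (s k))"
  unfolding almost_equicontinuous_def
proof (intro allI impI)
  fix \<epsilon> :: real assume "\<epsilon> > 0"
  then obtain F where F: "finite F" "eps_equicontinuous \<epsilon> (UNIV - F) X dX dY f"
    using f unfolding almost_equicontinuous_def by blast
  have "finite (s -` F)" using F(1) s by (rule finite_vimageI)
  moreover have "eps_equicontinuous \<epsilon> (UNIV - s -` F) (\<lambda>k. X (s k)) (\<lambda>k. dX (s k)) (\<lambda>k. dY (s k)) (\<lambda>k. f (s k))"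
    using F(2) unfolding eps_equicontinuous_def by (metis DiffD2 DiffI UNIV_I vimageI)
  ultimately show "\<exists>F. finite F \<and> F \<subseteq> UNIV \<and> eps_equicontinuous \<epsilon> (UNIV - F) (\<lambda>k. X (s k)) (\<lambda>k. dX (s k))
      (\<lambda>k. dY (s k)) (\<lambda>k. f (s k))" by blast
qed

lemma infinite_range_injective_sequence:
  fixes F :: "'i \<Rightarrow> 's"
  assumes "infinite (range F)"
  obtains \<sigma> :: "nat \<Rightarrow> 'i" where "inj (\<lambda>k. F (\<sigma> k))"
proof -
  obtain \<phi> :: "nat \<Rightarrow> 's" where \<phi>: "inj \<phi>" "range \<phi> \<subseteq> range F"
    using infinite_countable_subset[OF assms] by blast
  then have "\<forall>k. \<exists>j. F j = \<phi> k" by (metis rangeE rangeI subsetD)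
  then obtain \<sigma> where "\<And>k. F (\<sigma> k) = \<phi> k" by metis
  with \<phi>(1) show ?thesis using that[of \<sigma>] by simp
qed

section \<open>Finiteness of the set of invariants\<close>

theorem proposition5p1:
  fixes M :: "'b smooth_mfd" and gM :: "'b metric_tensor"
    and N :: "nat \<Rightarrow> 'a smooth_mfd" and gN :: "nat \<Rightarrow> 'a metric_tensor"
    and U :: "nat \<Rightarrow> 'a set" and f :: "nat \<Rightarrow> 'b \<Rightarrow> 'a" and n :: nat
    and S :: "'s set" and \<iota> :: "'a smooth_mfd \<Rightarrow> ('b \<Rightarrow> 'a) \<Rightarrow> 's"
  assumes "closed_riemannian_manifold M gM"
    and "\<And>k. riemannian_manifold (N k) (gN k)"
    and "\<And>k. mdim (N k) = n"
    and "\<And>k. continuous_map (mtop M) (mtop (N k)) (f k)"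
    and "\<And>k. compact_domain (N k) (U k)"
    and "\<And>k. f k ` topspace (mtop M) \<subseteq> U k"
    and "uniformly_bounded_geometry n UNIV N gN U"
    and "almost_equicontinuous UNIV (\<lambda>k. topspace (mtop M)) (\<lambda>k. riem_dist M gM)
           (\<lambda>k. riem_dist (N k) (gN k)) f \<or>
         (\<exists>g. (\<forall>k. homotopy_inverse (mtop M) (mtop (N k)) (f k) (g k)) \<and>
              almost_equicontinuous UNIV (\<lambda>k. topspace (mtop (N k)))
                (\<lambda>k. riem_dist (N k) (gN k)) (\<lambda>k. riem_dist M gM) g)"
    and "invariant_of_maps (mtop M) S \<iota>"
  shows "finite (range (\<lambda>k. \<iota> (N k) (f k)))"
proof (rule ccontr)
  let ?F = "\<lambda>k. \<iota> (N k) (f k)" and ?H = "homotopic_with (\<lambda>_. True)"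
  assume "infinite (range ?F)"
  then obtain \<sigma> :: "nat \<Rightarrow> nat" where \<sigma>: "inj (\<lambda>k. ?F (\<sigma> k))" by (rule infinite_range_injective_sequence)
  have "range \<sigma> \<subseteq> UNIV" by simp
  from assms(7)[unfolded uniformly_bounded_geometry_def Let_def, THEN conjunct2, rule_format, OF this]
  obtain r :: "nat \<Rightarrow> nat" and V :: "'a metric" and V' h h' where r: "strict_mono r"
    and conj: "\<forall>k. compact_domain (N (\<sigma> (r k))) (V' k) \<and> U (\<sigma> (r k)) \<subseteq> V' k \<and>
        homeomorphic_maps (mtopology_of V) (subtopology (mtop (N (\<sigma> (r k)))) (V' k)) (h k) (h' k)"
    and hae: "almost_equicontinuous UNIV (\<lambda>k. mspace V) (\<lambda>k x y. ennreal (mdist V x y))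
        (\<lambda>k. riem_dist (N (\<sigma> (r k))) (gN (\<sigma> (r k)))) h"
    and h'ae: "almost_equicontinuous UNIV V' (\<lambda>k. riem_dist (N (\<sigma> (r k))) (gN (\<sigma> (r k))))
        (\<lambda>k x y. ennreal (mdist V x y)) h'"
    by (elim exE conjE) (rule that; assumption)
  have V': "\<And>k. compact_domain (N (\<sigma> (r k))) (V' k)" "\<And>k. U (\<sigma> (r k)) \<subseteq> V' k"
    and hom: "\<And>k. homeomorphic_maps (mtopology_of V) (subtopology (mtop (N (\<sigma> (r k)))) (V' k)) (h k) (h' k)"
    using conj by simp_all
  define s where "s k = \<sigma> (r k)" for k
  note V' = V'[folded s_def] and hom = hom[folded s_def] and hae = hae[folded s_def] and h'ae = h'ae[folded s_def]
  have Finj: "inj (\<lambda>k. ?F (s k))"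
    using inj_compose[OF \<sigma>, of r] strict_mono_on_imp_inj_on[of UNIV r] r by (simp add: o_def s_def)
  then have s: "inj s" by (metis (no_types, lifting) injD injI)
  let ?X = "mtopology_of V"
  have sm: "smooth_manifold (N k)" for k using assms(2)[of k] by (simp add: riemannian_manifold_def)
  have VN: "V' k \<subseteq> topspace (mtop (N (s k)))" for k
    using V'(1)[of k] compactin_subset_topspace by (auto simp: compact_domain_def)
  have topV: "topspace (subtopology (mtop (N (s k))) (V' k)) = V' k" for k using VN by auto
  have XV: "?X homeomorphic_space subtopology (mtop (N (s k))) (V' k)" for k
    using hom homeomorphic_maps_imp_homeomorphic_space by blast
  have "compact_space (subtopology (mtop (N (s 0))) (V' 0))"
    using V'(1)[of 0] compact_space_subtopology by (auto simp: compact_domain_def)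
  then have cX: "compact_space ?X" using XV[of 0] homeomorphic_compact_space by blast
  have hX: "Hausdorff_space ?X"
    unfolding mtopology_of_def by (rule Metric_space.Hausdorff_space_mtopology[OF Metric_space_mspace_mdist])
  have bX: "manifold_with_boundary n ?X"
    using compact_domain_manifold_with_boundary[OF V'(1)[of 0]] assms(3) XV[of 0]
      manifold_with_boundary_homeomorphic homeomorphic_space_sym by metis
  have h_cont: "continuous_map ?X (mtop (N (s k))) (h k)" and h_img: "h k ` mspace V \<subseteq> V' k" for k
    using hom[of k] unfolding homeomorphic_maps_def continuous_map_in_subtopology by (auto simp: image_subset_iff_funcset)
  have h'_cont: "continuous_map (subtopology (mtop (N (s k))) (V' k)) ?X (h' k)" for k
    using hom[of k] by (simp add: homeomorphic_maps_def)
  have hh': "h k (h' k y) = y" if "y \<in> V' k" for k y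
    using hom[of k] that topV unfolding homeomorphic_maps_def by blast
  have h_emb: "embedding_map ?X (mtop (N (s k))) (h k)" for k
  proof -
    have hm: "homeomorphic_map ?X (subtopology (mtop (N (s k))) (V' k)) (h k)"
      using hom homeomorphic_maps_map by blast
    then have "h k ` topspace ?X = V' k" using homeomorphic_imp_surjective_map topV by metis
    with hm show ?thesis by (simp add: embedding_map_def)
  qed
  have fV: "f (s k) ` topspace (mtop M) \<subseteq> V' k" for k using assms(6)[of "s k"] V'(2)[of k] by blast
  define u where "u k = h' k \<circ> f (s k)" for k
  have u: "continuous_map (mtop M) ?X (u k)" for k
    unfolding u_def by (rule continuous_map_compose[OF _ h'_cont])
      (use assms(4) fV in \<open>auto simp: continuous_map_in_subtopology image_subset_iff\<close>)
  have hu: "h k (u k x) = f (s k) x" if "x \<in> topspace (mtop M)" for k x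
  proof -
    have "f (s k) x \<in> V' k" using fV[of k] that by blast
    then show ?thesis by (simp add: u_def hh')
  qed
  \<comment> \<open>The invariant can be read off from the homotopy class in \<open>V\<close>, in any of the manifolds.\<close>
  have \<iota>u: "?F (s k) = \<iota> (N (s l)) (h l \<circ> v)" if "?H (mtop M) ?X (u k) v" for k l v
  proof -
    have "?H (mtop M) (mtop (N (s k))) (f (s k)) (h k \<circ> u k)"
      by (rule homotopic_with_equal) (use hu assms(4) in auto)
    then have "?F (s k) = \<iota> (N (s k)) (h k \<circ> u k)" by (rule invariant_of_maps_homotopic[OF assms(9) sm])
    also have "\<dots> = \<iota> (N (s l)) (h l \<circ> v)"
      by (rule invariant_of_maps_transfer[OF assms(9) sm assms(3) sm assms(3) cX hX bX h_emb h_emb that])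
    finally show ?thesis .
  qed
  have "\<exists>k l. k \<noteq> l \<and> ?F (s k) = ?F (s l)"
    using assms(8)
  proof (elim disjE exE conjE)
    assume "almost_equicontinuous UNIV (\<lambda>k. topspace (mtop M)) (\<lambda>k. riem_dist M gM) (\<lambda>k. riem_dist (N k) (gN k)) f"
    from almost_equicontinuous_compose[OF almost_equicontinuous_reindex[OF this s] h'ae fV]
    have uae: "almost_equicontinuous UNIV (\<lambda>k. topspace (mtop M)) (\<lambda>k. riem_dist M gM) (\<lambda>k x y. ennreal (mdist V x y)) u"
      by (simp add: u_def[abs_def])
    obtain D where D: "openin (prod_topology ?X ?X) D" "\<And>z. z \<in> topspace ?X \<Longrightarrow> (z, z) \<in> D"
      "?H (subtopology (prod_topology ?X ?X) D) ?X fst snd"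
      using locally_equiconnected[OF cX hX manifold_with_boundary_locally_convex[OF bX]] by metis
    obtain k l where kl: "k \<noteq> l" "\<And>x. x \<in> topspace (mtop M) \<Longrightarrow> (u k x, u l x) \<in> D"
      using almost_equicontinuous_close_pair[OF uae closed_manifold_has_finite_nets[OF assms(1)] cX controls_topology_mdist _ D(1,2)]
        continuous_map_image_subset_topspace[OF u] by metis
    have "?H (mtop M) ?X (u k) (u l)" by (rule near_maps_homotopic[OF D(3) u u kl(2)])
    then have "?F (s k) = \<iota> (N (s l)) (h l \<circ> u l)" by (rule \<iota>u)
    also have "\<dots> = ?F (s l)" by (rule \<iota>u[symmetric]) (simp add: u)
    finally show ?thesis using kl(1) by blast
  next
    fix g assume g: "\<forall>k. homotopy_inverse (mtop M) (mtop (N k)) (f k) (g k)"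
      and gae: "almost_equicontinuous UNIV (\<lambda>k. topspace (mtop (N k))) (\<lambda>k. riem_dist (N k) (gN k)) (\<lambda>k. riem_dist M gM) g"
    have cM: "compact_space (mtop M)" and rM: "riemannian_manifold M gM" and smM: "smooth_manifold M"
      using assms(1) by (auto simp: closed_riemannian_manifold_def riemannian_manifold_def)
    have hM: "Hausdorff_space (mtop M)" using smM by (simp add: smooth_manifold_def)
    define w where "w k = g (s k) \<circ> h k" for k
    have gc: "continuous_map (mtop (N (s k))) (mtop M) (g (s k))" for k
      using g by (simp add: homotopy_inverse_def)
    have w: "continuous_map ?X (mtop M) (w k)" for k
      unfolding w_def by (rule continuous_map_compose[OF h_cont gc])
    have hN: "h k ` mspace V \<subseteq> topspace (mtop (N (s k)))" for k using h_img VN by blast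
    from almost_equicontinuous_compose[OF hae almost_equicontinuous_reindex[OF gae s] hN]
    have wae: "almost_equicontinuous UNIV (\<lambda>k. mspace V) (\<lambda>k x y. ennreal (mdist V x y)) (\<lambda>k. riem_dist M gM) w"
      by (simp add: w_def[abs_def])
    obtain D where D: "openin (prod_topology (mtop M) (mtop M)) D" "\<And>z. z \<in> topspace (mtop M) \<Longrightarrow> (z, z) \<in> D"
      "?H (subtopology (prod_topology (mtop M) (mtop M)) D) (mtop M) fst snd"
      using locally_equiconnected[OF cM hM smooth_manifold_locally_convex[OF smM]] by metis
    have wM: "w k ` mspace V \<subseteq> topspace (mtop M)" for k
      using continuous_map_image_subset_topspace[OF w] by simp
    obtain k l where kl: "k \<noteq> l" "\<And>x. x \<in> mspace V \<Longrightarrow> (w k x, w l x) \<in> D"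
      using almost_equicontinuous_close_pair[OF wae compact_metric_has_finite_nets[OF cX] cM riem_dist_controls_topology[OF rM] wM D(1,2)]
      by metis
    have wkl: "?H ?X (mtop M) (w k) (w l)" by (rule near_maps_homotopic[OF D(3) w w]) (use kl in simp)
    let ?L = "mtop (N (s l))"
    have fl: "continuous_map (mtop M) ?L (f (s l))" by (rule assms(4))
    have "?H (mtop M) (mtop M) (g (s k) \<circ> f (s k)) (w k \<circ> u k)"
      by (rule homotopic_with_equal) (use hu continuous_map_compose[OF assms(4) gc] in \<open>auto simp: w_def\<close>)
    moreover have "?H (mtop M) (mtop M) (g (s k) \<circ> f (s k)) id" using g by (simp add: homotopy_inverse_def)
    moreover have "?H (mtop M) (mtop M) (w k \<circ> u k) (w l \<circ> u k)"
      by (rule homotopic_with_compose_continuous_map_right[OF wkl u]) simp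
    ultimately have "?H (mtop M) (mtop M) id (w l \<circ> u k)"
      using homotopic_with_trans homotopic_with_symD by metis
    from homotopic_with_compose_continuous_map_left[OF this fl, of "\<lambda>_. True"]
    have "?H (mtop M) ?L (f (s l)) ((f (s l) \<circ> g (s l)) \<circ> (h l \<circ> u k))" by (simp add: w_def o_assoc)
    moreover have "?H (mtop M) ?L ((f (s l) \<circ> g (s l)) \<circ> (h l \<circ> u k)) (id \<circ> (h l \<circ> u k))"
      by (rule homotopic_with_compose_continuous_map_right[of "\<lambda>_. True" ?L ?L])
        (use g continuous_map_compose[OF u h_cont] in \<open>auto simp: homotopy_inverse_def\<close>)
    ultimately have "?H (mtop M) ?L (f (s l)) (h l \<circ> u k)" using homotopic_with_trans by fastforce
    then have "?F (s l) = \<iota> (N (s l)) (h l \<circ> u k)" by (rule invariant_of_maps_homotopic[OF assms(9) sm])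
    also have "\<dots> = ?F (s k)" by (rule \<iota>u[symmetric]) (simp add: u)
    finally show ?thesis using kl(1) by metis
  qed
  then show False using Finj by (metis (no_types, lifting) injD)
qed

end
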